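(* Let $m,n\ge 1$ be integers, let $w_1,\dots,w_m\in A_1$ and $v\in A_\infty$ be weights on $\mathbb{R}^n$, and put $\nu=w_1^{1/m}\cdots w_m^{1/m}$. Then there is a finite constant $C$ (independent of $f_1,\dots,f_m$) such that for all $f_i\in L^1(w_i)$, $i=1,\dots,m$, $$\left\| \frac{\prod_{i=1}^m Mf_i}{v}\right\|_{L^{\frac1m,\infty}(\nu v^{1/m})}\le C\prod_{i=1}^m\|f_i\|_{L^1(w_i)}.$$
   Context: A weight is a nonnegative locally integrable function on $\mathbb{R}^n$ that is positive a.e. $A_1$ and $A_\infty$ are the usual Muckenhoupt classes on $\mathbb{R}^n$. $Mf(x)=\sup_{Q\ni x}\frac1{|Q|}\int_Q|f|$ is the Hardy–Littlewood maximal function, the supremum being over all cubes $Q$ containing $x$. $\|f\|_{L^1(w)}=\int_{\mathbb{R}^n}|f|\,w\,dx$. For $0<p<\infty$ and a nonnegative function $\mu$ on $\mathbb{R}^n$, $\|g\|_{L^{p,\infty}(\mu)}=\sup_{\lambda>0}\lambda\,\big(\mu(\{x:|g(x)|>\lambda\})\big)^{1/p}$, where $\mu(E)=\int_E\mu(x)\,dx$. *)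

theory Defs
  imports "HOL-Analysis.Analysis"
begin

definition cube :: "(real ^ 'n) set \<Rightarrow> bool" where
  "cube Q \<longleftrightarrow> (\<exists>a l. 0 < l \<and> Q = cbox a (\<chi> i. a $ i + l))"

definition weight :: "(real ^ 'n \<Rightarrow> real) \<Rightarrow> bool" where
  "weight w \<longleftrightarrow> (\<forall>x. 0 \<le> w x) \<and> (AE x in lebesgue. 0 < w x) \<and>
    (\<forall>K. compact K \<longrightarrow> w absolutely_integrable_on K)"

definition average :: "(real ^ 'n) set \<Rightarrow> (real ^ 'n \<Rightarrow> ennreal) \<Rightarrow> ennreal" where
  "average Q g = (\<integral>\<^sup>+x\<in>Q. g x \<partial>lebesgue) / emeasure lebesgue Q"

definition HL_maximal :: "(real ^ 'n \<Rightarrow> 'b::real_normed_vector) \<Rightarrow> real ^ 'n \<Rightarrow> ennreal" where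
  "HL_maximal f x = (SUP Q\<in>{Q. cube Q \<and> x \<in> Q}. average Q (\<lambda>y. ennreal (norm (f y))))"

text \<open>Real powers on \<open>[0, \<infinity>]\<close>, meant for positive exponents only: \<open>\<infinity>\<close> to any power is \<open>\<infinity>\<close>.\<close>

definition ennpowr :: "ennreal \<Rightarrow> real \<Rightarrow> ennreal" where
  "ennpowr x a = (if x = \<infinity> then \<infinity> else ennreal (enn2real x powr a))"

definition A1_weight :: "(real ^ 'n \<Rightarrow> real) \<Rightarrow> bool" where
  "A1_weight w \<longleftrightarrow> weight w \<and>
    (\<exists>C<\<infinity>. AE x in lebesgue. HL_maximal w x \<le> C * ennreal (w x))"

text \<open>The exponent \<open>- 1 / (p - 1)\<close> is \<open>1 - p'\<close> for the conjugate exponent \<open>p'\<close> of \<open>p\<close>.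
  The value \<open>0 powr (- 1 / (p - 1)) = 0\<close> is harmless, since a weight vanishes only on a null set.\<close>

definition Ap_weight :: "real \<Rightarrow> (real ^ 'n \<Rightarrow> real) \<Rightarrow> bool" where
  "Ap_weight p w \<longleftrightarrow> 1 < p \<and> weight w \<and>
    (\<exists>C<\<infinity>. \<forall>Q. cube Q \<longrightarrow>
      average Q (\<lambda>x. ennreal (w x)) *
      ennpowr (average Q (\<lambda>x. ennreal (w x powr (- 1 / (p - 1))))) (p - 1) \<le> C)"

definition Ainfty_weight :: "(real ^ 'n \<Rightarrow> real) \<Rightarrow> bool" where
  "Ainfty_weight w \<longleftrightarrow> (\<exists>p>1. Ap_weight p w)"

definition L1_norm :: "(real ^ 'n \<Rightarrow> real) \<Rightarrow> (real ^ 'n \<Rightarrow> 'b::real_normed_vector) \<Rightarrow> ennreal" where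
  "L1_norm w f = (\<integral>\<^sup>+x. ennreal (norm (f x) * w x) \<partial>lebesgue)"

definition L1_space :: "(real ^ 'n \<Rightarrow> real) \<Rightarrow> (real ^ 'n \<Rightarrow> 'b::real_normed_vector) set" where
  "L1_space w = {f \<in> borel_measurable lebesgue. L1_norm w f < \<infinity>}"

text \<open>The function \<open>g\<close> takes values in \<open>[0, \<infinity>]\<close>; it stands for \<open>\<bar>g\<bar>\<close> in the usual definition.\<close>

definition weak_Lp_norm ::
  "real \<Rightarrow> (real ^ 'n \<Rightarrow> real) \<Rightarrow> (real ^ 'n \<Rightarrow> ennreal) \<Rightarrow> ennreal" where
  "weak_Lp_norm p \<mu> g = (SUP t\<in>{0<..}. ennreal t *
    ennpowr (\<integral>\<^sup>+x\<in>{x. ennreal t < g x}. ennreal (\<mu> x) \<partial>lebesgue) (1 / p))"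

end

theory Submission
  imports Defs
begin

text \<open>
Throughout, \<open>u\<close> is an \<open>A\<^sub>1\<close> weight, \<open>v\<close> an \<open>A\<^sub>\<infinity>\<close> weight, \<open>|E|\<close> the volume of \<open>E\<close>, \<open>u(E)\<close> its mass
under \<open>u\<close>, and \<open>3I\<close> the triple of a dyadic cube \<open>I\<close>.

The maximal operator is replaced by a dyadic one: \<open>dmax f x\<close> is the supremum of the averages of \<open>f\<close> over
the dyadic cubes \<open>I\<close> with \<open>x \<in> 3I\<close>. It dominates \<open>HL_maximal\<close> up to the factor \<open>6 ^ n\<close>
(\<open>HL_maximal_le_dmax\<close>), and its superlevel sets are covered by the triples of the maximal dyadic cubes
at the same height.

The core is \<open>mixed_weak_type_dmax\<close>, the case of one function: the integral of \<open>u * v\<close> over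
\<open>{v < dmax f}\<close> is at most a constant times the integral of \<open>f * u\<close>. Put \<open>a = 2 * 2 ^ n\<close>, and let \<open>S\<^sub>k\<close> be the maximal dyadic
cubes on which the average of \<open>f\<close> exceeds \<open>a ^ k\<close>. A point of the superlevel set with
\<open>a ^ k < v \<le> a ^ (k + 1)\<close> lies in \<open>3I\<close> for some \<open>I\<close> in \<open>S\<^sub>k\<close>, so the integral is at most the sum of
\<open>a ^ (k + 1) * u(3I \<inter> {a ^ k < v \<le> a ^ (k + 1)})\<close> over all \<open>k\<close> and all \<open>I\<close> in \<open>S\<^sub>k\<close>. The cubes are sorted
by the integers \<open>l\<close> and \<open>j\<close> for which the average of \<open>v\<close> over \<open>3I\<close> is about \<open>a ^ (k + l)\<close> and the average
of \<open>u\<close> is about \<open>2 ^ j\<close>.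

For large \<open>|l|\<close> the values of \<open>v\<close> near \<open>a ^ k\<close> are untypical on \<open>3I\<close>. The set where they occur has
a volume exponentially small in \<open>|l|\<close>, and the \<open>A\<^sub>1\<close> property turns this into a factor for \<open>u\<close> that
decays exponentially (\<open>A1_cond_decay\<close>, \<open>mass_stratum_le\<close>). Hence it suffices to bound the sum for fixed \<open>l\<close>
without this gain. For fixed \<open>l\<close> and \<open>j\<close> the terms \<open>a ^ k * u(3I)\<close> are about \<open>2 ^ j * a ^ (- l) * v(3I)\<close>, and
\<open>v(3I)\<close> is comparable with the \<open>v\<close>-mass of the part of \<open>I\<close> that is missed by the cubes of \<open>S\<^sub>k\<^sub>+\<^sub>1\<close>. These
parts are disjoint. So the sum is bounded by a multiple of \<open>2 ^ j\<close> times the integral of \<open>f\<close> over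
the union of the cubes in question (\<open>stopping_class_sum\<close>). On that union \<open>2 ^ j\<close> is below a multiple of
\<open>u\<close>, and the sum over \<open>j\<close> is geometric (\<open>class_level_sum\<close>).

The passage to several functions rests on the fact that the constant for one function depends on the
weights through their \<open>A\<^sub>1\<close> and \<open>A\<^sub>\<infinity>\<close> constants only. On \<open>3I\<close>, \<open>dmax f\<close> exceeds \<open>c\<close> times any of its values there
on a set of proportion at most a multiple of \<open>1 / c\<close> (\<open>dmax_local_distribution\<close>). Therefore the weights
\<open>v\<^sub>i = v / (\<Prod>j \<noteq> i. dmax f\<^sub>j)\<close> are \<open>A\<^sub>\<infinity>\<close> weights with constants that do not depend on the functions
(\<open>Ainf_cond_divide_dmax\<close>), and the inequality for one function applies to \<open>w\<^sub>i\<close>, \<open>v\<^sub>i\<close> and \<open>f\<^sub>i\<close>. On the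
layer \<open>\<tau> * v < (\<Prod>i. dmax f\<^sub>i) \<le> 2 * \<tau> * v\<close> the density \<open>\<nu> * v powr (1 / m)\<close> is dominated by the geometric
mean of the \<open>\<tau> * w\<^sub>i * v\<^sub>i\<close>, up to a power of \<open>\<tau>\<close>. The inequality of arithmetic and geometric means then
combines the \<open>m\<close> estimates (\<open>mixed_layer_bound\<close>), and summing over \<open>\<tau> = 2 ^ k * t\<close> gives the theorem for
bounded functions with bounded support. Monotone convergence does the rest.
\<close>

section \<open>Dyadic cubes\<close>

type_synonym 'n cube_index = "int \<times> (int ^ 'n)"

text \<open>The index \<open>(k, z)\<close> stands for the half-open cube of side \<open>2 ^ k\<close> with lower corner
\<open>2 ^ k * z\<close>. Comparing integer parts makes \<open>block r p\<close> the concentric half-open cube that is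
\<open>2 * r + 1\<close> times as wide, and a union of dyadic cubes of the same generation.\<close>

definition block :: "int \<Rightarrow> ('n::finite) cube_index \<Rightarrow> (real ^ 'n) set" where
  "block r p = {x. \<forall>i. \<bar>\<lfloor>x $ i / 2 powi fst p\<rfloor> - snd p $ i\<bar> \<le> r}"

abbreviation dyadic :: "('n::finite) cube_index \<Rightarrow> (real ^ 'n) set" where
  "dyadic \<equiv> block 0"

abbreviation triple :: "('n::finite) cube_index \<Rightarrow> (real ^ 'n) set" where
  "triple \<equiv> block 1"

definition cell :: "int \<Rightarrow> real ^ 'n::finite \<Rightarrow> 'n cube_index" where
  "cell k x = (k, \<chi> i. \<lfloor>x $ i / 2 powi k\<rfloor>)"

definition ancestor :: "nat \<Rightarrow> ('n::finite) cube_index \<Rightarrow> 'n cube_index" where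
  "ancestor m p = (fst p + int m, \<chi> i. snd p $ i div 2 ^ m)"

lemma countable_cube_index: "countable (A :: 'n::finite cube_index set)"
  by (rule countableI_type)

lemma mem_dyadic_iff: "x \<in> dyadic p \<longleftrightarrow> p = cell (fst p) x"
  by (auto simp: block_def cell_def vec_eq_iff prod_eq_iff)

lemma mem_dyadic_cell [simp]: "x \<in> dyadic (cell k x)"
  by (simp add: mem_dyadic_iff cell_def)

lemma fst_cell [simp]: "fst (cell k x) = k"
  by (simp add: cell_def)

lemma block_mono: "r \<le> s \<Longrightarrow> block r p \<subseteq> block s p"
  unfolding block_def by (auto intro: order_trans)

lemma floor_div_ancestor:
  fixes x :: real
  shows "\<lfloor>x / 2 powi (k + int m)\<rfloor> = \<lfloor>x / 2 powi k\<rfloor> div 2 ^ m"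
proof -
  have "x / 2 powi (k + int m) = (x / 2 powi k) / real_of_int (2 ^ m)"
    by (simp add: power_int_add field_simps)
  then show ?thesis
    by (metis floor_divide_real_eq_div zero_le_numeral zero_le_power)
qed

lemma ancestor_0 [simp]: "ancestor 0 p = p"
  by (simp add: ancestor_def prod_eq_iff vec_eq_iff)

lemma fst_ancestor [simp]: "fst (ancestor m p) = fst p + int m"
  by (simp add: ancestor_def)

lemma ancestor_ancestor: "ancestor m (ancestor l p) = ancestor (m + l) p"
  by (simp add: ancestor_def vec_eq_iff prod_eq_iff zdiv_zmult2_eq power_add mult.commute)

lemma ancestor_cell: "ancestor m (cell k x) = cell (k + int m) x"
  by (simp add: ancestor_def cell_def vec_eq_iff floor_div_ancestor)

lemma dyadic_subset_ancestor: "dyadic p \<subseteq> dyadic (ancestor m p)"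
proof
  fix x assume "x \<in> dyadic p"
  then have "ancestor m p = cell (fst p + int m) x"
    by (metis mem_dyadic_iff ancestor_cell)
  then show "x \<in> dyadic (ancestor m p)" by simp
qed

lemma dyadic_meet_ancestor:
  assumes "x \<in> dyadic p" "x \<in> dyadic q" "fst p \<le> fst q"
  shows "q = ancestor (nat (fst q - fst p)) p"
  using assms by (metis mem_dyadic_iff ancestor_cell add_diff_cancel_left' diff_ge_0_iff_ge diff_add_cancel add.commute int_nat_eq)

lemma dyadic_nested:
  assumes "x \<in> dyadic p" "x \<in> dyadic q" "fst p \<le> fst q"
  shows "dyadic p \<subseteq> dyadic q"
  using dyadic_meet_ancestor[OF assms] dyadic_subset_ancestor by metis

text \<open>Membership in a block of generation \<open>k\<close> depends on the generation \<open>k\<close> cell of the point only,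
and a finer dyadic cube lies in one cell.\<close>

lemma dyadic_subset_block:
  assumes "x \<in> dyadic q" "x \<in> block r p" "fst q \<le> fst p"
  shows "dyadic q \<subseteq> block r p"
proof
  fix y assume y: "y \<in> dyadic q"
  have "cell (fst p) y = cell (fst p) x"
  proof -
    have "dyadic q \<subseteq> dyadic (cell (fst p) x)"
      using assms by (intro dyadic_nested[of x]) auto
    then show ?thesis using y mem_dyadic_iff[of y "cell (fst p) x"] by (metis fst_cell subsetD)
  qed
  then have "\<lfloor>y $ i / 2 powi fst p\<rfloor> = \<lfloor>x $ i / 2 powi fst p\<rfloor>" for i
    by (simp add: cell_def vec_eq_iff)
  then show "y \<in> block r p" using assms(2) by (simp add: block_def)
qed

lemma int_div_near:
  fixes a b :: int
  assumes "\<bar>a - b\<bar> \<le> c" "c \<le> d"  "0 < d"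
  shows "\<bar>a div d - b div d\<bar> \<le> 1"
proof -
  have "a div d \<le> (b + d) div d" "b div d \<le> (a + d) div d"
    by (rule zdiv_mono1; use assms in linarith)+
  then show ?thesis using assms by auto
qed

text \<open>Dividing the indices by \<open>2 ^ m\<close> brings integers at distance at most \<open>2 ^ m\<close> to distance at most
one. In this way every bounded neighbourhood of a cube is absorbed by the triple of an ancestor.\<close>

lemma block_subset_triple_ancestor:
  assumes "r \<le> 2 ^ m"
  shows "block r p \<subseteq> triple (ancestor m p)"
proof
  fix x assume x: "x \<in> block r p"
  have "\<bar>\<lfloor>x $ i / 2 powi fst p\<rfloor> div 2 ^ m - snd p $ i div 2 ^ m\<bar> \<le> 1" for i
    using x assms int_div_near[of "\<lfloor>x $ i / 2 powi fst p\<rfloor>" "snd p $ i" r "2 ^ m"] by (auto simp: block_def)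
  then show "x \<in> triple (ancestor m p)"
    by (simp add: block_def ancestor_def floor_div_ancestor)
qed

lemma triple_subset_triple_ancestor: "triple p \<subseteq> triple (ancestor m p)"
  by (rule block_subset_triple_ancestor) simp

lemma mem_block_iff:
  "x \<in> block r p \<longleftrightarrow> (\<forall>i. real_of_int (snd p $ i - r) * 2 powi fst p \<le> x $ i \<and>
     x $ i < real_of_int (snd p $ i + r + 1) * 2 powi fst p)"
proof -
  have "\<bar>\<lfloor>t / s\<rfloor> - z\<bar> \<le> r \<longleftrightarrow> real_of_int (z - r) * s \<le> t \<and> t < real_of_int (z + r + 1) * s"
    if "0 < s" for t s :: real and z
  proof -
    have "\<bar>\<lfloor>t / s\<rfloor> - z\<bar> \<le> r \<longleftrightarrow> z - r \<le> \<lfloor>t / s\<rfloor> \<and> \<lfloor>t / s\<rfloor> < z + r + 1" by auto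
    also have "\<dots> \<longleftrightarrow> real_of_int (z - r) \<le> t / s \<and> t / s < real_of_int (z + r + 1)"
      by (simp only: le_floor_iff floor_less_iff)
    also have "\<dots> \<longleftrightarrow> real_of_int (z - r) * s \<le> t \<and> t < real_of_int (z + r + 1) * s"
      using that by (simp only: pos_le_divide_eq pos_divide_less_eq)
    finally show ?thesis .
  qed
  then show ?thesis by (simp add: block_def)
qed

lemma dyadic_coordinate_near:
  assumes "x \<in> dyadic q" "y \<in> dyadic q"
  shows "\<bar>y $ i - x $ i\<bar> < 2 powi fst q"
proof -
  have "real_of_int (snd q $ i) * 2 powi fst q \<le> x $ i" "x $ i < real_of_int (snd q $ i + 1) * 2 powi fst q"
    "real_of_int (snd q $ i) * 2 powi fst q \<le> y $ i" "y $ i < real_of_int (snd q $ i + 1) * 2 powi fst q"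
    using assms by (simp_all add: mem_block_iff)
  then show ?thesis by (simp add: algebra_simps abs_less_iff)
qed

definition block_lo :: "int \<Rightarrow> ('n::finite) cube_index \<Rightarrow> real ^ 'n" where
  "block_lo r p = (\<chi> i. real_of_int (snd p $ i - r) * 2 powi fst p)"

lemma emeasure_cbox_cube:
  fixes a :: "real ^ 'n"
  assumes "0 \<le> l"
  shows "emeasure lebesgue (cbox a (\<chi> i. a $ i + l)) = ennreal (l ^ CARD('n))"
proof -
  have "emeasure lebesgue (cbox a (\<chi> i. a $ i + l)) = emeasure lborel (cbox a (\<chi> i. a $ i + l))"
    by simp
  also have "\<dots> = ennreal (l ^ CARD('n))"
    using assms
    by (simp add: emeasure_lborel_cbox_eq Basis_vec_def cart_eq_inner_axis[symmetric] inner_axis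
      prod.UNION_disjoint axis_eq_axis)
  finally show ?thesis .
qed

lemma sets_block [measurable]: "block r p \<in> sets lebesgue"
proof -
  have "block r p = (\<Inter>i. {x. real_of_int (snd p $ i - r) * 2 powi fst p \<le> x $ i} \<inter>
     {x. x $ i < real_of_int (snd p $ i + r + 1) * 2 powi fst p})"
    by (auto simp: mem_block_iff)
  also have "\<dots> \<in> sets borel" by measurable
  finally show ?thesis by auto
qed

lemma block_subset_cbox:
  "block r p \<subseteq> cbox (block_lo r p) (\<chi> i. block_lo r p $ i + (2 * real_of_int r + 1) * 2 powi fst p)"
proof
  fix x assume "x \<in> block r p"
  then have "real_of_int (snd p $ i - r) * 2 powi fst p \<le> x $ i"
    "x $ i < real_of_int (snd p $ i + r + 1) * 2 powi fst p" for i
    by (simp_all add: mem_block_iff)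
  then have "block_lo r p $ i \<le> x $ i" "x $ i \<le> block_lo r p $ i + (2 * real_of_int r + 1) * 2 powi fst p" for i
    by (auto simp: block_lo_def algebra_simps intro: less_imp_le)
  then show "x \<in> cbox (block_lo r p) (\<chi> i. block_lo r p $ i + (2 * real_of_int r + 1) * 2 powi fst p)"
    by (simp add: mem_box_cart)
qed

lemma emeasure_block:
  fixes p :: "'n::finite cube_index"
  assumes "0 \<le> r"
  shows "emeasure lebesgue (block r p) = ennreal (((2 * real_of_int r + 1) * 2 powi fst p) ^ CARD('n))"
proof (rule antisym)
  let ?l = "(2 * real_of_int r + 1) * 2 powi fst p :: real"
  let ?a = "block_lo r p"
  let ?b = "\<chi> i. ?a $ i + ?l"
  have l: "0 < ?l" using assms by simp
  show "emeasure lebesgue (block r p) \<le> ennreal (?l ^ CARD('n))"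
    using l block_subset_cbox[of r p] by (metis emeasure_cbox_cube emeasure_mono less_imp_le lmeasurable_cbox fmeasurableD)
  have "box ?a ?b \<subseteq> block r p"
  proof
    fix x assume "x \<in> box ?a ?b"
    then have "?a $ i < x $ i" "x $ i < ?a $ i + ?l" for i
      by (simp_all add: mem_box_cart)
    then show "x \<in> block r p"
      by (auto simp: mem_block_iff block_lo_def algebra_simps intro: less_imp_le)
  qed
  then have "emeasure lebesgue (box ?a ?b) \<le> emeasure lebesgue (block r p)"
    by (intro emeasure_mono) auto
  moreover have "emeasure lebesgue (box ?a ?b) = emeasure lebesgue (cbox ?a ?b)"
  proof -
    have *: "\<forall>b\<in>Basis. ?a \<bullet> b \<le> ?b \<bullet> b"
      using l by (auto simp: Basis_vec_def inner_axis)
    then show ?thesis by (simp add: emeasure_lborel_cbox_eq emeasure_lborel_box_eq)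
  qed
  ultimately show "ennreal (?l ^ CARD('n)) \<le> emeasure lebesgue (block r p)"
    using l emeasure_cbox_cube[of ?l ?a] by (metis less_imp_le)
qed

section \<open>A dyadic maximal function and its Calderon-Zygmund cubes\<close>

definition vol :: "('n::finite) cube_index \<Rightarrow> real" where
  "vol p = (2 powi fst p) ^ CARD('n)"

lemma vol_pos [simp]: "0 < vol p"
  by (simp add: vol_def)

lemma vol_nonneg [simp]: "0 \<le> vol p"
  by (simp add: less_imp_le)

lemma vol_nonzero [simp]: "vol p \<noteq> 0"
  using vol_pos[of p] by linarith

lemma emeasure_block_vol:
  fixes p :: "'n::finite cube_index"
  assumes "0 \<le> r"
  shows "emeasure lebesgue (block r p) = ennreal ((2 * real_of_int r + 1) ^ CARD('n) * vol p)"
  using assms by (simp only: emeasure_block power_mult_distrib vol_def)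

lemma emeasure_dyadic [simp]: "emeasure lebesgue (dyadic p) = ennreal (vol p)"
  using emeasure_block_vol[of 0 p] by simp

lemma emeasure_triple [simp]:
  "emeasure lebesgue (triple (p :: 'n::finite cube_index)) = ennreal (3 ^ CARD('n) * vol p)"
  using emeasure_block_vol[of 1 p] by simp

lemma vol_ancestor: "vol (ancestor m (p :: 'n::finite cube_index)) = (2 ^ m) ^ CARD('n) * vol p"
  by (simp add: vol_def power_int_add power_mult_distrib)

text \<open>Averages are mostly handled in the form \<open>c * volume < mass\<close>, which avoids division in \<open>[0, \<infinity>]\<close>.\<close>

lemma less_divide_ennreal_real_iff:
  assumes "0 < v"
  shows "c < m / ennreal v \<longleftrightarrow> c * ennreal v < m"
proof -
  have "m / ennreal v \<le> c \<longleftrightarrow> m \<le> c * ennreal v"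
  proof
    assume "m / ennreal v \<le> c"
    then have "m / ennreal v * ennreal v \<le> c * ennreal v" by (rule mult_right_mono) simp
    moreover have "m / ennreal v * ennreal v = m"
      using assms by (simp add: ennreal_divide_times)
    ultimately show "m \<le> c * ennreal v" by simp
  next
    assume "m \<le> c * ennreal v"
    then have "m / ennreal v \<le> c * ennreal v / ennreal v" by (rule divide_right_mono_ennreal)
    also have "\<dots> = c" using assms by (intro ennreal_mult_divide_eq) auto
    finally show "m / ennreal v \<le> c" .
  qed
  then show ?thesis by (simp add: not_le[symmetric])
qed

abbreviation mass :: "(real ^ 'n \<Rightarrow> ennreal) \<Rightarrow> (real ^ 'n) set \<Rightarrow> ennreal" where
  "mass u F \<equiv> emeasure (density lebesgue u) F"

text \<open>The averages are over dyadic cubes, but the cubes that count at \<open>x\<close> are those whose triple contains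
\<open>x\<close>. The usual dyadic maximal function does not dominate \<open>HL_maximal\<close>: two points on either side
of a coordinate hyperplane share no dyadic cube. This variant does.\<close>

definition dmax :: "(real ^ 'n \<Rightarrow> ennreal) \<Rightarrow> real ^ 'n \<Rightarrow> ennreal" where
  "dmax f x = (SUP p\<in>{p. x \<in> triple p}. mass f (dyadic p) / ennreal (vol p))"

lemma less_dmax_iff:
  "c < dmax f x \<longleftrightarrow> (\<exists>p. x \<in> triple p \<and> c * ennreal (vol p) < mass f (dyadic p))"
  by (simp add: dmax_def less_SUP_iff less_divide_ennreal_real_iff)

lemma mass_le_dmax:
  assumes "x \<in> triple p"
  shows "mass f (dyadic p) \<le> dmax f x * ennreal (vol p)"
proof (rule ccontr)
  assume "\<not> ?thesis"
  then have "dmax f x < dmax f x"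
    using assms less_dmax_iff[of "dmax f x" f x] not_le by blast
  then show False by simp
qed

lemma borel_measurable_dmax [measurable]: "dmax f \<in> borel_measurable lebesgue"
proof (rule borel_measurableI_greater)
  fix c
  have "{x \<in> space lebesgue. c < dmax f x} =
      (\<Union>p\<in>{p. c * ennreal (vol p) < mass f (dyadic p)}. triple p)"
    by (auto simp: less_dmax_iff)
  also have "\<dots> \<in> sets lebesgue"
    by (intro sets.countable_UN'' countable_cube_index) auto
  finally show "{x \<in> space lebesgue. c < dmax f x} \<in> sets lebesgue" .
qed

lemma sets_dmax_greater [measurable]: "{x. c < dmax f x} \<in> sets lebesgue"
proof -
  have "{x \<in> space lebesgue. c < dmax f x} \<in> sets lebesgue" by measurable
  then show ?thesis by simp
qed

lemma dmax_eq_0: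
  assumes "mass f UNIV = 0"
  shows "dmax f x = 0"
proof -
  have "mass f (dyadic q) = 0" for q
    using emeasure_mono[of "dyadic q" UNIV "density lebesgue f"] assms by simp
  then have "\<not> 0 < dmax f x" by (simp add: less_dmax_iff)
  then show ?thesis by simp
qed

lemma emeasure_UN_mult_le:
  assumes I: "countable I" and disj: "disjoint_family_on X I"
    and sets: "\<And>i. i \<in> I \<Longrightarrow> X i \<in> sets M" "sets M = sets N"
    and le: "\<And>i. i \<in> I \<Longrightarrow> c * emeasure M (X i) \<le> d * emeasure N (X i)"
  shows "c * emeasure M (\<Union>i\<in>I. X i) \<le> d * emeasure N (\<Union>i\<in>I. X i)"
proof -
  have "c * emeasure M (\<Union>i\<in>I. X i) = (\<integral>\<^sup>+i. c * emeasure M (X i) \<partial>count_space I)"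
    using I disj sets by (simp add: emeasure_UN_countable nn_integral_cmult)
  also have "\<dots> \<le> (\<integral>\<^sup>+i. d * emeasure N (X i) \<partial>count_space I)"
    using le by (intro nn_integral_mono) simp
  also have "\<dots> = d * emeasure N (\<Union>i\<in>I. X i)"
    using I disj sets by (simp add: emeasure_UN_countable nn_integral_cmult)
  finally show ?thesis .
qed

lemma emeasure_UN_le_nn_integral:
  assumes I: "countable I" and sets: "\<And>i. i \<in> I \<Longrightarrow> X i \<in> sets M"
  shows "emeasure M (\<Union>i\<in>I. X i) \<le> (\<integral>\<^sup>+i. emeasure M (X i) \<partial>count_space I)"
proof -
  have U: "(\<Union>i\<in>I. X i) \<in> sets M" using I sets by blast
  have "emeasure M (\<Union>i\<in>I. X i) = (\<integral>\<^sup>+x. indicator (\<Union>i\<in>I. X i) x \<partial>M)"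
    using U by simp
  also have "\<dots> \<le> (\<integral>\<^sup>+x. \<integral>\<^sup>+i. indicator (X i) x \<partial>count_space I \<partial>M)"
  proof (intro nn_integral_mono)
    fix x
    show "indicator (\<Union>i\<in>I. X i) x \<le> (\<integral>\<^sup>+i. indicator (X i) x \<partial>count_space I)"
    proof (cases "x \<in> (\<Union>i\<in>I. X i)")
      case True
      then obtain j where "j \<in> I" "x \<in> X j" by auto
      then show ?thesis
        using nn_integral_ge_point[of j I "\<lambda>i. indicator (X i) x"] by (auto split: split_indicator)
    qed simp
  qed
  also have "\<dots> = (\<integral>\<^sup>+i. \<integral>\<^sup>+x. indicator (X i) x \<partial>M \<partial>count_space I)"
    using I sets by (intro nn_integral_count_space_nn_integral) auto
  also have "\<dots> = (\<integral>\<^sup>+i. emeasure M (X i) \<partial>count_space I)"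
    using sets by (intro nn_integral_cong) auto
  finally show ?thesis .
qed

lemma mass_mult_indicator:
  assumes [measurable]: "f \<in> borel_measurable lebesgue" "A \<in> sets lebesgue" "B \<in> sets lebesgue"
  shows "mass (\<lambda>x. f x * indicator B x) A = mass f (A \<inter> B)"
  by (auto simp: emeasure_density intro!: nn_integral_cong split: split_indicator)

lemma mass_mono: "A \<subseteq> B \<Longrightarrow> B \<in> sets lebesgue \<Longrightarrow> mass f A \<le> mass f B"
  by (rule emeasure_mono) auto

text \<open>The Calderon-Zygmund cubes of \<open>g\<close> at height \<open>c\<close>. The dyadic cubes that contain a given one are
its ancestors, so maximality is a condition on ancestors.\<close>

definition maximal_cubes :: "(real ^ 'n \<Rightarrow> ennreal) \<Rightarrow> ennreal \<Rightarrow> 'n::finite cube_index set" where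
  "maximal_cubes g c = {p. c * ennreal (vol p) < mass g (dyadic p) \<and>
     (\<forall>m>0. mass g (dyadic (ancestor m p)) \<le> c * ennreal (vol (ancestor m p)))}"

definition level_set :: "(real ^ 'n \<Rightarrow> ennreal) \<Rightarrow> ennreal \<Rightarrow> (real ^ 'n) set" where
  "level_set g c = (\<Union>p\<in>maximal_cubes g c. dyadic p)"

lemma sets_level_set [measurable]: "level_set g c \<in> sets lebesgue"
  unfolding level_set_def by (intro sets.countable_UN'' countable_cube_index) auto

lemma maximal_cubes_average: "p \<in> maximal_cubes g c \<Longrightarrow> c * ennreal (vol p) < mass g (dyadic p)"
  by (simp add: maximal_cubes_def)

text \<open>The volume of the ancestors grows geometrically while the mass of \<open>g\<close> stays bounded, so only
finitely many ancestors have an average above \<open>c\<close>; the largest of them is maximal.\<close>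

lemma maximal_ancestor_exists:
  fixes p :: "'n::finite cube_index"
  assumes fin: "mass g UNIV < \<infinity>" and "0 < c" and p: "c * ennreal (vol p) < mass g (dyadic p)"
  obtains m where "ancestor m p \<in> maximal_cubes g c"
proof -
  let ?S = "{m. c * ennreal (vol (ancestor m p)) < mass g (dyadic (ancestor m p))}"
  have "c \<noteq> \<infinity>" using p by (auto simp: ennreal_top_mult)
  then obtain c' where c': "c = ennreal c'" "0 < c'"
    using \<open>0 < c\<close> by (cases c) auto
  obtain G where G: "mass g UNIV = ennreal G" "0 \<le> G"
    using fin by (cases "mass g UNIV") auto
  obtain N where N: "G / (c' * vol p) < 2 ^ N"
    using real_arch_pow[of 2] by auto
  have bdd: "m \<le> N" if "m \<in> ?S" for m
  proof (rule ccontr)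
    assume "\<not> m \<le> N"
    have "c' * ((2 ^ m) ^ CARD('n) * vol p) < G"
    proof -
      have "ennreal (c' * vol (ancestor m p)) = c * ennreal (vol (ancestor m p))"
        using c' by (simp add: ennreal_mult)
      also have "\<dots> < mass g (dyadic (ancestor m p))" using that by simp
      also have "\<dots> \<le> ennreal G" unfolding G(1)[symmetric] by (intro mass_mono) auto
      finally show ?thesis using c' by (simp add: ennreal_less_iff vol_ancestor)
    qed
    moreover have "(2::real) ^ N \<le> (2 ^ m) ^ CARD('n)"
    proof -
      have "(2::real) ^ N \<le> 2 ^ (m * CARD('n))"
        using \<open>\<not> m \<le> N\<close> by (intro power_increasing) (auto intro: order_trans[of N m])
      then show ?thesis by (simp add: power_mult)
    qed
    then have "2 ^ N * (c' * vol p) \<le> (2 ^ m) ^ CARD('n) * (c' * vol p)"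
      using c' by (intro mult_right_mono) auto
    ultimately have "2 ^ N * (c' * vol p) < G" by (simp add: algebra_simps)
    with N c' show False by (simp add: field_simps)
  qed
  have fS: "finite ?S" using bdd by (meson finite_nat_set_iff_bounded_le)
  have ne: "0 \<in> ?S" using p by simp
  have M: "Max ?S \<in> ?S" by (rule Max_in[OF fS]) (use ne in blast)
  have "mass g (dyadic (ancestor m (ancestor (Max ?S) p))) \<le> c * ennreal (vol (ancestor m (ancestor (Max ?S) p)))"
    if "0 < m" for m
  proof (rule ccontr)
    assume "\<not> ?thesis"
    then have "m + Max ?S \<in> ?S" by (simp add: ancestor_ancestor)
    then show False using that Max_ge[OF fS, of "m + Max ?S"] by simp
  qed
  then have "ancestor (Max ?S) p \<in> maximal_cubes g c"
    using M by (simp add: maximal_cubes_def)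
  then show thesis by (rule that)
qed

text \<open>The parent of a maximal cube fails the condition, and it is only \<open>2 ^ n\<close> times as large.\<close>

lemma maximal_cubes_average_upper:
  fixes p :: "'n::finite cube_index"
  assumes "p \<in> maximal_cubes g c"
  shows "mass g (dyadic p) \<le> 2 ^ CARD('n) * (c * ennreal (vol p))"
proof -
  have "mass g (dyadic p) \<le> mass g (dyadic (ancestor 1 p))"
    by (intro mass_mono dyadic_subset_ancestor) auto
  also have "\<dots> \<le> c * ennreal (vol (ancestor 1 p))"
    using assms by (simp add: maximal_cubes_def)
  also have "\<dots> = 2 ^ CARD('n) * (c * ennreal (vol p))"
    by (simp add: vol_ancestor ennreal_mult ennreal_power[symmetric] mult_ac)
  finally show ?thesis .
qed

lemma maximal_cubes_disjoint:
  assumes p: "p \<in> maximal_cubes g c" and q: "q \<in> maximal_cubes g c"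
    and x: "x \<in> dyadic p" "x \<in> dyadic q"
  shows "p = q"
proof -
  have *: "p = q" if "p \<in> maximal_cubes g c" "q \<in> maximal_cubes g c" "x \<in> dyadic p" "x \<in> dyadic q" "fst p \<le> fst q" for p q
  proof (cases "fst p = fst q")
    case True
    then show ?thesis using dyadic_meet_ancestor[OF \<open>x \<in> dyadic p\<close> \<open>x \<in> dyadic q\<close>] by simp
  next
    case False
    then obtain m where m: "0 < m" "q = ancestor m p"
      using dyadic_meet_ancestor[OF \<open>x \<in> dyadic p\<close> \<open>x \<in> dyadic q\<close> \<open>fst p \<le> fst q\<close>] \<open>fst p \<le> fst q\<close>
      by (metis less_le zero_less_nat_eq diff_gt_0_iff_gt)
    have "mass g (dyadic q) \<le> c * ennreal (vol q)"
      using \<open>p \<in> maximal_cubes g c\<close> m by (simp add: maximal_cubes_def)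
    with maximal_cubes_average[OF \<open>q \<in> maximal_cubes g c\<close>] show ?thesis
      by (simp add: leD)
  qed
  show ?thesis using *[OF p q x] *[OF q p x(2,1)] linear[of "fst p" "fst q"] by blast
qed

lemma disjoint_maximal_cubes: "disjoint_family_on dyadic (maximal_cubes g c)"
  unfolding disjoint_family_on_def using maximal_cubes_disjoint by blast

lemma dmax_subset_triples:
  assumes fin: "mass g UNIV < \<infinity>" and "0 < c"
  shows "{x. c < dmax g x} \<subseteq> (\<Union>p\<in>maximal_cubes g c. triple p)"
proof
  fix x assume "x \<in> {x. c < dmax g x}"
  then obtain p where p: "x \<in> triple p" "c * ennreal (vol p) < mass g (dyadic p)"
    by (auto simp: less_dmax_iff)
  obtain m where "ancestor m p \<in> maximal_cubes g c"
    using maximal_ancestor_exists[OF fin \<open>0 < c\<close> p(2)] .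
  then show "x \<in> (\<Union>p\<in>maximal_cubes g c. triple p)"
    using p(1) triple_subset_triple_ancestor by blast
qed

text \<open>The superlevel set is covered by the triples of the maximal cubes, which are disjoint and carry
average at least \<open>c\<close> each.\<close>

lemma weak_type_dmax:
  fixes g :: "real ^ 'n \<Rightarrow> ennreal"
  assumes fin: "mass g UNIV < \<infinity>"
  shows "c * emeasure lebesgue {x. c < dmax g x} \<le> 3 ^ CARD('n) * mass g UNIV"
proof (cases "c = 0")
  case False
  then have "0 < c" by (simp add: zero_less_iff_neq_zero)
  let ?P = "maximal_cubes g c"
  have "c * emeasure lebesgue {x. c < dmax g x} \<le> c * emeasure lebesgue (\<Union>p\<in>?P. triple p)"
    by (intro mult_left_mono emeasure_mono dmax_subset_triples fin \<open>0 < c\<close> sets.countable_UN'' countable_cube_index) auto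
  also have "\<dots> \<le> c * (\<integral>\<^sup>+p. emeasure lebesgue (triple p) \<partial>count_space ?P)"
    by (intro mult_left_mono emeasure_UN_le_nn_integral countable_cube_index) auto
  also have "\<dots> = 3 ^ CARD('n) * (\<integral>\<^sup>+p. c * ennreal (vol p) \<partial>count_space ?P)"
    by (simp add: nn_integral_cmult[symmetric] ennreal_mult ennreal_power[symmetric] mult_ac)
  also have "\<dots> \<le> 3 ^ CARD('n) * (\<integral>\<^sup>+p. mass g (dyadic p) \<partial>count_space ?P)"
    by (intro mult_left_mono nn_integral_mono) (auto simp: maximal_cubes_def)
  also have "(\<integral>\<^sup>+p. mass g (dyadic p) \<partial>count_space ?P) = mass g (\<Union>p\<in>?P. dyadic p)"
    by (intro emeasure_UN_countable[symmetric] countable_cube_index disjoint_maximal_cubes) auto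
  also have "\<dots> \<le> mass g UNIV"
    by (intro mass_mono) auto
  finally show ?thesis by (simp add: mult_left_mono)
qed simp

lemma le_level_factor: "(c :: ennreal) \<le> 2 * 2 ^ k * c"
proof -
  have "ennreal 1 \<le> ennreal (2 * 2 ^ k)"
    by (intro ennreal_leI one_le_power[of "2::real" "Suc k", simplified])
  then have "1 * c \<le> (2 * 2 ^ k) * c"
    by (intro mult_right_mono) (simp_all add: ennreal_mult ennreal_power[symmetric])
  then show ?thesis by simp
qed

lemma level_set_antimono:
  assumes fin: "mass g UNIV < \<infinity>" and "0 < c" "c \<le> d"
  shows "level_set g d \<subseteq> level_set g c"
proof
  fix x assume "x \<in> level_set g d"
  then obtain q where q: "q \<in> maximal_cubes g d" "x \<in> dyadic q" by (auto simp: level_set_def)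
  have "c * ennreal (vol q) < mass g (dyadic q)"
    using maximal_cubes_average[OF q(1)] \<open>c \<le> d\<close> by (meson le_less_trans mult_right_mono zero_le)
  then obtain m where "ancestor m q \<in> maximal_cubes g c"
    using maximal_ancestor_exists[OF fin \<open>0 < c\<close>] by blast
  then show "x \<in> level_set g c"
    using dyadic_subset_ancestor[of q m] q(2) unfolding level_set_def by blast
qed

text \<open>Inside a maximal cube \<open>p\<close> at height \<open>c\<close> the average is at most \<open>2 ^ n * c\<close>. The cubes at height
\<open>2 * 2 ^ n * c\<close> that meet \<open>p\<close> are contained in \<open>p\<close>, and by disjointness they fill at most half of it.\<close>

lemma level_set_sparse:
  fixes p :: "'n::finite cube_index"
  assumes fin: "mass g UNIV < \<infinity>" and c: "0 < c" "c < \<infinity>" and p: "p \<in> maximal_cubes g c"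
  shows "2 * emeasure lebesgue (dyadic p \<inter> level_set g (2 * 2 ^ CARD('n) * c)) \<le> ennreal (vol p)"
proof -
  let ?d = "2 * 2 ^ CARD('n) * c"
  let ?B = "{q \<in> maximal_cubes g ?d. dyadic q \<inter> dyadic p \<noteq> {}}"
  have cd: "c \<le> ?d" by (rule le_level_factor)
  have sub: "dyadic q \<subseteq> dyadic p" if q: "q \<in> ?B" for q
  proof -
    have "c * ennreal (vol q) < mass g (dyadic q)"
      using maximal_cubes_average[of q g ?d] q mult_right_mono[OF cd, of "ennreal (vol q)"]
      by (auto intro: le_less_trans)
    then obtain m where m: "ancestor m q \<in> maximal_cubes g c"
      using maximal_ancestor_exists[OF fin c(1)] by blast
    have "ancestor m q = p"
      using q dyadic_subset_ancestor[of q m] by (blast intro: maximal_cubes_disjoint[OF m p])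
    then show ?thesis using dyadic_subset_ancestor[of q m] by simp
  qed
  have eq: "dyadic p \<inter> level_set g ?d = (\<Union>q\<in>?B. dyadic q)"
    using sub by (auto simp: level_set_def)
  have "?d * emeasure lebesgue (\<Union>q\<in>?B. dyadic q) \<le> 1 * mass g (\<Union>q\<in>?B. dyadic q)"
    by (intro emeasure_UN_mult_le countable_cube_index disjoint_family_on_mono[OF _ disjoint_maximal_cubes])
      (auto dest: maximal_cubes_average intro: less_imp_le)
  also have "\<dots> \<le> mass g (dyadic p)"
    using sub by (simp, intro mass_mono) auto
  also have "\<dots> \<le> 2 ^ CARD('n) * (c * ennreal (vol p))"
    by (rule maximal_cubes_average_upper[OF p])
  finally have "(2 ^ CARD('n) * c) * (2 * emeasure lebesgue (\<Union>q\<in>?B. dyadic q)) \<le> (2 ^ CARD('n) * c) * ennreal (vol p)"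
    by (simp add: mult_ac)
  moreover have "2 ^ CARD('n) * c \<noteq> 0" "2 ^ CARD('n) * c \<noteq> top"
    using c by (auto simp: ennreal_mult_eq_top_iff power_eq_top_ennreal)
  ultimately show ?thesis unfolding eq
    by (subst (asm) ennreal_mult_le_mult_iff) auto
qed

lemma level_set_complement_large:
  fixes p :: "'n::finite cube_index"
  assumes "mass g UNIV < \<infinity>" "0 < c" "c < \<infinity>" "p \<in> maximal_cubes g c"
    and e: "emeasure lebesgue (dyadic p - level_set g (2 * 2 ^ CARD('n) * c)) = ennreal e" "0 \<le> e"
  shows "vol p \<le> 2 * e"
proof -
  let ?W = "level_set g (2 * 2 ^ CARD('n) * c)"
  have "emeasure lebesgue (dyadic p \<inter> ?W) \<le> ennreal (vol p)"
    unfolding emeasure_dyadic[symmetric] by (intro emeasure_mono) auto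
  then have "emeasure lebesgue (dyadic p \<inter> ?W) \<noteq> top" by (rule neq_top_trans[rotated]) simp
  then obtain s where s: "emeasure lebesgue (dyadic p \<inter> ?W) = ennreal s" "0 \<le> s"
    by (cases "emeasure lebesgue (dyadic p \<inter> ?W)") auto
  have "ennreal (2 * s) \<le> ennreal (vol p)"
    using level_set_sparse[OF assms(1-4)] s by (simp add: ennreal_mult)
  then have "2 * s \<le> vol p" by (simp add: ennreal_le_iff)
  moreover have "vol p \<le> s + e"
  proof -
    have "ennreal (vol p) = emeasure lebesgue ((dyadic p \<inter> ?W) \<union> (dyadic p - ?W))"
      by (simp only: Int_Diff_Un emeasure_dyadic)
    also have "\<dots> \<le> emeasure lebesgue (dyadic p \<inter> ?W) + emeasure lebesgue (dyadic p - ?W)"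
      by (intro emeasure_subadditive) auto
    also have "\<dots> = ennreal (s + e)" using s e by simp
    finally show ?thesis using s e by (simp add: ennreal_le_iff del: ennreal_plus)
  qed
  ultimately show ?thesis by linarith
qed

section \<open>Comparison of maximal functions and local oscillation\<close>

lemma abs_div_diff_le:
  fixes a b d :: int
  assumes "0 < d"
  shows "\<bar>a div d - b div d\<bar> \<le> \<bar>a - b\<bar>"
proof -
  have *: "b div d \<le> a div d + (b - a)" if "a \<le> b" for a b :: int
  proof -
    have "b div d \<le> (a + (b - a) * d) div d"
      using assms that mult_left_mono[of 1 d "b - a"] by (intro zdiv_mono1) auto
    then show ?thesis using assms by simp
  qed
  show ?thesis
  proof (cases "a \<le> b")
    case True
    then show ?thesis using *[OF True] zdiv_mono1[OF True assms] by simp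
  next
    case False
    then show ?thesis using *[of b a] zdiv_mono1[of b a d] assms by simp
  qed
qed

text \<open>Two points of a neighbourhood of \<open>p\<close> stay close when their indices are divided further, so a cube \<open>q\<close>
that is at least as large as \<open>p\<close> and near one of the points is near the other.\<close>

lemma block_common_point:
  assumes x: "x \<in> block r p" "x \<in> block t q" and y: "y \<in> block s p" and "fst p \<le> fst q"
  shows "y \<in> block (r + s + t) q"
proof -
  obtain m where m: "fst q = fst p + int m"
    using \<open>fst p \<le> fst q\<close> by (metis zle_iff_zadd)
  have "\<bar>\<lfloor>y $ i / 2 powi fst q\<rfloor> - snd q $ i\<bar> \<le> r + s + t" for i
  proof -
    let ?x = "\<lfloor>x $ i / 2 powi fst p\<rfloor>" and ?y = "\<lfloor>y $ i / 2 powi fst p\<rfloor>"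
    have "\<bar>?x - snd p $ i\<bar> \<le> r" "\<bar>?y - snd p $ i\<bar> \<le> s"
      using x(1) y unfolding block_def by simp_all
    then have "\<bar>?y - ?x\<bar> \<le> r + s" by linarith
    moreover have "\<bar>?y div 2 ^ m - ?x div 2 ^ m\<bar> \<le> \<bar>?y - ?x\<bar>"
      by (rule abs_div_diff_le) simp
    moreover have "\<bar>?x div 2 ^ m - snd q $ i\<bar> \<le> t"
      using x(2) unfolding block_def m floor_div_ancestor by simp
    ultimately show ?thesis unfolding m floor_div_ancestor by linarith
  qed
  then show ?thesis by (simp add: block_def)
qed

lemma disjoint_generation: "disjoint_family_on dyadic {q. fst q = k \<and> P q}"
  unfolding disjoint_family_on_def
proof (intro ballI impI)
  fix p q assume "p \<in> {q. fst q = k \<and> P q}" "q \<in> {q. fst q = k \<and> P q}" "p \<noteq> q"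
  then show "dyadic p \<inter> dyadic q = {}"
    by (metis (mono_tags, lifting) mem_Collect_eq disjoint_iff mem_dyadic_iff)
qed

text \<open>No counting of cubes is involved: if every generation \<open>k\<close> cube that meets \<open>A\<close> has average at most
\<open>c\<close>, then the union of these disjoint cubes has average at most \<open>c\<close>.\<close>

lemma mass_generation_le:
  assumes A: "\<And>q. fst q = k \<Longrightarrow> dyadic q \<inter> A \<noteq> {} \<Longrightarrow> mass f (dyadic q) \<le> c * ennreal (vol q)"
    and B: "\<And>q. fst q = k \<Longrightarrow> dyadic q \<inter> A \<noteq> {} \<Longrightarrow> dyadic q \<subseteq> B" "B \<in> sets lebesgue"
  shows "mass f A \<le> c * emeasure lebesgue B"
proof -
  let ?I = "{q. fst q = k \<and> dyadic q \<inter> A \<noteq> {}}"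
  let ?U = "\<Union>q\<in>?I. dyadic q"
  have U: "?U \<in> sets lebesgue" by (intro sets.countable_UN'' countable_cube_index) auto
  have "A \<subseteq> ?U"
  proof
    fix x assume "x \<in> A"
    then have "cell k x \<in> ?I" by (auto simp: disjoint_iff intro!: exI[of _ x])
    then show "x \<in> ?U" using mem_dyadic_cell[of x k] by blast
  qed
  then have "1 * mass f A \<le> 1 * mass f ?U"
    using U by (intro mult_left_mono mass_mono) auto
  also have "\<dots> \<le> c * emeasure lebesgue ?U"
    using A by (intro emeasure_UN_mult_le countable_cube_index disjoint_generation) auto
  also have "\<dots> \<le> c * emeasure lebesgue B"
    using B by (intro mult_left_mono emeasure_mono) auto
  finally show ?thesis by simp
qed

lemma mass_block2_le_dmax:
  fixes p :: "'n::finite cube_index"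
  assumes y: "y \<in> triple p"
  shows "mass f (block 2 p) \<le> 20 ^ CARD('n) * (ennreal (vol p) * dmax f y)"
proof -
  have "mass f (block 2 p) \<le> 4 ^ CARD('n) * dmax f y * emeasure lebesgue (block 2 p)"
  proof (rule mass_generation_le[where k = "fst p"])
    fix q :: "'n cube_index" assume q: "fst q = fst p" "dyadic q \<inter> block 2 p \<noteq> {}"
    obtain x where x: "x \<in> dyadic q" "x \<in> block 2 p" using q by auto
    show "dyadic q \<subseteq> block 2 p" by (rule dyadic_subset_block[OF x]) (simp add: q)
    have "y \<in> block 3 q" using block_common_point[OF x(2,1) y] q(1) by simp
    then have "y \<in> triple (ancestor 2 q)" using block_subset_triple_ancestor[of 3 2 q] by auto
    then have "mass f (dyadic (ancestor 2 q)) \<le> dmax f y * ennreal (vol (ancestor 2 q))"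
      by (rule mass_le_dmax)
    also have "\<dots> = 4 ^ CARD('n) * dmax f y * ennreal (vol q)"
      by (simp add: vol_ancestor ennreal_mult ennreal_power[symmetric] mult_ac)
    finally show "mass f (dyadic q) \<le> 4 ^ CARD('n) * dmax f y * ennreal (vol q)"
      using mass_mono[OF dyadic_subset_ancestor[of q 2], of f] by simp
  qed simp
  also have "\<dots> = 20 ^ CARD('n) * (ennreal (vol p) * dmax f y)"
  proof -
    have "(20::ennreal) ^ CARD('n) = 4 ^ CARD('n) * 5 ^ CARD('n)"
      by (simp flip: power_mult_distrib)
    then show ?thesis by (subst emeasure_block_vol) (simp_all add: ennreal_mult ennreal_power[symmetric] mult_ac)
  qed
  finally show ?thesis .
qed

text \<open>On \<open>triple p\<close> the function \<open>dmax f\<close> exceeds a large multiple of any of its own values there only on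
a small portion. Cubes at least as large as \<open>p\<close> that are seen by one point of the triple have a
grandparent seen by all points, so they contribute comparable averages everywhere. Smaller cubes only
see the restriction of \<open>f\<close> to \<open>block 2 p\<close>, for which the weak type estimate is available, and the mass
of that restriction is controlled by \<open>dmax f y\<close>.\<close>

lemma dmax_local_distribution:
  fixes p :: "'n::finite cube_index"
  assumes [measurable]: "f \<in> borel_measurable lebesgue"
    and fin: "mass f UNIV < \<infinity>" and y: "y \<in> triple p"
  shows "c * emeasure lebesgue {x \<in> triple p. c < dmax f x} \<le> 60 ^ CARD('n) * (ennreal (vol p) * dmax f y)"
proof (cases "c \<le> 4 ^ CARD('n) * dmax f y")
  case True
  have "c * emeasure lebesgue {x \<in> triple p. c < dmax f x} \<le> (4 ^ CARD('n) * dmax f y) * emeasure lebesgue (triple p)"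
    using True by (intro mult_mono emeasure_mono) auto
  also have "\<dots> = (4 ^ CARD('n) * 3 ^ CARD('n)) * (ennreal (vol p) * dmax f y)"
    by (simp add: ennreal_mult ennreal_power[symmetric] mult_ac)
  also have "\<dots> = 12 ^ CARD('n) * (ennreal (vol p) * dmax f y)"
    by (simp flip: power_mult_distrib)
  also have "\<dots> \<le> 60 ^ CARD('n) * (ennreal (vol p) * dmax f y)"
    by (intro mult_right_mono power_mono) auto
  finally show ?thesis .
next
  case False
  \<comment> \<open>Now \<open>c\<close> is so large that only cubes smaller than \<open>p\<close> can take \<open>dmax f\<close> above \<open>c\<close> on the triple.\<close>
  let ?g = "\<lambda>x. f x * indicator (block 2 p) x"
  have mg: "mass ?g A = mass f (A \<inter> block 2 p)" if "A \<in> sets lebesgue" for A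
    using that by (intro mass_mult_indicator) auto
  have "{x \<in> triple p. c < dmax f x} \<subseteq> {x. c < dmax ?g x}"
  proof safe
    fix x assume x: "x \<in> triple p" "c < dmax f x"
    then obtain q where q: "x \<in> triple q" "c * ennreal (vol q) < mass f (dyadic q)"
      by (auto simp: less_dmax_iff)
    have "fst q < fst p"
    proof (rule ccontr)
      assume "\<not> fst q < fst p"
      then have "y \<in> block 3 q" using block_common_point[OF x(1) q(1) y] by simp
      then have "y \<in> triple (ancestor 2 q)" using block_subset_triple_ancestor[of 3 2 q] by auto
      then have "mass f (dyadic (ancestor 2 q)) \<le> dmax f y * ennreal (vol (ancestor 2 q))"
        by (rule mass_le_dmax)
      also have "\<dots> = 4 ^ CARD('n) * dmax f y * ennreal (vol q)"
        by (simp add: vol_ancestor ennreal_mult ennreal_power[symmetric] mult_ac)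
      also have "\<dots> \<le> c * ennreal (vol q)"
        using False by (intro mult_right_mono) auto
      finally show False
        using q(2) mass_mono[OF dyadic_subset_ancestor[of q 2], of f] by (simp add: leD)
    qed
    then have "dyadic q \<subseteq> block 2 p"
    proof (intro subsetI)
      fix z assume z: "z \<in> dyadic q"
      obtain m where m: "fst p = fst q + int m" using \<open>fst q < fst p\<close> by (metis zle_iff_zadd less_imp_le)
      have za: "z \<in> dyadic (ancestor m q)" using z dyadic_subset_ancestor by (rule subsetD[rotated])
      have xa: "x \<in> triple (ancestor m q)" using q(1) triple_subset_triple_ancestor by (rule subsetD[rotated])
      show "z \<in> block 2 p"
        using block_common_point[OF xa x(1) za] m by simp
    qed
    then have "mass ?g (dyadic q) = mass f (dyadic q)" by (simp add: mg Int_absorb2)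
    then show "c < dmax ?g x" using q unfolding less_dmax_iff by (intro exI[of _ q]) simp
  qed
  then have "c * emeasure lebesgue {x \<in> triple p. c < dmax f x} \<le> c * emeasure lebesgue {x. c < dmax ?g x}"
    by (intro mult_left_mono emeasure_mono) auto
  also have "\<dots> \<le> 3 ^ CARD('n) * mass ?g UNIV"
    using fin by (intro weak_type_dmax) (auto simp: mg intro: le_less_trans[OF mass_mono])
  also have "mass ?g UNIV = mass f (block 2 p)" by (simp add: mg)
  also have "3 ^ CARD('n) * mass f (block 2 p) \<le> 3 ^ CARD('n) * (20 ^ CARD('n) * (ennreal (vol p) * dmax f y))"
    by (intro mult_left_mono mass_block2_le_dmax[OF y]) simp
  also have "\<dots> = (3 ^ CARD('n) * 20 ^ CARD('n)) * (ennreal (vol p) * dmax f y)"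
    by (simp only: mult_ac)
  finally show ?thesis by (simp flip: power_mult_distrib)
qed

text \<open>Here tripling is essential: the ancestors of a cube never leave its orthant, their triples do.\<close>

lemma triple_subset_triple_ancestor_far:
  fixes p q :: "'n::finite cube_index"
  obtains m where "triple p \<subseteq> triple (ancestor m q)"
proof -
  obtain i j where ij: "fst p + int i = fst q + int j"
  proof
    show "fst p + int (nat (fst q - fst p)) = fst q + int (nat (fst p - fst q))" by simp
  qed
  let ?p = "ancestor i p" and ?q = "ancestor j q"
  define N where "N = (\<Sum>i\<in>UNIV. nat \<bar>snd ?p $ i - snd ?q $ i\<bar>)"
  have "triple ?p \<subseteq> block (int (N + 1)) ?q"
  proof
    fix x assume x: "x \<in> triple ?p"
    have "\<bar>\<lfloor>x $ i / 2 powi fst ?q\<rfloor> - snd ?q $ i\<bar> \<le> int (N + 1)" for i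
    proof -
      have "nat \<bar>snd ?p $ i - snd ?q $ i\<bar> \<le> N" unfolding N_def by (intro member_le_sum) auto
      then have "\<bar>snd ?p $ i - snd ?q $ i\<bar> \<le> int N" by linarith
      moreover have "\<bar>\<lfloor>x $ i / 2 powi fst ?q\<rfloor> - snd ?p $ i\<bar> \<le> 1"
        using x ij by (simp add: block_def)
      ultimately show ?thesis by linarith
    qed
    then show "x \<in> block (int (N + 1)) ?q" unfolding block_def by (intro CollectI allI)
  qed
  also have "\<dots> \<subseteq> triple (ancestor (N + 1) ?q)"
  proof (rule block_subset_triple_ancestor)
    have "N + 1 \<le> 2 ^ (N + 1)" by (rule less_imp_le, rule less_exp)
    then have "int (N + 1) \<le> int (2 ^ (N + 1))" by (rule of_nat_mono)
    then show "int (N + 1) \<le> 2 ^ (N + 1)" by simp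
  qed
  finally have "triple p \<subseteq> triple (ancestor ((N + 1) + j) q)"
    using triple_subset_triple_ancestor[of p i] by (simp only: ancestor_ancestor)
  then show thesis by (rule that)
qed

text \<open>A cube with positive mass has an ancestor whose triple contains the given one.\<close>

lemma dmax_bounded_below:
  fixes p :: "'n::finite cube_index"
  assumes "mass f UNIV \<noteq> 0"
  obtains c where "0 < c" "\<And>y. y \<in> triple p \<Longrightarrow> c \<le> dmax f y"
proof -
  obtain q :: "'n cube_index" where q: "mass f (dyadic q) \<noteq> 0"
  proof (rule ccontr)
    assume "\<not> thesis"
    then have "mass f (dyadic q) = 0" for q :: "'n cube_index" using that by blast
    then have "mass f UNIV \<le> 0 * emeasure lebesgue (UNIV :: (real ^ 'n) set)"
      by (intro mass_generation_le[where k = 0]) auto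
    with assms show False by simp
  qed
  obtain m where m: "triple p \<subseteq> triple (ancestor m q)"
    by (rule triple_subset_triple_ancestor_far)
  have "mass f (dyadic (ancestor m q)) \<noteq> 0"
    using q mass_mono[OF dyadic_subset_ancestor[of q m], of f] by auto
  then have "0 < mass f (dyadic (ancestor m q)) / ennreal (vol (ancestor m q))"
    by (simp add: ennreal_zero_less_divide zero_less_iff_neq_zero)
  moreover have "mass f (dyadic (ancestor m q)) / ennreal (vol (ancestor m q)) \<le> dmax f y" if "y \<in> triple p" for y
    using that m unfolding dmax_def by (intro SUP_upper) auto
  ultimately show thesis by (rule that)
qed

text \<open>Let \<open>Q\<close> have side \<open>l\<close>, and let \<open>s\<close> be the power of two with \<open>l \<le> s < 2 * l\<close>. Every dyadic cube of side
\<open>s\<close> that meets \<open>Q\<close> has \<open>x\<close> in its triple, and together these cubes lie in a cube of side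
\<open>3 * s \<le> 6 * l\<close>. This gives the factor \<open>6 ^ n\<close>.\<close>

lemma HL_maximal_le_dmax:
  fixes f :: "real ^ 'n \<Rightarrow> 'b::real_normed_vector"
  assumes [measurable]: "f \<in> borel_measurable lebesgue"
  shows "HL_maximal f x \<le> 6 ^ CARD('n) * dmax (\<lambda>y. ennreal (norm (f y))) x"
  unfolding HL_maximal_def
proof (rule SUP_least)
  fix Q assume "Q \<in> {Q. cube Q \<and> x \<in> Q}"
  then obtain a l where l: "0 < l" and Q: "Q = cbox a (\<chi> i. a $ i + l)" and x: "x \<in> Q"
    by (auto simp: cube_def)
  let ?g = "\<lambda>y. ennreal (norm (f y))"
  define k where "k = \<lceil>log 2 l\<rceil>"
  define s :: real where "s = 2 powi k"
  have s: "l \<le> s" "s \<le> 2 * l"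
  proof -
    have s: "s = 2 powr real_of_int k" by (simp add: s_def powr_real_of_int')
    have "2 powr log 2 l \<le> 2 powr real_of_int k" unfolding k_def by (intro powr_mono) auto
    then show "l \<le> s" using l s by simp
    have "2 powr real_of_int k \<le> 2 powr (log 2 l + 1)" unfolding k_def by (intro powr_mono) linarith+
    then show "s \<le> 2 * l" using l s by (simp add: powr_add)
  qed
  let ?B = "cbox (\<chi> i. a $ i - s) (\<chi> i. (\<chi> i. a $ i - s) $ i + 3 * s)"
  have "mass ?g Q \<le> dmax ?g x * emeasure lebesgue ?B"
  proof (rule mass_generation_le[where k = k])
    fix q :: "'n cube_index" assume q: "fst q = k" "dyadic q \<inter> Q \<noteq> {}"
    then obtain z where z: "z \<in> dyadic q" "z \<in> Q" by auto
    have zi: "a $ i \<le> z $ i" "z $ i \<le> a $ i + l" for i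
      using z(2) by (auto simp: Q mem_box_cart)
    have xi: "a $ i \<le> x $ i" "x $ i \<le> a $ i + l" for i
      using x by (auto simp: Q mem_box_cart)
    have "real_of_int (snd q $ i - 1) * 2 powi fst q \<le> x $ i \<and>
     x $ i < real_of_int (snd q $ i + 1 + 1) * 2 powi fst q" for i
    proof -
      have "real_of_int (snd q $ i) * s \<le> z $ i" "z $ i < real_of_int (snd q $ i + 1) * s"
        using z(1) q(1) by (simp_all add: mem_block_iff s_def)
      moreover have "z $ i - s \<le> x $ i" "x $ i \<le> z $ i + s"
        using zi[of i] xi[of i] s by linarith+
      ultimately show ?thesis unfolding q(1) s_def[symmetric] by (simp add: algebra_simps)
    qed
    then have "x \<in> triple q" by (simp only: mem_block_iff) blast
    then show "mass ?g (dyadic q) \<le> dmax ?g x * ennreal (vol q)" by (rule mass_le_dmax)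
    show "dyadic q \<subseteq> ?B"
    proof
      fix y assume y: "y \<in> dyadic q"
      have "a $ i - s \<le> y $ i \<and> y $ i \<le> a $ i - s + 3 * s" for i
        using dyadic_coordinate_near[OF z(1) y, of i] zi[of i] s unfolding q(1) s_def[symmetric] by linarith
      then show "y \<in> ?B" by (simp add: mem_box_cart)
    qed
  qed simp
  also have "emeasure lebesgue ?B = ennreal ((3 * s) ^ CARD('n))"
    using s l by (intro emeasure_cbox_cube) auto
  also have "dmax ?g x * \<dots> \<le> dmax ?g x * ennreal ((6 * l) ^ CARD('n))"
    using s l by (intro mult_left_mono ennreal_leI power_mono) auto
  also have "\<dots> = 6 ^ CARD('n) * dmax ?g x * ennreal (l ^ CARD('n))"
    using l by (simp add: power_mult_distrib ennreal_mult ennreal_power[symmetric] mult_ac)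
  finally have "mass ?g Q \<le> 6 ^ CARD('n) * dmax ?g x * ennreal (l ^ CARD('n))" .
  then have "mass ?g Q / ennreal (l ^ CARD('n)) \<le> 6 ^ CARD('n) * dmax ?g x"
    using less_divide_ennreal_real_iff[of "l ^ CARD('n)"] l by (simp add: not_less[symmetric])
  moreover have "average Q ?g = mass ?g Q / ennreal (l ^ CARD('n))"
  proof -
    have "mass ?g Q = (\<integral>\<^sup>+x\<in>Q. ?g x \<partial>lebesgue)"
      unfolding Q by (intro emeasure_density) auto
    moreover have "emeasure lebesgue Q = ennreal (l ^ CARD('n))"
      unfolding Q using l by (intro emeasure_cbox_cube) simp
    ultimately show ?thesis by (simp only: average_def)
  qed
  ultimately show "average Q ?g \<le> 6 ^ CARD('n) * dmax ?g x" by simp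
qed

section \<open>Division of \<open>A\<^sub>\<infinity>\<close> weights by maximal functions\<close>

text \<open>A quantitative form of \<open>A\<^sub>\<infinity>\<close>: a set that occupies the proportion \<open>s\<close> of a triple carries at
least the proportion \<open>s ^ r / K\<close> of the mass. Lower bounds of this kind survive division
by \<open>dmax f\<close>. Since \<open>s \<le> 1\<close>, a natural exponent costs no generality.\<close>

definition Ainf_cond :: "real \<Rightarrow> nat \<Rightarrow> (real ^ 'n::finite \<Rightarrow> ennreal) \<Rightarrow> bool" where
  "Ainf_cond K r v \<longleftrightarrow> v \<in> borel_measurable lebesgue \<and>
     (\<forall>p. 0 < mass v (triple p) \<and> mass v (triple p) < \<infinity> \<and>
       (\<forall>F\<in>sets lebesgue. F \<subseteq> triple p \<longrightarrow>
          emeasure lebesgue F ^ r * mass v (triple p)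
          \<le> ennreal K * emeasure lebesgue (triple p) ^ r * mass v F))"

lemma Ainf_condD:
  assumes "Ainf_cond K r v"
  shows "v \<in> borel_measurable lebesgue" "0 < mass v (triple p)" "mass v (triple p) < \<infinity>"
    "F \<in> sets lebesgue \<Longrightarrow> F \<subseteq> triple p \<Longrightarrow>
       emeasure lebesgue F ^ r * mass v (triple p) \<le> ennreal K * emeasure lebesgue (triple p) ^ r * mass v F"
  using assms unfolding Ainf_cond_def by blast+

lemma emeasure_subset_triple_real:
  fixes p :: "'n::finite cube_index"
  assumes "F \<subseteq> triple p"
  obtains d where "emeasure lebesgue F = ennreal d" "0 \<le> d" "d \<le> 3 ^ CARD('n) * vol p"
proof -
  have le: "emeasure lebesgue F \<le> ennreal (3 ^ CARD('n) * vol p)"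
    using emeasure_mono[OF assms, of lebesgue] by simp
  then have "emeasure lebesgue F \<noteq> top" by (rule neq_top_trans[rotated]) simp
  then show thesis
    using le that by (cases "emeasure lebesgue F") auto
qed

lemma mass_le_mult:
  assumes [measurable]: "u \<in> borel_measurable lebesgue" "v \<in> borel_measurable lebesgue" "F \<in> sets lebesgue"
    and le: "AE x in lebesgue. x \<in> F \<longrightarrow> u x \<le> c * v x"
  shows "mass u F \<le> c * mass v F"
proof -
  have "mass u F = (\<integral>\<^sup>+x. u x * indicator F x \<partial>lebesgue)" by (intro emeasure_density) auto
  also have "\<dots> \<le> (\<integral>\<^sup>+x. c * (v x * indicator F x) \<partial>lebesgue)"
    using le by (intro nn_integral_mono_AE) (auto elim!: eventually_mono split: split_indicator)
  also have "\<dots> = c * (\<integral>\<^sup>+x. v x * indicator F x \<partial>lebesgue)" by (intro nn_integral_cmult) auto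
  also have "(\<integral>\<^sup>+x. v x * indicator F x \<partial>lebesgue) = mass v F" by (intro emeasure_density[symmetric]) auto
  finally show ?thesis .
qed

lemma inverse_antimono_ennreal:
  fixes x y :: ennreal
  assumes "x \<le> y"
  shows "inverse y \<le> inverse x"
proof (cases "x = 0 \<or> y = top")
  case False
  then obtain a b where "x = ennreal a" "y = ennreal b" "0 < a" "a \<le> b"
    using assms by (cases x; cases y) (auto simp: top_unique ennreal_le_iff less_le)
  then show ?thesis by (simp add: inverse_ennreal ennreal_leI)
qed auto

text \<open>Discard from \<open>F\<close> the points where \<open>dmax f\<close> exceeds \<open>c = 2 * 60 ^ n * vol p * dmax f y / |F|\<close>. By the
local distribution estimate they fill at most half of \<open>F\<close>. On the rest the new weight is at least
\<open>v / c\<close>, and the condition for \<open>v\<close> applies to what is left; the factor \<open>1 / c\<close> raises the exponent by one.\<close>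

lemma Ainf_cond_divide_dmax_at:
  fixes v f :: "real ^ 'n::finite \<Rightarrow> ennreal"
  assumes v: "Ainf_cond K r v" and "0 < K"
    and f [measurable]: "f \<in> borel_measurable lebesgue" and fin: "mass f UNIV < \<infinity>"
    and d: "dmax f y = ennreal d" "0 < d"
    and y: "y \<in> triple p" and F [measurable]: "F \<in> sets lebesgue" and FT: "F \<subseteq> triple p"
  shows "emeasure lebesgue F ^ Suc r * (mass v (triple p) * inverse (dmax f y))
     \<le> ennreal (K * 2 ^ Suc r * 60 ^ CARD('n)) * emeasure lebesgue (triple p) ^ Suc r * mass (\<lambda>x. v x / dmax f x) F"
proof -
  let ?h = "\<lambda>x. v x / dmax f x"
  let ?t = "3 ^ CARD('n) * vol p"
  note [measurable] = Ainf_condD(1)[OF v]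
  obtain \<delta> where \<delta>: "emeasure lebesgue F = ennreal \<delta>" "0 \<le> \<delta>" "\<delta> \<le> ?t"
    using emeasure_subset_triple_real[OF FT] .
  show ?thesis
  proof (cases "\<delta> = 0 \<or> mass ?h F = \<infinity>")
    case True
    then show ?thesis
    proof
      assume "\<delta> = 0"
      then show ?thesis using \<delta> by simp
    next
      assume "mass ?h F = \<infinity>"
      moreover have "ennreal (K * 2 ^ Suc r * 60 ^ CARD('n)) * emeasure lebesgue (triple p) ^ Suc r \<noteq> 0"
        using \<open>0 < K\<close> by (simp add: ennreal_power)
      ultimately show ?thesis by (simp add: ennreal_mult_top)
    qed
  next
    case False
    then have \<delta>0: "0 < \<delta>" using \<delta> by simp
    obtain H where H: "mass ?h F = ennreal H" "0 \<le> H" using False by (cases "mass ?h F") auto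
    obtain V where V: "mass v (triple p) = ennreal V" "0 \<le> V"
      using Ainf_condD(3)[OF v, of p] by (cases "mass v (triple p)") auto
    define c where "c = 2 * 60 ^ CARD('n) * vol p * d / \<delta>"
    have c: "0 < c" using \<delta>0 d by (simp add: c_def)
    let ?G = "{x \<in> triple p. ennreal c < dmax f x}"
    have Gs [measurable]: "?G \<in> sets lebesgue" by (simp add: Collect_conj_eq)
    obtain \<gamma> where \<gamma>: "emeasure lebesgue ?G = ennreal \<gamma>" "0 \<le> \<gamma>"
      using emeasure_subset_triple_real[of ?G p] by blast
    have "ennreal (c * \<gamma>) = ennreal c * emeasure lebesgue ?G"
      using \<gamma> c by (simp add: ennreal_mult)
    also have "\<dots> \<le> 60 ^ CARD('n) * (ennreal (vol p) * dmax f y)"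
      by (rule dmax_local_distribution[OF f fin y])
    also have "\<dots> = ennreal (60 ^ CARD('n) * vol p * d)"
      using d by (simp add: ennreal_mult ennreal_power[symmetric] mult_ac)
    also have "60 ^ CARD('n) * vol p * d = c * (\<delta> / 2)" using \<delta>0 by (simp add: c_def)
    finally have "c * \<gamma> \<le> c * (\<delta> / 2)" using c \<delta>0 by (simp add: ennreal_le_iff)
    then have \<gamma>\<delta>: "\<gamma> \<le> \<delta> / 2" using c by (simp only: mult_le_cancel_left_pos)
    let ?F = "F - ?G"
    obtain \<phi> where \<phi>: "emeasure lebesgue ?F = ennreal \<phi>" "0 \<le> \<phi>"
      using emeasure_subset_triple_real[of ?F p] FT by blast
    have "ennreal \<delta> \<le> emeasure lebesgue (?F \<union> ?G)"
      unfolding \<delta>(1)[symmetric] by (intro emeasure_mono) auto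
    also have "\<dots> \<le> emeasure lebesgue ?F + emeasure lebesgue ?G" by (intro emeasure_subadditive) auto
    also have "\<dots> = ennreal (\<phi> + \<gamma>)" using \<phi> \<gamma> by simp
    finally have "\<delta> \<le> \<phi> + \<gamma>" using \<phi>(2) \<gamma>(2) by (subst (asm) ennreal_le_iff) auto
    then have "\<delta> / 2 \<le> \<phi>" using \<gamma>\<delta> by linarith
    have vF: "mass v ?F \<le> ennreal c * mass ?h F"
    proof -
      have "mass v ?F \<le> ennreal c * mass ?h ?F"
      proof (rule mass_le_mult)
        have "v x \<le> ennreal c * ?h x" if "x \<in> ?F" for x
        proof -
          have Dx: "dmax f x \<le> ennreal c" using that FT by auto
          have "mass f UNIV \<noteq> 0" using d dmax_eq_0[of f y] by auto
          then obtain b where b: "0 < b" "\<And>y. y \<in> triple p \<Longrightarrow> b \<le> dmax f y"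
            using dmax_bounded_below[of f p] by blast
          have "dmax f x \<noteq> 0" using b that FT by force
          moreover have "dmax f x \<noteq> top" using Dx by (rule neq_top_trans[rotated]) simp
          ultimately have "v x = dmax f x * ?h x"
            by (simp add: ennreal_times_divide ennreal_mult_divide_eq mult.commute)
          also have "\<dots> \<le> ennreal c * ?h x" by (intro mult_right_mono Dx) simp
          finally show ?thesis .
        qed
        then show "AE x in lebesgue. x \<in> ?F \<longrightarrow> v x \<le> ennreal c * ?h x" by blast
      qed auto
      also have "\<dots> \<le> ennreal c * mass ?h F" by (intro mult_left_mono mass_mono) auto
      finally show ?thesis .
    qed
    have "ennreal ((\<delta> / 2) ^ r * V) \<le> emeasure lebesgue ?F ^ r * mass v (triple p)"
      using \<open>\<delta> / 2 \<le> \<phi>\<close> \<phi> \<delta>0 V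
      by (simp add: ennreal_mult ennreal_power mult_right_mono power_mono ennreal_leI del: power_divide)
    also have "\<dots> \<le> ennreal K * emeasure lebesgue (triple p) ^ r * mass v ?F"
      using FT by (intro Ainf_condD(4)[OF v]) auto
    also have "\<dots> \<le> ennreal K * emeasure lebesgue (triple p) ^ r * (ennreal c * mass ?h F)"
      by (intro mult_left_mono vF) auto
    also have "\<dots> = ennreal (K * ?t ^ r * (c * H))"
    proof -
      have nn: "0 \<le> K" "0 \<le> ?t" "0 \<le> c" using \<open>0 < K\<close> c by auto
      show ?thesis
        unfolding emeasure_triple H(1) ennreal_power[OF nn(2)]
        using nn H(2) by (simp only: ennreal_mult zero_le_power mult_nonneg_nonneg)
    qed
    finally have "(\<delta> / 2) ^ r * V \<le> K * ?t ^ r * (c * H)"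
      using \<open>0 < K\<close> c H by (simp add: ennreal_le_iff)
    then have "\<delta> * ((\<delta> / 2) ^ r * V) \<le> \<delta> * (K * ?t ^ r * (c * H))"
      using \<delta>0 by (intro mult_left_mono) auto
    also have "\<dots> = K * ?t ^ r * 2 * 60 ^ CARD('n) * vol p * d * H"
      using \<delta>0 by (simp add: c_def)
    also have "\<dots> \<le> K * ?t ^ r * 2 * 60 ^ CARD('n) * ?t * d * H"
      using \<open>0 < K\<close> d H by (intro mult_right_mono mult_left_mono) auto
    finally have "2 ^ r * (\<delta> * ((\<delta> / 2) ^ r * V)) \<le> 2 ^ r * (K * ?t ^ r * 2 * 60 ^ CARD('n) * ?t * d * H)"
      by (intro mult_left_mono) auto
    then have *: "\<delta> ^ Suc r * V \<le> K * 2 ^ Suc r * 60 ^ CARD('n) * ?t ^ Suc r * H * d"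
      by (simp add: power_divide mult_ac)
    then have "\<delta> ^ Suc r * (V * inverse d) \<le> K * 2 ^ Suc r * 60 ^ CARD('n) * ?t ^ Suc r * H"
      using d by (simp add: field_simps)
    then have "ennreal (\<delta> ^ Suc r * (V * inverse d)) \<le> ennreal (K * 2 ^ Suc r * 60 ^ CARD('n) * ?t ^ Suc r * H)"
      by (rule ennreal_leI)
    moreover have "ennreal (\<delta> ^ Suc r * (V * inverse d)) = emeasure lebesgue F ^ Suc r * (mass v (triple p) * inverse (dmax f y))"
      using \<delta> V d by (simp only: ennreal_mult ennreal_power inverse_ennreal zero_le_power mult_nonneg_nonneg
        inverse_nonnegative_iff_nonnegative less_imp_le)
    moreover have "ennreal (K * 2 ^ Suc r * 60 ^ CARD('n) * ?t ^ Suc r * H) = 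
       ennreal (K * 2 ^ Suc r * 60 ^ CARD('n)) * emeasure lebesgue (triple p) ^ Suc r * mass ?h F"
    proof -
      have nn: "0 \<le> K * 2 ^ Suc r * 60 ^ CARD('n)" "0 \<le> ?t" using \<open>0 < K\<close> by auto
      show ?thesis
        unfolding emeasure_triple H(1) ennreal_power[OF nn(2)]
        using nn H(2) by (simp only: ennreal_mult zero_le_power mult_nonneg_nonneg)
    qed
    ultimately show ?thesis by simp
  qed
qed

text \<open>The new constants do not depend on \<open>f\<close>. The mass of the triple under the new weight is at most
\<open>S * mass v (triple p)\<close> with \<open>S\<close> the supremum of \<open>1 / dmax f\<close> on the triple, so it suffices to compare
with one value of \<open>1 / dmax f\<close> at a time.\<close>

lemma Ainf_cond_divide_dmax:
  fixes v f :: "real ^ 'n::finite \<Rightarrow> ennreal"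
  assumes v: "Ainf_cond K r v" and "0 < K"
    and f [measurable]: "f \<in> borel_measurable lebesgue" and fin: "mass f UNIV < \<infinity>" and ne: "mass f UNIV \<noteq> 0"
    and bd: "\<And>x. dmax f x < \<infinity>"
  shows "Ainf_cond (K * 2 ^ Suc r * 60 ^ CARD('n)) (Suc r) (\<lambda>x. v x / dmax f x)"
proof -
  let ?h = "\<lambda>x. v x / dmax f x"
  note [measurable] = Ainf_condD(1)[OF v]
  have "0 < mass ?h (triple p) \<and> mass ?h (triple p) < \<infinity> \<and> (\<forall>F\<in>sets lebesgue. F \<subseteq> triple p \<longrightarrow>
          emeasure lebesgue F ^ Suc r * mass ?h (triple p)
          \<le> ennreal (K * 2 ^ Suc r * 60 ^ CARD('n)) * emeasure lebesgue (triple p) ^ Suc r * mass ?h F)" for p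
  proof -
    obtain b where b: "0 < b" "\<And>y. y \<in> triple p \<Longrightarrow> b \<le> dmax f y"
      using dmax_bounded_below[OF ne, of p] by blast
    define S where "S = (SUP y\<in>triple p. inverse (dmax f y))"
    have S: "S \<le> inverse b" unfolding S_def
      by (intro SUP_least) (simp add: b inverse_antimono_ennreal)
    have hT: "mass ?h (triple p) \<le> S * mass v (triple p)"
    proof (rule mass_le_mult)
      have "?h x \<le> S * v x" if "x \<in> triple p" for x
      proof -
        have "?h x = inverse (dmax f x) * v x" by (simp add: divide_ennreal_def mult.commute)
        also have "\<dots> \<le> S * v x" unfolding S_def by (intro mult_right_mono SUP_upper that) simp
        finally show ?thesis .
      qed
      then show "AE x in lebesgue. x \<in> triple p \<longrightarrow> ?h x \<le> S * v x" by blast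
    qed auto
    have F: "emeasure lebesgue F ^ Suc r * (mass v (triple p) * inverse (dmax f y))
          \<le> ennreal (K * 2 ^ Suc r * 60 ^ CARD('n)) * emeasure lebesgue (triple p) ^ Suc r * mass ?h F"
      if "F \<in> sets lebesgue" "F \<subseteq> triple p" "y \<in> triple p" for F y
    proof -
      obtain d where "dmax f y = ennreal d" "0 < d"
        using bd[of y] less_le_trans[OF b(1) b(2)[OF \<open>y \<in> triple p\<close>]] by (cases "dmax f y") (auto simp: ennreal_less_zero_iff)
      then show ?thesis using Ainf_cond_divide_dmax_at[OF v \<open>0 < K\<close> f fin] that by blast
    qed
    obtain y0 where y0: "y0 \<in> triple p"
      using emeasure_triple[of p] by (cases "triple p = {}") auto
    have pos: "mass ?h (triple p) \<noteq> 0"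
    proof
      assume "mass ?h (triple p) = 0"
      then have "emeasure lebesgue (triple p) ^ Suc r * (mass v (triple p) * inverse (dmax f y0)) = 0"
        using F[of "triple p" y0] y0 by simp
      moreover have "inverse (dmax f y0) \<noteq> 0" using bd[of y0] by simp
      ultimately show False using Ainf_condD(2)[OF v, of p] by (simp add: ennreal_power)
    qed
    have "S < \<infinity>" using le_less_trans[OF S, of \<infinity>] b(1) by (auto simp: less_top[symmetric])
    then have "S * mass v (triple p) < \<infinity>"
      using Ainf_condD(3)[OF v, of p] by (simp add: ennreal_mult_less_top)
    with hT have fin: "mass ?h (triple p) < \<infinity>" by (rule le_less_trans)
    have "emeasure lebesgue F ^ Suc r * mass ?h (triple p)
          \<le> ennreal (K * 2 ^ Suc r * 60 ^ CARD('n)) * emeasure lebesgue (triple p) ^ Suc r * mass ?h F"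
      if "F \<in> sets lebesgue" "F \<subseteq> triple p" for F
    proof -
      have "emeasure lebesgue F ^ Suc r * mass ?h (triple p) \<le> emeasure lebesgue F ^ Suc r * (S * mass v (triple p))"
        by (intro mult_left_mono hT) simp
      also have "\<dots> = (SUP y\<in>triple p. emeasure lebesgue F ^ Suc r * (mass v (triple p) * inverse (dmax f y)))"
        by (simp add: S_def SUP_mult_left_ennreal SUP_mult_right_ennreal mult_ac)
      also have "\<dots> \<le> ennreal (K * 2 ^ Suc r * 60 ^ CARD('n)) * emeasure lebesgue (triple p) ^ Suc r * mass ?h F"
        by (intro SUP_least F that)
      finally show ?thesis .
    qed
    with pos fin show ?thesis by (simp add: zero_less_iff_neq_zero)
  qed
  then show ?thesis unfolding Ainf_cond_def by auto
qed

section \<open>Muckenhoupt weights\<close>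

lemma weight_borel_measurable:
  fixes w :: "real ^ 'n \<Rightarrow> real"
  assumes "weight w"
  shows "w \<in> borel_measurable lebesgue"
proof (rule borel_measurable_LIMSEQ_real)
  show "(\<lambda>i. indicat_real (cball 0 (real i)) x *\<^sub>R w x) \<longlonglongrightarrow> w x" for x
  proof (rule tendsto_eventually)
    obtain N where "norm x \<le> real N" using real_arch_simple by blast
    then have "eventually (\<lambda>i. norm x \<le> real i) sequentially"
      by (intro eventually_sequentiallyI[of N]) linarith
    then show "\<forall>\<^sub>F i in sequentially. indicat_real (cball 0 (real i)) x *\<^sub>R w x = w x"
      by eventually_elim simp
  qed
  show "(\<lambda>x. indicat_real (cball 0 (real i)) x *\<^sub>R w x) \<in> borel_measurable lebesgue" for i
  proof -
    have "w absolutely_integrable_on cball 0 (real i)" using assms by (simp add: weight_def)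
    then show ?thesis unfolding set_integrable_def by (rule borel_measurable_integrable)
  qed
qed

lemma weight_mass_cbox_finite:
  assumes "weight w"
  shows "mass (\<lambda>x. ennreal (w x)) (cbox a b) < \<infinity>"
proof -
  note [measurable] = weight_borel_measurable[OF assms]
  have "integrable lebesgue (\<lambda>x. indicat_real (cbox a b) x *\<^sub>R w x)"
  proof -
    have "w absolutely_integrable_on cbox a b" using assms by (simp add: weight_def)
    then show ?thesis unfolding set_integrable_def .
  qed
  then have "(\<integral>\<^sup>+x. ennreal (norm (indicat_real (cbox a b) x *\<^sub>R w x)) \<partial>lebesgue) < \<infinity>"
    by (simp add: integrable_iff_bounded)
  also have "(\<integral>\<^sup>+x. ennreal (norm (indicat_real (cbox a b) x *\<^sub>R w x)) \<partial>lebesgue)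
    = (\<integral>\<^sup>+x. ennreal (w x) * indicator (cbox a b) x \<partial>lebesgue)"
    using assms by (intro nn_integral_cong) (auto simp: weight_def split: split_indicator)
  also have "\<dots> = mass (\<lambda>x. ennreal (w x)) (cbox a b)"
    by (intro emeasure_density[symmetric]) auto
  finally show ?thesis .
qed

lemma mass_pos:
  assumes [measurable]: "u \<in> borel_measurable lebesgue" and [measurable]: "F \<in> sets lebesgue"
    and "AE x in lebesgue. 0 < u x" and "emeasure lebesgue F \<noteq> 0"
  shows "0 < mass u F"
proof (rule ccontr)
  assume "\<not> 0 < mass u F"
  then have "mass u F = 0" by simp
  then have "(\<integral>\<^sup>+x. u x * indicator F x \<partial>lebesgue) = 0"
    by (subst (asm) emeasure_density) auto
  then have "AE x in lebesgue. u x * indicator F x = 0"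
    by (subst (asm) nn_integral_0_iff_AE) auto
  with assms(3) have "AE x in lebesgue. x \<notin> F"
    by eventually_elim (auto split: split_indicator_asm)
  then have "F \<in> null_sets lebesgue" by (simp add: AE_iff_null_sets)
  with assms(4) show False by (simp add: null_setsD1)
qed

lemma weight_AE_pos: "weight w \<Longrightarrow> AE x in lebesgue. 0 < ennreal (w x)"
  by (simp add: weight_def)

text \<open>The Muckenhoupt conditions speak of closed cubes; a block is a closed cube up to a null set.\<close>

lemma block_in_cube:
  fixes p :: "'n::finite cube_index"
  assumes "0 \<le> r"
  obtains Q where "cube Q" "block r p \<subseteq> Q" "emeasure lebesgue Q = emeasure lebesgue (block r p)" "\<exists>a b. Q = cbox a b"
proof -
  let ?l = "(2 * real_of_int r + 1) * 2 powi fst p"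
  let ?Q = "cbox (block_lo r p) (\<chi> i. block_lo r p $ i + ?l)"
  have l: "0 < ?l" using assms by simp
  show thesis
  proof
    show "cube ?Q" unfolding cube_def using l by blast
    show "emeasure lebesgue ?Q = emeasure lebesgue (block r p)"
      unfolding emeasure_block[OF assms] using l by (intro emeasure_cbox_cube) simp
  qed (use block_subset_cbox in blast)+
qed

definition A1_cond :: "real \<Rightarrow> (real ^ 'n::finite \<Rightarrow> ennreal) \<Rightarrow> bool" where
  "A1_cond A u \<longleftrightarrow> u \<in> borel_measurable lebesgue \<and>
     (\<forall>p. \<forall>r\<in>{0, 1}. 0 < mass u (block r p) \<and> mass u (block r p) < \<infinity> \<and>
       (AE x in lebesgue. x \<in> block r p \<longrightarrow>
          mass u (block r p) \<le> ennreal A * emeasure lebesgue (block r p) * u x))"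

lemma A1_weight_imp_A1_cond:
  fixes w :: "real ^ 'n::finite \<Rightarrow> real"
  assumes "A1_weight w"
  shows "\<exists>A0. \<forall>A\<ge>A0. A1_cond A (\<lambda>x. ennreal (w x))"
proof -
  let ?u = "\<lambda>x. ennreal (w x)"
  have w: "weight w" using assms by (simp add: A1_weight_def)
  note [measurable] = weight_borel_measurable[OF w]
  obtain C where "C < \<infinity>" and C: "AE x in lebesgue. HL_maximal w x \<le> C * ?u x"
    using assms unfolding A1_weight_def by blast
  then obtain A0 where A0: "C = ennreal A0" by (cases C) auto
  have "A1_cond A ?u" if "A0 \<le> A" for A
  proof -
    have "0 < mass ?u (block r p) \<and> mass ?u (block r p) < \<infinity> \<and>
       (AE x in lebesgue. x \<in> block r p \<longrightarrow>
          mass ?u (block r p) \<le> ennreal A * emeasure lebesgue (block r p) * ?u x)"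
      if "r = 0 \<or> r = 1" for p :: "'n cube_index" and r
    proof -
      have r: "0 \<le> r" using that by auto
      obtain Q where Q: "cube Q" "block r p \<subseteq> Q" "emeasure lebesgue Q = emeasure lebesgue (block r p)"
        and Qc: "\<exists>a b. Q = cbox a b"
        by (rule block_in_cube[OF r])
      have Qs [measurable]: "Q \<in> sets lebesgue" using Qc by auto
      have le: "mass ?u (block r p) \<le> mass ?u Q" by (intro mass_mono Q) simp
      have pos: "0 < mass ?u (block r p)"
      proof (intro mass_pos weight_AE_pos w)
        have "0 < (2 * real_of_int r + 1) ^ CARD('n) * vol p" using r by (intro mult_pos_pos) auto
        then show "emeasure lebesgue (block r p) \<noteq> 0"
          unfolding emeasure_block_vol[OF r] by (simp only: ennreal_eq_0_iff not_le)
      qed auto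
      have fin: "mass ?u (block r p) < \<infinity>"
        using Qc weight_mass_cbox_finite[OF w] le by (auto intro: le_less_trans)
      have "AE x in lebesgue. x \<in> block r p \<longrightarrow>
          mass ?u (block r p) \<le> ennreal A * emeasure lebesgue (block r p) * ?u x"
        using C
      proof eventually_elim
        case (elim x)
        show ?case
        proof
          assume x: "x \<in> block r p"
          obtain d where d: "emeasure lebesgue (block r p) = ennreal d" "0 < d"
            using emeasure_block_vol[OF r, of p] r by (metis vol_pos mult_pos_pos zero_less_power
              add_nonneg_pos mult_nonneg_nonneg of_int_0_le_iff zero_le_numeral zero_less_one)
          have "average Q (\<lambda>y. ennreal (norm (w y))) \<le> HL_maximal w x"
            unfolding HL_maximal_def using Q x by (intro SUP_upper) auto
          also have "\<dots> \<le> C * ?u x" by (rule elim)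
          also have "\<dots> \<le> ennreal A * ?u x"
            using that A0 \<open>A0 \<le> A\<close> by (intro mult_right_mono) (auto intro: ennreal_leI)
          also have "average Q (\<lambda>y. ennreal (norm (w y))) = mass ?u Q / ennreal d"
            unfolding average_def Q(3) d(1) using w
            by (subst emeasure_density) (auto simp: weight_def)
          finally have "mass ?u Q \<le> ennreal A * ?u x * ennreal d"
            using less_divide_ennreal_real_iff[OF d(2)] by (simp add: not_less[symmetric])
          with le show "mass ?u (block r p) \<le> ennreal A * emeasure lebesgue (block r p) * ?u x"
            unfolding d(1) by (simp add: mult_ac)
        qed
      qed
      with pos fin show ?thesis by blast
    qed
    then show ?thesis unfolding A1_cond_def by auto
  qed
  then show ?thesis by blast
qed

lemma A1_condD:
  assumes "A1_cond A u" "r = 0 \<or> r = 1"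
  shows "u \<in> borel_measurable lebesgue" "0 < mass u (block r p)" "mass u (block r p) < \<infinity>"
    "AE x in lebesgue. x \<in> block r p \<longrightarrow> mass u (block r p) \<le> ennreal A * emeasure lebesgue (block r p) * u x"
  using assms unfolding A1_cond_def by blast+

lemma A1_cond_subset:
  assumes u: "A1_cond A u" "r = 0 \<or> r = 1" and F [measurable]: "F \<in> sets lebesgue" and "F \<subseteq> block r p"
  shows "emeasure lebesgue F * mass u (block r p) \<le> ennreal A * emeasure lebesgue (block r p) * mass u F"
proof -
  note [measurable] = A1_condD(1)[OF u]
  have "mass (\<lambda>_. mass u (block r p)) F \<le> (ennreal A * emeasure lebesgue (block r p)) * mass u F"
    using A1_condD(4)[OF u, of p] \<open>F \<subseteq> block r p\<close>
    by (intro mass_le_mult) (auto elim!: eventually_mono)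
  then show ?thesis by (simp only: emeasure_density_const[OF F] mult_ac)
qed

text \<open>The hypothesis on \<open>\<theta>\<close> is Young's inequality with a free parameter. Its second term becomes
\<open>d / 2\<close> for \<open>\<theta> = (2 * S / d) powr (p - 1)\<close>, and this turns it into Hoelder's inequality up to a constant.\<close>

lemma Ap_subset_real:
  fixes S V W C t d p :: real
  assumes p: "1 < p" and pos: "0 < S" "0 < d" "0 < V" "0 < t" "0 \<le> W" "0 \<le> C"
    and A: "V / t * (S / t) powr (p - 1) \<le> C"
    and Y: "\<And>\<theta>. 0 < \<theta> \<Longrightarrow> d \<le> \<theta> * W + \<theta> powr (- 1 / (p - 1)) * S"
  shows "d powr p * V \<le> 2 powr p * C * t powr p * W"
proof -
  define \<theta> where "\<theta> = (2 * S / d) powr (p - 1)"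
  have \<theta>: "0 < \<theta>" using pos by (simp add: \<theta>_def)
  have "\<theta> powr (- 1 / (p - 1)) = (2 * S / d) powr (-1)"
    using p by (simp add: \<theta>_def powr_powr)
  also have "\<dots> = d / (2 * S)" using pos by (simp add: powr_minus_divide)
  finally have "d / 2 \<le> \<theta> * W" using Y[OF \<theta>] pos by (simp add: field_simps)
  then have 1: "d \<le> 2 * ((2 * S / d) powr (p - 1) * W)" by (simp add: \<theta>_def)
  have "d powr (p - 1) * d \<le> d powr (p - 1) * (2 * ((2 * S / d) powr (p - 1) * W))"
    by (intro mult_left_mono 1) simp
  also have "d powr (p - 1) * d = d powr p" using pos powr_add[of d "p - 1" 1] by simp
  also have "d powr (p - 1) * (2 * ((2 * S / d) powr (p - 1) * W)) = 2 * 2 powr (p - 1) * S powr (p - 1) * W"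
    using pos by (simp add: powr_mult powr_divide)
  also have "2 * 2 powr (p - 1) = 2 powr p" by (simp add: powr_diff)
  finally have 2: "d powr p \<le> 2 powr p * S powr (p - 1) * W" .
  have "V * S powr (p - 1) = (V / t * (S / t) powr (p - 1)) * (t * t powr (p - 1))"
    using pos by (simp add: powr_divide)
  also have "\<dots> \<le> C * (t * t powr (p - 1))"
    using A pos by (intro mult_right_mono) auto
  also have "t * t powr (p - 1) = t powr p" using pos by (simp add: powr_diff)
  finally have 3: "V * S powr (p - 1) \<le> C * t powr p" .
  have "d powr p * V \<le> (2 powr p * S powr (p - 1) * W) * V"
    using 2 pos by (intro mult_right_mono) auto
  also have "\<dots> = 2 powr p * W * (V * S powr (p - 1))" by simp
  also have "\<dots> \<le> 2 powr p * W * (C * t powr p)"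
    using 3 pos by (intro mult_left_mono) auto
  finally show ?thesis by (simp add: mult_ac)
qed

text \<open>For \<open>F\<close> in a cube \<open>Q\<close> and \<open>\<theta> > 0\<close>, the pointwise bound
\<open>1 \<le> \<theta> * v + (\<theta> * v) powr (- 1 / (p - 1))\<close> integrates over \<open>F\<close> to an estimate of \<open>|F|\<close> by the mass
of \<open>F\<close> under \<open>v\<close> and the mass of \<open>Q\<close> under the dual weight. The \<open>A\<^sub>p\<close> condition bounds the latter.\<close>

lemma Ap_weight_imp_Ainf_cond:
  fixes v :: "real ^ 'n::finite \<Rightarrow> real"
  assumes "Ap_weight p v"
  shows "\<exists>K r. 0 < K \<and> 0 < r \<and> Ainf_cond K r (\<lambda>x. ennreal (v x))"
proof -
  let ?u = "\<lambda>x. ennreal (v x)"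
  let ?e = "- 1 / (p - 1)"
  let ?s = "\<lambda>x. ennreal (v x powr ?e)"
  have p: "1 < p" and w: "weight v" using assms by (simp_all add: Ap_weight_def)
  note [measurable] = weight_borel_measurable[OF w]
  obtain C' where "C' < \<infinity>" and C': "\<And>Q. cube Q \<Longrightarrow> average Q ?u * ennpowr (average Q ?s) (p - 1) \<le> C'"
    using assms unfolding Ap_weight_def by blast
  then obtain C where C: "C' = ennreal C" "0 \<le> C" by (cases C') auto
  define r where "r = nat \<lceil>p\<rceil>"
  have r: "p \<le> real r" "0 < r" using p by (auto simp: r_def)
  define K where "K = 2 powr p * C + 1"
  have K: "0 < K" "2 powr p * C \<le> K" using C by (auto simp: K_def add_nonneg_pos)
  have "0 < mass ?u (triple P) \<and> mass ?u (triple P) < \<infinity> \<and>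
       (\<forall>F\<in>sets lebesgue. F \<subseteq> triple P \<longrightarrow>
          emeasure lebesgue F ^ r * mass ?u (triple P)
          \<le> ennreal K * emeasure lebesgue (triple P) ^ r * mass ?u F)" for P :: "'n cube_index"
  proof -
    let ?t = "3 ^ CARD('n) * vol P"
    have t: "0 < ?t" by simp
    obtain Q where Q: "cube Q" "triple P \<subseteq> Q" "emeasure lebesgue Q = emeasure lebesgue (triple P)"
      and Qc: "\<exists>a b. Q = cbox a b"
      using block_in_cube[of 1 P] by auto
    have Qs [measurable]: "Q \<in> sets lebesgue" using Qc by auto
    have Qt: "emeasure lebesgue Q = ennreal ?t" using Q by simp
    have le: "mass ?u (triple P) \<le> mass ?u Q" by (intro mass_mono Q) simp
    have pos: "0 < mass ?u (triple P)"
      by (intro mass_pos weight_AE_pos w) auto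
    have finQ: "mass ?u Q < \<infinity>" using Qc weight_mass_cbox_finite[OF w] by auto
    obtain V where V: "mass ?u Q = ennreal V" "0 < V"
      using finQ less_le_trans[OF pos le] by (cases "mass ?u Q") auto
    have avu: "average Q ?u = ennreal (V / ?t)"
    proof -
      have "average Q ?u = mass ?u Q / emeasure lebesgue Q"
        unfolding average_def by (subst emeasure_density) auto
      then show ?thesis unfolding V(1) Qt using V t by (simp only: divide_ennreal less_imp_le)
    qed
    have avs: "average Q ?s = mass ?s Q / ennreal ?t"
      unfolding average_def Qt by (subst emeasure_density) auto
    have "mass ?s Q \<noteq> \<infinity>"
    proof
      assume "mass ?s Q = \<infinity>"
      then have "ennpowr (average Q ?s) (p - 1) = \<infinity>"
        unfolding avs by (simp add: ennreal_top_divide ennpowr_def)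
      then have "average Q ?u * ennpowr (average Q ?s) (p - 1) = \<infinity>"
        unfolding avu using V t by (simp add: ennreal_mult_top)
      then show False using C'[OF Q(1)] C by (simp add: top_unique)
    qed
    moreover have "0 < mass ?s Q"
    proof (rule mass_pos)
      show "AE x in lebesgue. 0 < ?s x"
        using weight_AE_pos[OF w] by eventually_elim simp
    qed (use Qt in auto)
    ultimately obtain S where S: "mass ?s Q = ennreal S" "0 < S"
      by (cases "mass ?s Q") auto
    have A: "V / ?t * (S / ?t) powr (p - 1) \<le> C"
    proof -
      have "average Q ?s = ennreal (S / ?t)"
        unfolding avs S(1) using S t by (simp only: divide_ennreal less_imp_le)
      then have "ennpowr (average Q ?s) (p - 1) = ennreal ((S / ?t) powr (p - 1))"
        using S t by (simp add: ennpowr_def)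
      then have "ennreal (V / ?t) * ennreal ((S / ?t) powr (p - 1)) \<le> ennreal C"
        using C'[OF Q(1)] unfolding avu C(1) by simp
      then have "ennreal (V / ?t * (S / ?t) powr (p - 1)) \<le> ennreal C"
        using V t by (subst ennreal_mult) auto
      then show ?thesis using C by (simp add: ennreal_le_iff)
    qed
    have "emeasure lebesgue F ^ r * mass ?u (triple P) \<le> ennreal K * emeasure lebesgue (triple P) ^ r * mass ?u F"
      if F [measurable]: "F \<in> sets lebesgue" and FT: "F \<subseteq> triple P" for F
    proof -
      obtain d where d: "emeasure lebesgue F = ennreal d" "0 \<le> d" "d \<le> ?t"
        using emeasure_subset_triple_real[OF FT] .
      show ?thesis
      proof (cases "d = 0")
        case True
        then show ?thesis using d r by (simp add: zero_power)
      next
        case False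
        then have d0: "0 < d" using d by simp
        have FQ: "F \<subseteq> Q" using FT Q by blast
        have "mass ?u F \<le> ennreal V" unfolding V(1)[symmetric] by (intro mass_mono FQ) simp
        then obtain W where W: "mass ?u F = ennreal W" "0 \<le> W"
          by (cases "mass ?u F") (auto simp: top_unique)
        have Y: "d \<le> \<theta> * W + \<theta> powr ?e * S" if th: "0 < \<theta>" for \<theta>
        proof -
          have "ennreal d = (\<integral>\<^sup>+x. indicator F x \<partial>lebesgue)" using d by simp
          also have "\<dots> \<le> (\<integral>\<^sup>+x. ennreal \<theta> * (?u x * indicator F x) + ennreal (\<theta> powr ?e) * (?s x * indicator F x) \<partial>lebesgue)"
          proof (rule nn_integral_mono_AE)
            show "AE x in lebesgue. indicator F x \<le> ennreal \<theta> * (?u x * indicator F x) + ennreal (\<theta> powr ?e) * (?s x * indicator F x)"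
              using weight_AE_pos[OF w]
            proof eventually_elim
              case (elim x)
              then have v: "0 < v x" by simp
              have "1 \<le> \<theta> * v x + \<theta> powr ?e * v x powr ?e"
              proof (cases "1 \<le> \<theta> * v x")
                case True
                then show ?thesis by (simp add: add_increasing2)
              next
                case False
                then have "1 powr ?e \<le> (\<theta> * v x) powr ?e"
                  using v th p by (intro powr_mono2') (auto simp: field_simps)
                then show ?thesis using v th by (simp add: powr_mult add_increasing)
              qed
              then have "ennreal 1 \<le> ennreal (\<theta> * v x + \<theta> powr ?e * v x powr ?e)"
                by (rule ennreal_leI)
              also have "\<dots> = ennreal \<theta> * ?u x + ennreal (\<theta> powr ?e) * ?s x"
                using v th by (simp add: ennreal_mult)
              finally show ?case by (auto split: split_indicator)
            qed
          qed
          also have "\<dots> = ennreal \<theta> * mass ?u F + ennreal (\<theta> powr ?e) * mass ?s F"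
            by (simp add: nn_integral_add nn_integral_cmult emeasure_density)
          also have "\<dots> \<le> ennreal \<theta> * mass ?u F + ennreal (\<theta> powr ?e) * mass ?s Q"
            by (intro add_left_mono mult_left_mono mass_mono FQ) auto
          also have "\<dots> = ennreal (\<theta> * W + \<theta> powr ?e * S)"
            using th W S by (simp add: ennreal_mult)
          finally show ?thesis using th W S by (subst (asm) ennreal_le_iff) auto
        qed
        have main: "d powr p * V \<le> 2 powr p * C * ?t powr p * W"
          by (rule Ap_subset_real[OF p S(2) d0 V(2) t W(2) C(2) A Y])
        have "d ^ r * V \<le> K * ?t ^ r * W"
        proof -
          have "(d / ?t) powr real r \<le> (d / ?t) powr p"
            using r d0 d by (intro powr_mono') auto
          then have 1: "d ^ r / ?t ^ r \<le> d powr p / ?t powr p"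
            using d0 t by (simp add: powr_realpow power_divide powr_divide)
          have "d ^ r / ?t ^ r * V \<le> d powr p / ?t powr p * V"
            using 1 V by (intro mult_right_mono) auto
          also have "\<dots> \<le> 2 powr p * C * W"
            using main t by (simp add: field_simps)
          also have "\<dots> \<le> K * W" using K W by (intro mult_right_mono) auto
          finally show ?thesis using t by (simp add: field_simps)
        qed
        then have "ennreal (d ^ r * V) \<le> ennreal (K * ?t ^ r * W)" by (rule ennreal_leI)
        moreover have "ennreal (d ^ r * V) = emeasure lebesgue F ^ r * mass ?u Q"
          using d V by (simp add: ennreal_mult ennreal_power)
        moreover have "ennreal (K * ?t ^ r * W) = ennreal K * emeasure lebesgue (triple P) ^ r * mass ?u F"
        proof -
          have nn: "0 \<le> K" "0 \<le> ?t" using K by auto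
          show ?thesis
            unfolding emeasure_triple W(1) ennreal_power[OF nn(2)]
            using nn W(2) by (simp only: ennreal_mult zero_le_power mult_nonneg_nonneg)
        qed
        ultimately show ?thesis
          using mult_left_mono[OF le, of "emeasure lebesgue F ^ r"] by simp
      qed
    qed
    with pos le finQ show ?thesis by auto
  qed
  then have "Ainf_cond K r ?u" unfolding Ainf_cond_def by auto
  with K r show ?thesis by blast
qed

section \<open>Exponential decay for \<open>A\<^sub>1\<close> weights\<close>

text \<open>Fine dyadic cubes shrink to each of their points.\<close>

lemma small_dyadic_in_open:
  fixes x :: "real ^ 'n::finite"
  assumes "open S" "x \<in> S"
  obtains k where "k \<le> k0" "dyadic (cell k x) \<subseteq> S"
proof -
  obtain e where e: "0 < e" "ball x e \<subseteq> S" using assms by (meson openE)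
  obtain N where N: "(1 / 2) ^ N < e / real CARD('n)"
    using real_arch_pow_inv[of "e / real CARD('n)" "1 / 2"] e by auto
  define M where "M = max N (nat (- k0))"
  have "(1 / 2 :: real) ^ M \<le> (1 / 2) ^ N" by (intro power_decreasing) (auto simp: M_def)
  then have "(1 / 2 :: real) ^ M < e / real CARD('n)" using N by linarith
  then have M: "(1 / 2) ^ M * real CARD('n) < e" by (simp only: pos_less_divide_eq zero_less_card_finite of_nat_0_less_iff)
  have side: "(2::real) powi (- int M) = (1 / 2) ^ M" by (simp add: power_int_minus power_one_over field_simps)
  have "dyadic (cell (- int M) x) \<subseteq> ball x e"
  proof
    fix y assume y: "y \<in> dyadic (cell (- int M) x)"
    have "norm (y - x) \<le> (\<Sum>i\<in>UNIV. \<bar>(y - x) $ i\<bar>)" by (rule norm_le_l1_cart)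
    also have "\<dots> \<le> (\<Sum>i\<in>(UNIV :: 'n set). (1 / 2) ^ M)"
      using dyadic_coordinate_near[OF mem_dyadic_cell y] by (intro sum_mono) (simp add: side less_imp_le)
    also have "\<dots> = (1 / 2) ^ M * real CARD('n)" by simp
    also have "\<dots> < e" by (rule M)
    finally show "y \<in> ball x e" by (simp add: dist_norm norm_minus_commute)
  qed
  then show thesis using e by (intro that[of "- int M"]) (auto simp: M_def)
qed

text \<open>At least half of each maximal cube at height \<open>c\<close> is missed by the higher level set. By the \<open>A\<^sub>1\<close>
condition that half carries at least the proportion \<open>1 / (2 * A)\<close> of the \<open>u\<close>-mass of the cube.\<close>

lemma A1_cond_level_set_step:
  fixes u g :: "real ^ 'n::finite \<Rightarrow> ennreal"
  assumes u: "A1_cond A u" and A: "1 \<le> A"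
    and fin: "mass g UNIV < \<infinity>" and c: "0 < c" "c < \<infinity>"
  shows "mass u (level_set g (2 * 2 ^ CARD('n) * c)) \<le> ennreal (1 - 1 / (2 * A)) * mass u (level_set g c)"
proof -
  let ?W = "level_set g (2 * 2 ^ CARD('n) * c)"
  let ?\<theta> = "1 - 1 / (2 * A)"
  have \<theta>: "0 \<le> ?\<theta>" using A by (simp add: field_simps)
  note A1 = A1_condD[OF u, of 0, simplified]
  note [measurable] = A1(1)
  have mW: "mass (\<lambda>x. u x * indicator ?W x) B = mass u (B \<inter> ?W)" if "B \<in> sets lebesgue" for B
    using that by (intro mass_mult_indicator) auto
  have "1 * mass (\<lambda>x. u x * indicator ?W x) (\<Union>q\<in>maximal_cubes g c. dyadic q)
      \<le> ennreal ?\<theta> * mass u (\<Union>q\<in>maximal_cubes g c. dyadic q)"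
  proof (intro emeasure_UN_mult_le countable_cube_index disjoint_maximal_cubes)
    fix q assume q: "q \<in> maximal_cubes g c"
    have "dyadic q - ?W \<subseteq> triple q" using block_mono[of 0 1 q] by auto
    then obtain t where t: "emeasure lebesgue (dyadic q - ?W) = ennreal t" "0 \<le> t"
      using emeasure_subset_triple_real by blast
    have tv: "vol q / 2 \<le> t" using level_set_complement_large[OF fin c q t] by simp
    obtain U where U: "mass u (dyadic q) = ennreal U" "0 \<le> U"
      using A1(3)[of q] by (cases "mass u (dyadic q)") auto
    have sub: "mass u B \<le> ennreal U" if "B \<subseteq> dyadic q" for B
      unfolding U(1)[symmetric] by (intro mass_mono that) simp
    obtain a where a: "mass u (dyadic q \<inter> ?W) = ennreal a" "0 \<le> a"
      using sub[of "dyadic q \<inter> ?W"] by (cases "mass u (dyadic q \<inter> ?W)") (auto simp: top_unique)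
    obtain b where b: "mass u (dyadic q - ?W) = ennreal b" "0 \<le> b"
      using sub[of "dyadic q - ?W"] by (cases "mass u (dyadic q - ?W)") (auto simp: top_unique)
    have "ennreal (t * U) \<le> ennreal (A * vol q * b)"
      using A1_cond_subset[OF u, of 0 "dyadic q - ?W" q] t U b A by (simp add: ennreal_mult)
    then have "t * U \<le> A * vol q * b" using A b by (simp add: ennreal_le_iff)
    moreover have "vol q / 2 * U \<le> t * U" using tv U by (intro mult_right_mono) auto
    ultimately have "vol q * U \<le> 2 * (A * vol q * b)" by linarith
    also have "\<dots> = vol q * (2 * A * b)" by simp
    finally have "U \<le> 2 * A * b" by (simp only: mult_le_cancel_left_pos vol_pos)
    then have "U / (2 * A) \<le> b" using A by (simp add: field_simps)
    moreover have "ennreal (a + b) = mass u ((dyadic q \<inter> ?W) \<union> (dyadic q - ?W))"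
      unfolding ennreal_plus[OF a(2) b(2)] a(1)[symmetric] b(1)[symmetric]
      by (intro plus_emeasure) auto
    then have "ennreal (a + b) = ennreal U" by (simp only: Int_Diff_Un U)
    then have "a + b = U" using a b U by (simp del: ennreal_plus)
    ultimately have "a \<le> ?\<theta> * U" by (simp add: algebra_simps)
    then have "ennreal a \<le> ennreal ?\<theta> * ennreal U"
      using \<theta> U by (simp add: ennreal_mult[symmetric] ennreal_leI)
    then show "1 * mass (\<lambda>x. u x * indicator ?W x) (dyadic q) \<le> ennreal ?\<theta> * mass u (dyadic q)"
      by (simp add: mW a U)
  qed auto
  moreover have "?W \<subseteq> level_set g c"
    by (intro level_set_antimono[OF fin c(1)] le_level_factor)
  ultimately show ?thesis
    unfolding level_set_def[symmetric] by (simp add: mW Int_absorb1)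
qed

text \<open>This is the \<open>A\<^sub>\<infinity>\<close> property of \<open>A\<^sub>1\<close> weights as an upper bound: each factor \<open>b = 1 / (2 * 2 ^ n)\<close> in the
size of \<open>F\<close> gains a factor \<open>\<theta> = 1 - 1 / (2 * A)\<close> in its mass.
Enclose \<open>F\<close> in an open set \<open>S\<close> that is still small, and let \<open>\<Omega>\<^sub>j\<close> be the level set of the indicator
\<open>g\<close> of \<open>S \<inter> triple p\<close> at height \<open>b ^ j\<close>. Then \<open>F \<subseteq> \<Omega>\<^sub>1\<close>, because points of
an open set lie in dyadic cubes inside it; \<open>\<Omega>\<^sub>J \<subseteq> triple p\<close>, because the cubes at that height are
smaller than \<open>p\<close>; and the mass shrinks by the factor \<open>\<theta>\<close> from each \<open>\<Omega>\<^sub>j\<^sub>+\<^sub>1\<close> to \<open>\<Omega>\<^sub>j\<close>.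
Working with the open set avoids Lebesgue's differentiation theorem.\<close>

lemma A1_cond_decay:
  fixes u :: "real ^ 'n::finite \<Rightarrow> ennreal"
  assumes u: "A1_cond A u" and A: "1 \<le> A"
    and F [measurable]: "F \<in> sets lebesgue" and FT: "F \<subseteq> triple p"
    and small: "emeasure lebesgue F < ennreal ((1 / (2 * 2 ^ CARD('n))) ^ J * vol p)"
  shows "mass u F \<le> ennreal ((1 - 1 / (2 * A)) ^ (J - 1)) * mass u (triple p)"
proof (cases "J = 0")
  case True
  then show ?thesis using mass_mono[OF FT, of u] by simp
next
  case False
  let ?b = "1 / (2 * 2 ^ CARD('n)) :: real"
  let ?\<theta> = "1 - 1 / (2 * A)"
  have b: "0 < ?b" "?b < 1"
  proof -
    have "(1::real) \<le> 2 ^ CARD('n)" by (rule one_le_power) simp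
    then have "(1::real) < 2 * 2 ^ CARD('n)" by linarith
    then show "0 < ?b" "?b < 1" by (simp_all add: field_simps)
  qed
  have \<theta>: "0 \<le> ?\<theta>" using A by (simp add: field_simps)
  obtain d where d: "emeasure lebesgue F = ennreal d" "0 \<le> d"
    using emeasure_subset_triple_real[OF FT] by blast
  have dsm: "d < ?b ^ J * vol p" using small d by (simp add: ennreal_less_iff)
  obtain S where S: "open S" "F \<subseteq> S" "S - F \<in> lmeasurable" "emeasure lebesgue (S - F) < ennreal (?b ^ J * vol p - d)"
    using sets_lebesgue_outer_open[OF F, of "?b ^ J * vol p - d"] dsm by auto
  have Ss [measurable]: "S \<in> sets lebesgue" using S(1) by auto
  have "emeasure lebesgue S \<le> emeasure lebesgue F + emeasure lebesgue (S - F)"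
  proof -
    have "emeasure lebesgue S = emeasure lebesgue (F \<union> (S - F))" using S(2) by (simp add: Un_absorb1)
    also have "\<dots> \<le> emeasure lebesgue F + emeasure lebesgue (S - F)"
      by (intro emeasure_subadditive) auto
    finally show ?thesis .
  qed
  also have "\<dots> < ennreal d + ennreal (?b ^ J * vol p - d)"
    unfolding d(1) using S(4) by (intro ennreal_add_left_cancel_less[THEN iffD2]) auto
  also have "\<dots> = ennreal (?b ^ J * vol p)" using dsm d by (simp flip: ennreal_plus)
  finally have Ssm: "emeasure lebesgue S < ennreal (?b ^ J * vol p)" .
  define g :: "real ^ 'n \<Rightarrow> ennreal" where "g = indicator (S \<inter> triple p)"
  have mg: "mass g B = emeasure lebesgue (B \<inter> (S \<inter> triple p))" if "B \<in> sets lebesgue" for B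
    using mass_mult_indicator[of "\<lambda>_. 1" B "S \<inter> triple p"] that
    unfolding g_def by (simp add: emeasure_density_const density_1)
  have fin: "mass g UNIV < \<infinity>"
  proof -
    have "mass g UNIV = emeasure lebesgue (S \<inter> triple p)" by (simp add: mg)
    also have "\<dots> \<le> emeasure lebesgue (triple p)" by (intro emeasure_mono) auto
    also have "\<dots> < \<infinity>" by (simp only: emeasure_triple) simp
    finally show ?thesis .
  qed
  let ?L = "\<lambda>j. level_set g (ennreal (?b ^ j))"
  have "F \<subseteq> ?L 1"
  proof
    fix x assume x: "x \<in> F"
    then obtain k where k: "k \<le> fst p" "dyadic (cell k x) \<subseteq> S"
      using small_dyadic_in_open[OF S(1), of x] S(2) by blast
    have "dyadic (cell k x) \<subseteq> triple p"
      using x FT k(1) by (intro dyadic_subset_block[of x]) auto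
    then have "mass g (dyadic (cell k x)) = ennreal (vol (cell k x))"
      using k(2) by (simp only: mg sets_block Int_absorb2 le_inf_iff emeasure_dyadic)
    moreover have "ennreal (?b ^ 1) * ennreal (vol (cell k x)) < ennreal (vol (cell k x))"
    proof -
      have "?b * vol (cell k x) < 1 * vol (cell k x)" using b by (intro mult_strict_right_mono) auto
      then show ?thesis using b by (simp add: ennreal_mult[symmetric] ennreal_lessI)
    qed
    ultimately obtain m where "ancestor m (cell k x) \<in> maximal_cubes g (ennreal (?b ^ 1))"
      using maximal_ancestor_exists[OF fin, of "ennreal (?b ^ 1)" "cell k x"] b by auto
    moreover have "x \<in> dyadic (ancestor m (cell k x))"
      using dyadic_subset_ancestor[of "cell k x" m] by auto
    ultimately show "x \<in> ?L 1" unfolding level_set_def by blast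
  qed
  then have F1: "mass u F \<le> mass u (?L 1)" by (intro mass_mono) auto
  have iter: "mass u (?L 1) \<le> ennreal (?\<theta> ^ i) * mass u (?L (1 + i))" for i
  proof (induction i)
    case 0
    show ?case by simp
  next
    case (Suc i)
    have eq: "2 * 2 ^ CARD('n) * ennreal (?b ^ Suc (1 + i)) = ennreal (?b ^ (1 + i))"
    proof -
      have "2 * 2 ^ CARD('n) * ennreal (?b ^ Suc (1 + i)) = ennreal (2 * 2 ^ CARD('n) * ?b ^ Suc (1 + i))"
        by (simp only: ennreal_mult ennreal_power[symmetric] ennreal_numeral zero_le_numeral
          zero_le_power zero_le_divide_1_iff mult_nonneg_nonneg)
      also have "2 * 2 ^ CARD('n) * ?b ^ Suc (1 + i) = ?b ^ (1 + i)" by simp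
      finally show ?thesis .
    qed
    have "mass u (?L (1 + i)) \<le> ennreal ?\<theta> * mass u (?L (1 + Suc i))"
      using A1_cond_level_set_step[OF u A fin, of "ennreal (?b ^ Suc (1 + i))"] b
      unfolding eq by simp
    then have "ennreal (?\<theta> ^ i) * mass u (?L (1 + i)) \<le> ennreal (?\<theta> ^ i) * (ennreal ?\<theta> * mass u (?L (1 + Suc i)))"
      by (rule mult_left_mono) simp
    also have "\<dots> = ennreal (?\<theta> ^ Suc i) * mass u (?L (1 + Suc i))"
      using \<theta> by (simp only: power_Suc ennreal_mult zero_le_power mult_ac)
    finally show ?case using Suc by order
  qed
  note F1
  also have "mass u (?L 1) \<le> ennreal (?\<theta> ^ (J - 1)) * mass u (?L J)"
    using iter[of "J - 1"] False by simp
  also have "ennreal (?\<theta> ^ (J - 1)) * mass u (?L J) \<le> ennreal (?\<theta> ^ (J - 1)) * mass u (triple p)"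
  proof (intro mult_left_mono mass_mono)
    show "?L J \<subseteq> triple p"
    proof
      fix x assume "x \<in> ?L J"
      then obtain q where q: "q \<in> maximal_cubes g (ennreal (?b ^ J))" "x \<in> dyadic q"
        by (auto simp: level_set_def)
      have lt: "ennreal (?b ^ J) * ennreal (vol q) < mass g (dyadic q)"
        by (rule maximal_cubes_average[OF q(1)])
      also have "\<dots> \<le> emeasure lebesgue S" by (simp add: mg del: emeasure_completion) (intro emeasure_mono; auto)
      also note Ssm
      finally have "?b ^ J * vol q < ?b ^ J * vol p"
        using b by (simp add: ennreal_mult[symmetric] ennreal_less_iff)
      then have "vol q < vol p" using b by (simp only: mult_less_cancel_left_pos zero_less_power)
      then have "fst q \<le> fst p"
      proof (rule contrapos_pp)
        assume "\<not> fst q \<le> fst p"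
        then have "(2::real) powi fst p \<le> 2 powi fst q" by (intro power_int_increasing) auto
        then show "\<not> vol q < vol p" unfolding vol_def by (simp add: not_less power_mono)
      qed
      moreover have "dyadic q \<inter> (S \<inter> triple p) \<noteq> {}"
      proof
        assume "dyadic q \<inter> (S \<inter> triple p) = {}"
        then have "mass g (dyadic q) = 0" by (simp only: mg sets_block emeasure_empty)
        with lt show False by simp
      qed
      then obtain z where "z \<in> dyadic q" "z \<in> triple p" by auto
      ultimately have "dyadic q \<subseteq> triple p" by (intro dyadic_subset_block)
      then show "x \<in> triple p" using q(2) by auto
    qed
  qed simp_all
  finally show ?thesis .
qed

section \<open>Unions of dyadic cubes\<close>

text \<open>Dyadic cubes are nested or disjoint, so the inclusion-maximal members of the family are disjoint
and have the same union.\<close>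

lemma finite_dyadic_disjoint_cover:
  assumes "finite (G :: 'n::finite cube_index set)"
  shows "\<exists>H\<subseteq>G. disjoint_family_on dyadic H \<and> (\<Union>p\<in>H. dyadic p) = (\<Union>p\<in>G. dyadic p)"
  using assms
proof (induction G)
  case empty
  show ?case by (intro exI[of _ "{}"]) (auto simp: disjoint_family_on_def)
next
  case (insert p G)
  then obtain H where H: "H \<subseteq> G" "disjoint_family_on dyadic H" "(\<Union>p\<in>H. dyadic p) = (\<Union>p\<in>G. dyadic p)"
    by blast
  show ?case
  proof (cases "\<exists>q\<in>H. dyadic p \<subseteq> dyadic q")
    case True
    then show ?thesis using H by (intro exI[of _ H]) auto
  next
    case False
    let ?H = "insert p {q \<in> H. \<not> dyadic q \<subseteq> dyadic p}"
    have dis: "dyadic p \<inter> dyadic q = {}" if "q \<in> H" "\<not> dyadic q \<subseteq> dyadic p" for q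
    proof (rule ccontr)
      assume "dyadic p \<inter> dyadic q \<noteq> {}"
      then obtain x where x: "x \<in> dyadic p" "x \<in> dyadic q" by auto
      have "dyadic p \<subseteq> dyadic q \<or> dyadic q \<subseteq> dyadic p"
        using dyadic_nested[OF x] dyadic_nested[OF x(2,1)] linear by blast
      then show False using that False by blast
    qed
    have "disjoint_family_on dyadic ?H"
      using H(2) dis unfolding disjoint_family_on_def by blast
    moreover have "(\<Union>p\<in>?H. dyadic p) = (\<Union>p\<in>insert p G. dyadic p)"
      using H(3) by blast
    moreover have "?H \<subseteq> insert p G" using H(1) by blast
    ultimately show ?thesis by blast
  qed
qed

text \<open>The cubes may overlap. For a finite family one passes to the maximal members, and the general case
follows by monotone convergence of the partial unions.\<close>

lemma dyadic_union_mass_le: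
  fixes G :: "'n::finite cube_index set"
  assumes le: "\<And>p. p \<in> G \<Longrightarrow> mass v (dyadic p) \<le> c * mass f (dyadic p)"
  shows "mass v (\<Union>p\<in>G. dyadic p) \<le> c * mass f (\<Union>p\<in>G. dyadic p)"
proof (cases "G = {}")
  case False
  let ?G = "\<lambda>i. from_nat_into G ` {..i}"
  let ?U = "\<lambda>i. \<Union>p\<in>?G i. dyadic p"
  have sub: "?G i \<subseteq> G" for i using from_nat_into[OF False] by auto
  have Us: "(\<Union>p\<in>I. dyadic p) \<in> sets lebesgue" for I :: "'n cube_index set"
    by (intro sets.countable_UN'' countable_cube_index) auto
  have "(\<Union>i. ?U i) = (\<Union>p\<in>G. dyadic p)"
  proof -
    have "(\<Union>i. ?G i) = G"
    proof -
      have "(\<Union>i. ?G i) = range (from_nat_into G)" by blast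
      then show ?thesis using range_from_nat_into[OF False countable_cube_index] by simp
    qed
    then show ?thesis by (simp only: UN_UN_flatten[symmetric])
  qed
  then have "mass v (\<Union>p\<in>G. dyadic p) = (SUP i. mass v (?U i))"
  proof -
    have "incseq ?U" by (intro monoI UN_mono image_mono) auto
    then have "(SUP i. mass v (?U i)) = mass v (\<Union>i. ?U i)"
      using Us by (intro SUP_emeasure_incseq) auto
    then show ?thesis using \<open>(\<Union>i. ?U i) = (\<Union>p\<in>G. dyadic p)\<close> by simp
  qed
  also have "\<dots> \<le> c * mass f (\<Union>p\<in>G. dyadic p)"
  proof (rule SUP_least)
    fix i
    obtain H where H: "H \<subseteq> ?G i" "disjoint_family_on dyadic H" "(\<Union>p\<in>H. dyadic p) = ?U i"
      using finite_dyadic_disjoint_cover[of "?G i"] by blast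
    have "1 * mass v (\<Union>p\<in>H. dyadic p) \<le> c * mass f (\<Union>p\<in>H. dyadic p)"
      using H sub[of i] by (intro emeasure_UN_mult_le countable_cube_index) (auto intro!: le)
    also have "\<dots> \<le> c * mass f (\<Union>p\<in>G. dyadic p)"
      using H(1) sub[of i] Us by (intro mult_left_mono mass_mono UN_mono) auto
    finally show "mass v (?U i) \<le> c * mass f (\<Union>p\<in>G. dyadic p)" using H(3) by simp
  qed
  finally show ?thesis .
qed simp

section \<open>Sums over powers\<close>

lemma powi_bracket:
  fixes b y :: real
  assumes "1 < b" "0 < y"
  obtains l :: int where "b powi l < y" "y \<le> b powi (l + 1)"
proof
  let ?l = "\<lceil>log b y\<rceil> - 1"
  have "b powi ?l = b powr real_of_int ?l" using assms powr_real_of_int'[of b ?l] by simp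
  also have "\<dots> < b powr (log b y)" using assms by (intro powr_less_mono) linarith+
  also have "\<dots> = y" using assms by simp
  finally show "b powi ?l < y" .
  have "y = b powr (log b y)" using assms by simp
  also have "\<dots> \<le> b powr real_of_int \<lceil>log b y\<rceil>" using assms by (intro powr_mono) auto
  also have "\<dots> = b powi (?l + 1)" using assms by (simp add: powr_real_of_int')
  finally show "y \<le> b powi (?l + 1)" .
qed

lemma ennreal_powi_bracket:
  fixes b :: real and y :: ennreal
  assumes "1 < b" "0 < y" "y < \<infinity>"
  obtains l :: int where "ennreal (b powi l) < y" "y \<le> ennreal (b powi (l + 1))"
proof -
  obtain z where z: "y = ennreal z" "0 < z" using assms by (cases y) auto
  obtain l where "b powi l < z" "z \<le> b powi (l + 1)" using powi_bracket[OF assms(1) z(2)] .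
  then show thesis using assms(1) z by (intro that[of l]) (auto simp: ennreal_less_iff ennreal_leI)
qed

text \<open>The intervals \<open>[2 ^ j, 2 ^ (j + 1))\<close> have length \<open>2 ^ j\<close>, are disjoint, and for \<open>2 ^ j < y\<close> they lie in
\<open>[0, 2 * y]\<close>.\<close>

lemma nn_integral_powers_below:
  fixes y :: ennreal
  shows "(\<integral>\<^sup>+j. ennreal (2 powi j) * indicator {j. ennreal (2 powi j) < y} j \<partial>count_space (UNIV :: int set)) \<le> 2 * y"
proof (cases "y = \<infinity>")
  case False
  then obtain z where z: "y = ennreal z" "0 \<le> z" by (cases y) auto
  let ?J = "{j :: int. ennreal (2 powi j) < y}"
  let ?X = "\<lambda>j :: int. {2 powi j..<2 powi (j + 1) :: real}"
  have len: "emeasure lborel (?X j) = ennreal (2 powi j)" for j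
    by (simp add: power_int_add)
  have dis: "disjoint_family_on ?X ?J"
    unfolding disjoint_family_on_def
  proof (intro ballI impI)
    fix i j :: int assume "i \<noteq> j"
    have *: "?X i \<inter> ?X j = {}" if "i < j" for i j :: int
    proof -
      have "(2::real) powi (i + 1) \<le> 2 powi j" using that by (intro power_int_increasing) auto
      then show ?thesis by auto
    qed
    show "?X i \<inter> ?X j = {}" using *[of i j] *[of j i] \<open>i \<noteq> j\<close> by (cases "i < j") auto
  qed
  have "(\<integral>\<^sup>+j. ennreal (2 powi j) * indicator ?J j \<partial>count_space UNIV) = (\<integral>\<^sup>+j. emeasure lborel (?X j) \<partial>count_space ?J)"
    unfolding len by (simp add: nn_integral_count_space_indicator)
  also have "\<dots> = emeasure lborel (\<Union>j\<in>?J. ?X j)"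
    using dis by (intro emeasure_UN_countable[symmetric]) auto
  also have "\<dots> \<le> emeasure lborel {0..2 * z}"
  proof (intro emeasure_mono subsetI)
    fix x assume "x \<in> (\<Union>j\<in>?J. ?X j)"
    then obtain j :: int where j: "2 powi j < z" "2 powi j \<le> x" "x < 2 powi (j + 1)"
      using z by (auto simp: ennreal_less_iff)
    have "0 < (2::real) powi j" by simp
    moreover have "(2::real) powi (j + 1) = 2 * 2 powi j" by (simp add: power_int_add)
    ultimately show "x \<in> {0..2 * z}" using j by (auto intro: less_imp_le)
  qed simp
  also have "\<dots> = 2 * y" using z by (simp add: ennreal_mult)
  finally show ?thesis .
qed (simp add: ennreal_mult_top)

lemma nn_integral_int_nat_abs:
  fixes g :: "nat \<Rightarrow> ennreal"
  shows "(\<integral>\<^sup>+l. g (nat \<bar>l\<bar>) \<partial>count_space (UNIV :: int set)) \<le> 2 * (\<Sum>q. g q)"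
proof -
  have "(\<integral>\<^sup>+l. g (nat \<bar>l\<bar>) \<partial>count_space (UNIV :: int set))
    = (\<integral>\<^sup>+l. \<integral>\<^sup>+q. g q * indicator {nat \<bar>l\<bar>} q \<partial>count_space UNIV \<partial>count_space (UNIV :: int set))"
    by (simp add: nn_integral_indicator_singleton)
  also have "\<dots> = (\<integral>\<^sup>+q. \<integral>\<^sup>+l. g q * indicator {nat \<bar>l\<bar>} q \<partial>count_space (UNIV :: int set) \<partial>count_space UNIV)"
    by (intro nn_integral_count_space_nn_integral) auto
  also have "\<dots> \<le> (\<integral>\<^sup>+q. 2 * g q \<partial>count_space UNIV)"
  proof (intro nn_integral_mono)
    fix q :: nat
    have "(\<integral>\<^sup>+l. g q * indicator {nat \<bar>l\<bar>} q \<partial>count_space (UNIV :: int set))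
      = (\<integral>\<^sup>+l. g q * indicator {l. nat \<bar>l\<bar> = q} l \<partial>count_space (UNIV :: int set))"
      by (intro nn_integral_cong) (auto split: split_indicator)
    also have "\<dots> = g q * emeasure (count_space UNIV) {l :: int. nat \<bar>l\<bar> = q}"
      by (intro nn_integral_cmult_indicator) simp
    also have "\<dots> \<le> g q * emeasure (count_space UNIV) {int q, - int q}"
      by (intro mult_left_mono emeasure_mono) auto
    also have "g q * emeasure (count_space UNIV) {int q, - int q} \<le> g q * 2"
      by (intro mult_left_mono, subst emeasure_count_space) (auto simp: card_insert_if)
    finally show "(\<integral>\<^sup>+l. g q * indicator {nat \<bar>l\<bar>} q \<partial>count_space (UNIV :: int set)) \<le> 2 * g q"
      by (simp only: mult.commute)
  qed
  also have "\<dots> = 2 * (\<Sum>q. g q)" by (simp add: nn_integral_count_space_nat)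
  finally show ?thesis .
qed

text \<open>The factor gained on the portion of a triple where \<open>v\<close> is \<open>a ^ q\<close> times larger or smaller than its
average: \<open>\<theta> = 1 - 1 / (2 * A)\<close> comes from the \<open>A\<^sub>1\<close> weight, and \<open>r\<close> and \<open>c\<close> come from the exponent and
the constant of the \<open>A\<^sub>\<infinity>\<close> weight. The subtractions truncate at zero: small \<open>q\<close> give no gain.\<close>

definition decay :: "real \<Rightarrow> nat \<Rightarrow> nat \<Rightarrow> nat \<Rightarrow> real" where
  "decay \<theta> c r q = \<theta> ^ ((q - c) div r - 1)"

lemma decay_summable:
  assumes "0 < \<theta>" "\<theta> < 1" "0 < r"
  shows "(\<integral>\<^sup>+l. ennreal (decay \<theta> c r (nat \<bar>l\<bar>)) \<partial>count_space (UNIV :: int set)) < \<infinity>"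
proof -
  define \<rho> where "\<rho> = \<theta> powr (1 / real r)"
  define B where "B = \<theta> powr (- (real c / real r) - 2)"
  have \<rho>: "0 < \<rho>" "\<rho> < 1"
    using assms powr_less_mono'[of \<theta> 0 "1 / real r"] by (auto simp: \<rho>_def)
  have bound: "decay \<theta> c r q \<le> B * \<rho> ^ q" for q
  proof -
    have "real ((q - c) div r) \<ge> real (q - c) / real r - 1"
    proof -
      have "q - c < r * ((q - c) div r) + r"
        using mult_div_mod_eq[of r "q - c"] mod_less_divisor[OF assms(3), of "q - c"] by linarith
      then have "real (q - c) < real (r * ((q - c) div r) + r)" by (simp only: of_nat_less_iff)
      then have "real (q - c) \<le> real r * (real ((q - c) div r) + 1)" by (simp only: of_nat_add of_nat_mult) (simp add: algebra_simps)
      then have "real (q - c) / real r \<le> real ((q - c) div r) + 1"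
        using assms(3) by (simp only: pos_divide_le_eq of_nat_0_less_iff mult.commute)
      then show ?thesis by linarith
    qed
    moreover have "real (q - c) / real r \<ge> real q / real r - real c / real r"
      using divide_right_mono[of "real q - real c" "real (q - c)" "real r"] by (simp add: diff_divide_distrib)
    moreover have "real ((q - c) div r - 1) \<ge> real ((q - c) div r) - 1" by linarith
    ultimately have e: "real q / real r - real c / real r - 2 \<le> real ((q - c) div r - 1)" by linarith
    have "decay \<theta> c r q = \<theta> powr real ((q - c) div r - 1)"
      using assms by (simp add: decay_def powr_realpow)
    also have "\<dots> \<le> \<theta> powr (real q / real r - real c / real r - 2)"
      using e assms by (intro powr_mono') auto
    also have "\<dots> = \<theta> powr (- (real c / real r) - 2) * \<theta> powr (1 / real r * real q)"
      by (simp add: powr_add[symmetric] algebra_simps)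
    also have "\<theta> powr (1 / real r * real q) = \<rho> ^ q"
    proof -
      have "\<theta> powr (1 / real r * real q) = \<rho> powr real q"
        unfolding \<rho>_def by (rule powr_powr[symmetric])
      also have "\<dots> = \<rho> ^ q" by (rule powr_realpow[OF \<rho>(1)])
      finally show ?thesis .
    qed
    finally show ?thesis by (simp add: B_def)
  qed
  have "(\<integral>\<^sup>+l. ennreal (decay \<theta> c r (nat \<bar>l\<bar>)) \<partial>count_space (UNIV :: int set)) \<le> 2 * (\<Sum>q. ennreal (decay \<theta> c r q))"
    by (rule nn_integral_int_nat_abs)
  also have "\<dots> \<le> 2 * (\<Sum>q. ennreal (B * \<rho> ^ q))"
    by (intro mult_left_mono suminf_le ennreal_leI bound) auto
  also have "(\<Sum>q. ennreal (B * \<rho> ^ q)) = ennreal (\<Sum>q. B * \<rho> ^ q)"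
    using \<rho> by (intro suminf_ennreal2 summable_mult summable_geometric) (auto simp: B_def)
  also have "2 * \<dots> < \<infinity>" by (simp add: ennreal_mult_less_top)
  finally show ?thesis .
qed

section \<open>The mixed inequality for one function\<close>

text \<open>The height \<open>\<lambda>\<close> of the weak type estimate is absorbed in \<open>v\<close>, so the superlevel set is \<open>{v < dmax f}\<close>.
The base \<open>a\<close> is the ratio of heights at which the level sets halve inside each maximal cube.\<close>

locale weighted_stopping =
  fixes u v f :: "real ^ 'n::finite \<Rightarrow> ennreal" and A K :: real and r :: nat and a :: real
  assumes u: "A1_cond A u" and A: "1 \<le> A"
    and v: "Ainf_cond K r v" and K: "0 < K" and r: "0 < r"
    and f [measurable]: "f \<in> borel_measurable lebesgue" and fin: "mass f UNIV < \<infinity>"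
    and a: "a = 2 * 2 ^ CARD('n)"
begin

lemma u_measurable [measurable]: "u \<in> borel_measurable lebesgue"
  using A1_condD(1)[OF u, of 0] by simp

lemma v_measurable [measurable]: "v \<in> borel_measurable lebesgue"
  by (rule Ainf_condD(1)[OF v])

lemma a_gt_1: "1 < a"
proof -
  have "(1::real) \<le> 2 ^ CARD('n)" by (rule one_le_power) simp
  then show ?thesis unfolding a by linarith
qed

lemma a_powi_pos [simp]: "0 < a powi k"
  using a_gt_1 by simp

lemma a_powi_nonneg [simp]: "0 \<le> a powi k"
  using a_powi_pos[of k] by (rule less_imp_le)

lemma a_powi_Suc: "a powi (k + 1) = a * a powi k"
  using a_gt_1 by (simp add: power_int_add)

definition stratum :: "int \<Rightarrow> 'n cube_index \<Rightarrow> (real ^ 'n) set" where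
  "stratum k p = {x \<in> triple p. ennreal (a powi k) < v x \<and> v x \<le> ennreal (a powi (k + 1))}"

lemma sets_stratum [measurable]: "stratum k p \<in> sets lebesgue"
proof -
  have "{x \<in> space lebesgue. ennreal (a powi k) < v x \<and> v x \<le> ennreal (a powi (k + 1))} \<in> sets lebesgue"
    by measurable
  then have "triple p \<inter> {x. ennreal (a powi k) < v x \<and> v x \<le> ennreal (a powi (k + 1))} \<in> sets lebesgue"
    by auto
  then show ?thesis by (simp add: stratum_def Collect_conj_eq)
qed

text \<open>The average of \<open>v\<close> over the triple is about \<open>a ^ (k + l)\<close>, so \<open>l\<close> measures how far the
stratum \<open>v \<approx> a ^ k\<close> is from typical.\<close>

definition v_level :: "int \<Rightarrow> int \<Rightarrow> 'n cube_index \<Rightarrow> bool" where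
  "v_level k l p \<longleftrightarrow> ennreal (a powi (k + l)) * emeasure lebesgue (triple p) < mass v (triple p) \<and>
     mass v (triple p) \<le> ennreal (a powi (k + l + 1)) * emeasure lebesgue (triple p)"

text \<open>For large positive \<open>l\<close> the values of \<open>v\<close> on the stratum are much smaller than its average, and the
\<open>A\<^sub>\<infinity>\<close> condition forces the stratum to be small. For large negative \<open>l\<close> they are much larger, and
Chebyshev's inequality does it.\<close>

lemma stratum_small:
  assumes l: "v_level k l p" and "0 < d" and d: "emeasure lebesgue (stratum k p) = ennreal d"
  shows "(d / (3 ^ CARD('n) * vol p)) ^ r * a powi \<bar>l\<bar> \<le> (K + 1) * a ^ r"
proof -
  let ?t = "3 ^ CARD('n) * vol p"
  let ?s = "d / ?t"
  have sub: "stratum k p \<subseteq> triple p" by (auto simp: stratum_def)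
  have t: "0 < ?t" by simp
  have dt: "d \<le> ?t"
    using emeasure_mono[OF sub, of lebesgue] unfolding d emeasure_triple by (simp add: ennreal_le_iff)
  have s: "0 < ?s" "?s \<le> 1" using t dt \<open>0 < d\<close> by (auto simp: field_simps)
  obtain V where V: "mass v (triple p) = ennreal V" "0 \<le> V"
    using Ainf_condD(3)[OF v, of p] by (cases "mass v (triple p)") auto
  have V1: "a powi (k + l) * ?t < V" "V \<le> a powi (k + l + 1) * ?t"
    using l V unfolding v_level_def emeasure_triple
    by (simp_all add: ennreal_mult[symmetric] ennreal_less_iff ennreal_le_iff)
  have up: "mass v (stratum k p) \<le> ennreal (a powi (k + 1)) * emeasure lebesgue (stratum k p)"
    using mass_le_mult[of v "\<lambda>_. 1" "stratum k p" "ennreal (a powi (k + 1))"]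
    by (simp add: stratum_def density_1)
  have lo: "ennreal (a powi k) * emeasure lebesgue (stratum k p) \<le> mass v (triple p)"
  proof -
    have "mass (\<lambda>_. ennreal (a powi k)) (stratum k p) \<le> 1 * mass v (stratum k p)"
      by (rule mass_le_mult) (auto simp: stratum_def less_imp_le)
    also have "\<dots> \<le> mass v (triple p)" using sub by (simp add: mass_mono)
    finally show ?thesis by (simp add: emeasure_density_const)
  qed
  show ?thesis
  proof (cases "0 \<le> l")
    case True
    have "ennreal (d ^ r * V) = emeasure lebesgue (stratum k p) ^ r * mass v (triple p)"
      using d V \<open>0 < d\<close> by (simp add: ennreal_mult ennreal_power)
    also have "\<dots> \<le> ennreal K * emeasure lebesgue (triple p) ^ r * mass v (stratum k p)"
      using sub by (intro Ainf_condD(4)[OF v]) auto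
    also have "\<dots> \<le> ennreal K * emeasure lebesgue (triple p) ^ r * (ennreal (a powi (k + 1)) * ennreal d)"
      using up unfolding d by (intro mult_left_mono) auto
    also have "\<dots> = ennreal (K * ?t ^ r * (a powi (k + 1) * d))"
    proof -
      have nn: "0 \<le> K" "0 \<le> ?t" "0 \<le> a powi (k + 1)" "0 \<le> d" using K \<open>0 < d\<close> by (auto intro: less_imp_le)
      show ?thesis unfolding emeasure_triple ennreal_power[OF nn(2)]
        using nn by (simp only: ennreal_mult zero_le_power mult_nonneg_nonneg)
    qed
    finally have "d ^ r * V \<le> K * ?t ^ r * (a powi (k + 1) * d)"
      using K \<open>0 < d\<close> by (simp add: ennreal_le_iff less_imp_le)
    also have "\<dots> \<le> K * ?t ^ r * (a powi (k + 1) * ?t)"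
      using K dt by (intro mult_left_mono) (auto intro: less_imp_le)
    finally have "d ^ r * V \<le> K * ?t ^ r * (a powi (k + 1) * ?t)" .
    moreover have "d ^ r * (a powi (k + l) * ?t) \<le> d ^ r * V"
      using V1 \<open>0 < d\<close> by (intro mult_left_mono) auto
    ultimately have "d ^ r * (a powi (k + l) * ?t) \<le> K * ?t ^ r * (a powi (k + 1) * ?t)" by linarith
    moreover have "a powi (k + l) = a powi k * a powi l" "a powi (k + 1) = a powi k * a"
      using a_gt_1 by (simp_all add: power_int_add)
    ultimately have "(a powi k * ?t) * (d ^ r * a powi l) \<le> (a powi k * ?t) * (K * ?t ^ r * a)"
      by (simp add: mult_ac)
    then have "d ^ r * a powi l \<le> K * ?t ^ r * a"
      using t by (simp only: mult_le_cancel_left_pos mult_pos_pos a_powi_pos)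
    then have "?s ^ r * a powi l \<le> K * a" using t by (simp add: power_divide field_simps)
    also have "\<dots> \<le> (K + 1) * a ^ r"
      using K a_gt_1 r power_increasing[of 1 r a] by (intro mult_mono) auto
    finally show ?thesis using True by simp
  next
    case False
    have "ennreal (a powi k * d) \<le> ennreal V"
      using lo \<open>0 < d\<close> unfolding d V by (simp add: ennreal_mult less_imp_le)
    then have "a powi k * d \<le> a powi (k + l + 1) * ?t"
      using V V1 by (simp add: ennreal_le_iff)
    moreover have "a powi (k + l + 1) = a powi k * (a powi l * a)"
      using a_gt_1 by (simp add: power_int_add)
    ultimately have "a powi k * d \<le> a powi k * (a powi l * a * ?t)" by (simp add: mult_ac)
    then have "d \<le> a powi l * a * ?t" by (simp only: mult_le_cancel_left_pos a_powi_pos)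
    then have "?s \<le> a powi l * a" using t by (simp add: field_simps)
    then have "?s * a powi (- l) \<le> (a powi l * a) * a powi (- l)"
      by (intro mult_right_mono) (auto intro: less_imp_le)
    also have "\<dots> = a" using a_gt_1 by (simp add: power_int_minus)
    finally have 1: "?s * a powi (- l) \<le> a" .
    have "?s ^ r * a powi (- l) \<le> ?s * a powi (- l)"
      using s r power_decreasing[of 1 r ?s] by (intro mult_right_mono) (auto intro: less_imp_le)
    also have "\<dots> \<le> 1 * a ^ r" using 1 a_gt_1 r power_increasing[of 1 r a] by simp
    also have "\<dots> \<le> (K + 1) * a ^ r" using K a_gt_1 by (intro mult_right_mono) auto
    finally show ?thesis using False by simp
  qed
qed

text \<open>The constant \<open>c\<close> absorbs \<open>K\<close> and the dimensional factors of \<open>stratum_small\<close>; after that, every \<open>r\<close>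
units of \<open>|l|\<close> are worth one more factor \<open>a\<close> in the size of the stratum.\<close>

lemma mass_stratum_le:
  assumes l: "v_level k l p" and c: "(K + 1) * a ^ r * (3 ^ CARD('n)) ^ r < a ^ c"
  shows "mass u (stratum k p) \<le> ennreal (decay (1 - 1 / (2 * A)) c r (nat \<bar>l\<bar>)) * mass u (triple p)"
proof -
  define J where "J = (nat \<bar>l\<bar> - c) div r"
  have sub: "stratum k p \<subseteq> triple p" by (auto simp: stratum_def)
  have "mass u (stratum k p) \<le> ennreal ((1 - 1 / (2 * A)) ^ (J - 1)) * mass u (triple p)"
  proof (cases "J = 0")
    case True
    then show ?thesis using mass_mono[OF sub, of u] by simp
  next
    case False
    obtain d where d: "emeasure lebesgue (stratum k p) = ennreal d" "0 \<le> d"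
      using emeasure_subset_triple_real[OF sub] by blast
    have "d < (1 / a) ^ J * vol p"
    proof (cases "d = 0")
      case True
      then show ?thesis using a_gt_1 by simp
    next
      case False
      then have d0: "0 < d" using d by simp
      let ?t = "3 ^ CARD('n) * vol p"
      let ?s = "d / ?t"
      have s: "0 < ?s" using d0 by simp
      have "r * J \<le> nat \<bar>l\<bar> - c" unfolding J_def by (rule times_div_less_eq_dividend)
      moreover have "c < nat \<bar>l\<bar>" using \<open>J \<noteq> 0\<close> unfolding J_def by (rule contrapos_np) simp
      ultimately have "c + r * J \<le> nat \<bar>l\<bar>" by linarith
      then have "a ^ c * (a ^ J) ^ r \<le> a ^ nat \<bar>l\<bar>"
        using a_gt_1 by (simp add: power_mult[symmetric] power_add[symmetric] mult.commute power_increasing)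
      also have "\<dots> = a powi \<bar>l\<bar>" by (simp add: power_int_def)
      finally have "?s ^ r * (a ^ c * (a ^ J) ^ r) \<le> ?s ^ r * a powi \<bar>l\<bar>"
        using s by (intro mult_left_mono) auto
      also have "\<dots> \<le> (K + 1) * a ^ r" by (rule stratum_small[OF l d0 d(1)])
      finally have "(?s ^ r * (a ^ c * (a ^ J) ^ r)) * (3 ^ CARD('n)) ^ r \<le> ((K + 1) * a ^ r) * (3 ^ CARD('n)) ^ r"
        by (intro mult_right_mono) auto
      also have "\<dots> < a ^ c * 1" using c by simp
      finally have "a ^ c * (?s * a ^ J * 3 ^ CARD('n)) ^ r < a ^ c * 1"
        by (simp only: power_mult_distrib mult_ac)
      then have "(?s * a ^ J * 3 ^ CARD('n)) ^ r < 1"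
        using a_gt_1 by (simp only: mult_less_cancel_left_pos zero_less_power)
      then have "?s * a ^ J * 3 ^ CARD('n) < 1"
        using s a_gt_1 by (metis not_le one_le_power)
      then have "d * a ^ J < vol p" by (simp add: field_simps)
      then show ?thesis using a_gt_1 by (simp add: power_one_over field_simps)
    qed
    then have "emeasure lebesgue (stratum k p) < ennreal ((1 / a) ^ J * vol p)"
      using d by (simp add: ennreal_less_iff)
    then show ?thesis by (rule A1_cond_decay[OF u A sets_stratum sub, folded a])
  qed
  then show ?thesis unfolding decay_def J_def .
qed

definition stopping :: "(int \<times> 'n cube_index) set" where
  "stopping = {(k, p). p \<in> maximal_cubes f (ennreal (a powi k))}"

definition stopping_class :: "int \<Rightarrow> int \<Rightarrow> (int \<times> 'n cube_index) set" where
  "stopping_class l j = {(k, p). p \<in> maximal_cubes f (ennreal (a powi k)) \<and> v_level k l p \<and>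
     ennreal (2 powi j) * emeasure lebesgue (triple p) < mass u (triple p) \<and>
     mass u (triple p) \<le> ennreal (2 powi (j + 1)) * emeasure lebesgue (triple p)}"

definition fresh :: "int \<times> 'n cube_index \<Rightarrow> (real ^ 'n) set" where
  "fresh kp = dyadic (snd kp) - level_set f (ennreal (a powi (fst kp + 1)))"

lemma sets_fresh [measurable]: "fresh kp \<in> sets lebesgue"
  by (simp add: fresh_def)

lemma a_level: "ennreal (a powi (k + 1)) = 2 * 2 ^ CARD('n) * ennreal (a powi k)"
proof -
  have "ennreal a = 2 * 2 ^ CARD('n)"
    unfolding a by (simp add: ennreal_mult ennreal_power[symmetric])
  then show ?thesis unfolding a_powi_Suc using a_gt_1 by (simp add: ennreal_mult less_imp_le)
qed

lemma disjoint_fresh: "disjoint_family_on fresh stopping"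
  unfolding disjoint_family_on_def
proof (intro ballI impI)
  have *: "fresh (k, p) \<inter> fresh (k', p') = {}" if "p' \<in> maximal_cubes f (ennreal (a powi k'))" "k < k'" for k k' p p'
  proof -
    have "dyadic p' \<subseteq> level_set f (ennreal (a powi k'))" using that by (auto simp: level_set_def)
    also have "\<dots> \<subseteq> level_set f (ennreal (a powi (k + 1)))"
      using that a_gt_1 by (intro level_set_antimono fin ennreal_leI power_int_increasing) auto
    finally show ?thesis by (auto simp: fresh_def)
  qed
  fix s t assume st: "s \<in> stopping" "t \<in> stopping" "s \<noteq> t"
  obtain k p where s: "s = (k, p)" by (rule prod.exhaust)
  obtain k' p' where t: "t = (k', p')" by (rule prod.exhaust)
  have max: "p \<in> maximal_cubes f (ennreal (a powi k))" "p' \<in> maximal_cubes f (ennreal (a powi k'))"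
    using st by (simp_all add: s t stopping_def)
  consider "k < k'" | "k' < k" | "k = k'" by linarith
  then show "fresh s \<inter> fresh t = {}"
  proof cases
    case 1
    then show ?thesis using *[of p' k' k p] max s t by blast
  next
    case 2
    then show ?thesis using *[of p k k' p'] max s t by blast
  next
    case 3
    then have "p \<noteq> p'" using st s t by blast
    then have "dyadic p \<inter> dyadic p' = {}" using max maximal_cubes_disjoint 3 by blast
    then show ?thesis by (auto simp: fresh_def s t)
  qed
qed

text \<open>The fresh part is at least half of the cube, hence a fixed proportion of its triple.\<close>

lemma mass_triple_le_fresh:
  assumes "p \<in> maximal_cubes f (ennreal (a powi k))"
  shows "mass v (triple p) \<le> ennreal (K * (2 * 3 ^ CARD('n)) ^ r) * mass v (fresh (k, p))"
proof -
  let ?t = "3 ^ CARD('n) * vol p"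
  let ?E = "fresh (k, p)"
  have sub: "?E \<subseteq> triple p" using block_mono[of 0 1 p] by (auto simp: fresh_def)
  obtain e where e: "emeasure lebesgue ?E = ennreal e" "0 \<le> e"
    using emeasure_subset_triple_real[OF sub] by blast
  have "vol p \<le> 2 * e"
    using e assms fin by (intro level_set_complement_large[of f "ennreal (a powi k)"]) (auto simp: fresh_def a_level[symmetric])
  then have te: "?t \<le> 2 * 3 ^ CARD('n) * e" by simp
  let ?c = "ennreal (?t ^ r)"
  have c: "?c \<noteq> 0" "?c \<noteq> top" by auto
  have "?c * mass v (triple p) \<le> ennreal ((2 * 3 ^ CARD('n) * e) ^ r) * mass v (triple p)"
    using te by (intro mult_right_mono ennreal_leI power_mono) auto
  also have "\<dots> = ennreal ((2 * 3 ^ CARD('n)) ^ r) * (emeasure lebesgue ?E ^ r * mass v (triple p))"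
    using e by (simp add: power_mult_distrib ennreal_mult ennreal_power mult_ac)
  also have "\<dots> \<le> ennreal ((2 * 3 ^ CARD('n)) ^ r) * (ennreal K * emeasure lebesgue (triple p) ^ r * mass v ?E)"
    using sub by (intro mult_left_mono Ainf_condD(4)[OF v]) auto
  also have "\<dots> = ?c * (ennreal (K * (2 * 3 ^ CARD('n)) ^ r) * mass v ?E)"
  proof -
    have nn: "0 \<le> K" "0 \<le> ?t" "(0::real) \<le> (2 * 3 ^ CARD('n)) ^ r" using K by auto
    show ?thesis unfolding emeasure_triple ennreal_power[OF nn(2)] ennreal_mult[OF nn(1,3)]
      by (simp only: mult_ac)
  qed
  finally show ?thesis using ennreal_mult_le_mult_iff[OF c] by blast
qed

definition class_union :: "int \<Rightarrow> int \<Rightarrow> (real ^ 'n) set" where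
  "class_union l j = (\<Union>p\<in>snd ` stopping_class l j. dyadic p)"

lemma sets_class_union [measurable]: "class_union l j \<in> sets lebesgue"
  unfolding class_union_def by (intro sets.countable_UN'' countable_cube_index) auto

text \<open>Within a class, \<open>v\<close> and \<open>f\<close> have comparable averages: about \<open>a ^ (k + l)\<close> on the triple and about \<open>a ^ k\<close>
on the cube. The ratio does not depend on \<open>k\<close>, so the comparison passes to the union.\<close>

lemma class_mass_le:
  "mass v (class_union l j) \<le> ennreal (a powi (l + 1) * 3 ^ CARD('n)) * mass f (class_union l j)"
  unfolding class_union_def
proof (rule dyadic_union_mass_le)
  fix p assume "p \<in> snd ` stopping_class l j"
  then obtain k where kp: "(k, p) \<in> stopping_class l j" by force
  have "mass v (dyadic p) \<le> mass v (triple p)" using block_mono[of 0 1 p] by (intro mass_mono) auto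
  also have "\<dots> \<le> ennreal (a powi (k + l + 1)) * emeasure lebesgue (triple p)"
    using kp by (simp add: stopping_class_def v_level_def)
  also have "\<dots> = ennreal (a powi (l + 1) * 3 ^ CARD('n)) * (ennreal (a powi k) * ennreal (vol p))"
  proof -
    have "a powi (k + l + 1) = a powi (l + 1) * a powi k"
      using a_gt_1 by (simp add: power_int_add)
    then show ?thesis by (simp add: ennreal_mult less_imp_le mult_ac)
  qed
  also have "\<dots> \<le> ennreal (a powi (l + 1) * 3 ^ CARD('n)) * mass f (dyadic p)"
    using kp by (intro mult_left_mono less_imp_le maximal_cubes_average) (auto simp: stopping_class_def)
  finally show "mass v (dyadic p) \<le> ennreal (a powi (l + 1) * 3 ^ CARD('n)) * mass f (dyadic p)" .
qed

text \<open>The cubes of a class overlap for different \<open>k\<close>, and it has to be excluded that they pile up. Up to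
constants, each summand is \<open>2 ^ j * a ^ (- l)\<close> times the \<open>v\<close>-mass of the triple, and by \<open>A\<^sub>\<infinity>\<close> that is
the \<open>v\<close>-mass of the fresh part. The fresh parts are disjoint, so the sum is controlled by the
\<open>v\<close>-mass of the union, which is compared with the mass of \<open>f\<close>; the powers of \<open>a ^ l\<close> cancel.\<close>

lemma stopping_class_sum:
  "(\<integral>\<^sup>+kp. ennreal (a powi (fst kp)) * mass u (triple (snd kp)) \<partial>count_space (stopping_class l j))
   \<le> ennreal (2 * (K * (2 * 3 ^ CARD('n)) ^ r) * 3 ^ CARD('n) * a) * (ennreal (2 powi j) * mass f (class_union l j))"
proof -
  let ?I = "stopping_class l j"
  let ?K = "K * (2 * 3 ^ CARD('n)) ^ r"
  let ?c = "ennreal (2 powi (j + 1) * a powi (- l) * ?K)"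
  have I: "?I \<subseteq> stopping" by (auto simp: stopping_class_def stopping_def)
  have cI: "countable ?I" by (rule countableI_type)
  have nnK: "0 \<le> ?K" using K by simp
  have "(\<integral>\<^sup>+kp. ennreal (a powi (fst kp)) * mass u (triple (snd kp)) \<partial>count_space ?I)
     \<le> (\<integral>\<^sup>+kp. ?c * mass v (fresh kp) \<partial>count_space ?I)"
  proof (intro nn_integral_mono)
    fix kp assume "kp \<in> space (count_space ?I)"
    then obtain k p where kp: "kp = (k, p)" "(k, p) \<in> ?I" by (cases kp) auto
    then have vl: "v_level k l p" and mx: "p \<in> maximal_cubes f (ennreal (a powi k))"
      and ul: "mass u (triple p) \<le> ennreal (2 powi (j + 1)) * emeasure lebesgue (triple p)"
      by (auto simp: stopping_class_def)
    have "ennreal (a powi k) * mass u (triple p) \<le> ennreal (a powi k) * (ennreal (2 powi (j + 1)) * emeasure lebesgue (triple p))"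
      by (intro mult_left_mono ul) simp
    also have "\<dots> = ennreal (2 powi (j + 1) * a powi (- l)) * (ennreal (a powi (k + l)) * emeasure lebesgue (triple p))"
    proof -
      have "a powi k = a powi (- l) * a powi (k + l)"
        using a_gt_1 by (simp add: power_int_add[symmetric])
      then have "ennreal (a powi k) = ennreal (a powi (- l)) * ennreal (a powi (k + l))"
        by (simp add: ennreal_mult less_imp_le)
      moreover have "ennreal (2 powi (j + 1) * a powi (- l)) = ennreal (2 powi (j + 1)) * ennreal (a powi (- l))"
        by (intro ennreal_mult) (auto intro: less_imp_le)
      ultimately show ?thesis by (simp only: mult_ac)
    qed
    also have "\<dots> \<le> ennreal (2 powi (j + 1) * a powi (- l)) * mass v (triple p)"
      using vl by (intro mult_left_mono) (auto simp: v_level_def)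
    also have "\<dots> \<le> ennreal (2 powi (j + 1) * a powi (- l)) * (ennreal ?K * mass v (fresh (k, p)))"
      by (intro mult_left_mono mass_triple_le_fresh mx) simp
    also have "\<dots> = ?c * mass v (fresh (k, p))"
      using nnK by (subst (2) ennreal_mult) (auto simp: mult_ac intro: less_imp_le)
    finally show "ennreal (a powi (fst kp)) * mass u (triple (snd kp)) \<le> ?c * mass v (fresh kp)"
      by (simp add: kp)
  qed
  also have "\<dots> = ?c * (\<integral>\<^sup>+kp. mass v (fresh kp) \<partial>count_space ?I)" by (rule nn_integral_cmult) simp
  also have "(\<integral>\<^sup>+kp. mass v (fresh kp) \<partial>count_space ?I) = mass v (\<Union>kp\<in>?I. fresh kp)"
    by (intro emeasure_UN_countable[symmetric] cI disjoint_family_on_mono[OF I disjoint_fresh]) simp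
  also have "?c * \<dots> \<le> ?c * mass v (class_union l j)"
    by (intro mult_left_mono mass_mono) (auto simp: class_union_def fresh_def)
  also have "\<dots> \<le> ?c * (ennreal (a powi (l + 1) * 3 ^ CARD('n)) * mass f (class_union l j))"
    by (intro mult_left_mono class_mass_le) simp
  also have "\<dots> = ennreal (2 * ?K * 3 ^ CARD('n) * a) * (ennreal (2 powi j) * mass f (class_union l j))"
  proof -
    have "(2 powi (j + 1) * a powi (- l) * ?K) * (a powi (l + 1) * 3 ^ CARD('n)) = (2 * ?K * 3 ^ CARD('n) * a) * 2 powi j"
      using a_gt_1 by (simp add: power_int_add power_int_minus)
    then have "?c * ennreal (a powi (l + 1) * 3 ^ CARD('n)) = ennreal (2 * ?K * 3 ^ CARD('n) * a) * ennreal (2 powi j)"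
      using nnK a_gt_1 by (simp only: ennreal_mult[symmetric] zero_le_power_int zero_le_power zero_le_numeral mult_nonneg_nonneg less_imp_le a_powi_pos)
    then show ?thesis by (simp only: mult.assoc[symmetric])
  qed
  finally show ?thesis .
qed

text \<open>Almost every point of a cube of the class \<open>(l, j)\<close> has \<open>2 ^ j < A * u x\<close> by the \<open>A\<^sub>1\<close> condition, so the sum over
\<open>j\<close> is geometric and bounded by twice that value.\<close>

lemma class_level_sum:
  "(\<integral>\<^sup>+j. ennreal (2 powi j) * mass f (class_union l j) \<partial>count_space UNIV)
     \<le> ennreal (2 * A) * mass (\<lambda>x. f x * u x) UNIV"
proof -
  have "(\<integral>\<^sup>+j. ennreal (2 powi j) * mass f (class_union l j) \<partial>count_space UNIV)
     = (\<integral>\<^sup>+j. \<integral>\<^sup>+x. ennreal (2 powi j) * (f x * indicator (class_union l j) x) \<partial>lebesgue \<partial>count_space UNIV)"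
    by (simp add: nn_integral_cmult emeasure_density)
  also have "\<dots> = (\<integral>\<^sup>+x. \<integral>\<^sup>+j. ennreal (2 powi j) * (f x * indicator (class_union l j) x) \<partial>count_space UNIV \<partial>lebesgue)"
    by (intro nn_integral_count_space_nn_integral[symmetric]) auto
  also have "\<dots> \<le> (\<integral>\<^sup>+x. ennreal (2 * A) * (f x * u x) \<partial>lebesgue)"
  proof (rule nn_integral_mono_AE)
    have "AE x in lebesgue. \<forall>p. x \<in> triple p \<longrightarrow> mass u (triple p) \<le> ennreal A * emeasure lebesgue (triple p) * u x"
      using A1_condD(4)[OF u, of 1] by (subst AE_all_countable) blast
    then show "AE x in lebesgue. (\<integral>\<^sup>+j. ennreal (2 powi j) * (f x * indicator (class_union l j) x) \<partial>count_space UNIV) \<le> ennreal (2 * A) * (f x * u x)"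
    proof eventually_elim
      case (elim x)
      let ?y = "ennreal A * u x"
      have below: "ennreal (2 powi j) < ?y" if "x \<in> class_union l j" for j
      proof -
        obtain k p where kp: "(k, p) \<in> stopping_class l j" "x \<in> dyadic p"
          using \<open>x \<in> class_union l j\<close> by (force simp: class_union_def)
        have "x \<in> triple p" using kp(2) block_mono[of 0 1 p] by auto
        have "ennreal (2 powi j) * ennreal (3 ^ CARD('n) * vol p) < mass u (triple p)"
          using kp(1) by (simp add: stopping_class_def)
        also have "\<dots> \<le> ?y * ennreal (3 ^ CARD('n) * vol p)"
        proof -
          have "mass u (triple p) \<le> ennreal A * emeasure lebesgue (triple p) * u x"
            using elim \<open>x \<in> triple p\<close> by blast
          then show ?thesis by (simp only: emeasure_triple mult_ac)
        qed
        finally show ?thesis by (meson mult_right_mono not_le zero_le)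
      qed
      have "(\<integral>\<^sup>+j. ennreal (2 powi j) * (f x * indicator (class_union l j) x) \<partial>count_space UNIV)
         \<le> (\<integral>\<^sup>+j. f x * (ennreal (2 powi j) * indicator {j. ennreal (2 powi j) < ?y} j) \<partial>count_space UNIV)"
        using below by (intro nn_integral_mono) (auto simp: mult_ac split: split_indicator)
      also have "\<dots> = f x * (\<integral>\<^sup>+j. ennreal (2 powi j) * indicator {j. ennreal (2 powi j) < ?y} j \<partial>count_space UNIV)"
        by (rule nn_integral_cmult) simp
      also have "\<dots> \<le> f x * (2 * ?y)"
        by (intro mult_left_mono nn_integral_powers_below) simp
      also have "\<dots> = ennreal (2 * A) * (f x * u x)"
        using A by (simp add: ennreal_mult mult_ac)
      finally show ?case .
    qed
  qed
  also have "\<dots> = ennreal (2 * A) * mass (\<lambda>x. f x * u x) UNIV"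
    by (simp add: nn_integral_cmult emeasure_density)
  finally show ?thesis .
qed

text \<open>If \<open>a ^ k < v x \<le> a ^ (k + 1)\<close> and \<open>v x < dmax f x\<close>, then \<open>x\<close> lies in the triple of a maximal cube at
height \<open>a ^ k\<close>.\<close>

lemma superlevel_mass_le_stopping_sum:
  "mass (\<lambda>x. u x * v x) {x. v x < dmax f x}
    \<le> (\<integral>\<^sup>+kp. ennreal (a powi (fst kp + 1)) * mass u (stratum (fst kp) (snd kp)) \<partial>count_space stopping)"
proof -
  let ?uv = "\<lambda>x. u x * v x"
  have cS: "countable stopping" by (rule countableI_type)
  let ?U = "\<Union>kp\<in>stopping. stratum (fst kp) (snd kp)"
  have Us [measurable]: "?U \<in> sets lebesgue" using cS by (intro sets.countable_UN'') auto
  have "{x \<in> space lebesgue. v x < dmax f x} \<in> sets lebesgue" by measurable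
  then have Ls [measurable]: "{x. v x < dmax f x} \<in> sets lebesgue" by simp
  have in_U: "x \<in> ?U" if x: "v x < dmax f x" "v x \<noteq> 0" for x
  proof -
    have "v x < \<infinity>" using x(1) by (auto simp: less_top intro: less_le_trans)
    then obtain k where k: "ennreal (a powi k) < v x" "v x \<le> ennreal (a powi (k + 1))"
      using ennreal_powi_bracket[OF a_gt_1, of "v x"] x(2) by (auto simp: zero_less_iff_neq_zero)
    have "ennreal (a powi k) < dmax f x" using k(1) x(1) by (rule less_trans)
    then obtain p where p: "p \<in> maximal_cubes f (ennreal (a powi k))" "x \<in> triple p"
      using dmax_subset_triples[OF fin, of "ennreal (a powi k)"] by auto
    have "(k, p) \<in> stopping" using p by (simp add: stopping_def)
    moreover have "x \<in> stratum k p" using p k by (simp add: stratum_def)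
    ultimately show ?thesis by force
  qed
  have "mass ?uv {x. v x < dmax f x} \<le> mass ?uv ?U"
  proof -
    have "mass ?uv {x. v x < dmax f x} = (\<integral>\<^sup>+x. ?uv x * indicator {x. v x < dmax f x} x \<partial>lebesgue)"
      by (intro emeasure_density) auto
    also have "\<dots> \<le> (\<integral>\<^sup>+x. ?uv x * indicator ?U x \<partial>lebesgue)"
    proof (rule nn_integral_mono)
      fix x show "?uv x * indicator {x. v x < dmax f x} x \<le> ?uv x * indicator ?U x"
        using in_U[of x] by (cases "v x = 0") (auto split: split_indicator)
    qed
    also have "\<dots> = mass ?uv ?U" by (intro emeasure_density[symmetric]) auto
    finally show ?thesis .
  qed
  also have "\<dots> \<le> (\<integral>\<^sup>+kp. mass ?uv (stratum (fst kp) (snd kp)) \<partial>count_space stopping)"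
    by (intro emeasure_UN_le_nn_integral cS) simp
  also have "\<dots> \<le> (\<integral>\<^sup>+kp. ennreal (a powi (fst kp + 1)) * mass u (stratum (fst kp) (snd kp)) \<partial>count_space stopping)"
  proof (intro nn_integral_mono mass_le_mult)
    fix kp :: "int \<times> 'n cube_index"
    have "?uv x \<le> ennreal (a powi (fst kp + 1)) * u x" if "x \<in> stratum (fst kp) (snd kp)" for x
      using that by (subst mult.commute) (auto simp: stratum_def intro: mult_right_mono)
    then show "AE x in lebesgue. x \<in> stratum (fst kp) (snd kp) \<longrightarrow> ?uv x \<le> ennreal (a powi (fst kp + 1)) * u x"
      by blast
  qed auto
  finally show ?thesis .
qed

lemma stopping_in_class:
  assumes "kp \<in> stopping"
  obtains l j where "kp \<in> stopping_class l j"
proof -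
  obtain k p where kp: "kp = (k, p)" "p \<in> maximal_cubes f (ennreal (a powi k))"
    using assms by (auto simp: stopping_def)
  let ?t = "3 ^ CARD('n) * vol p"
  have t: "0 < ?t" by simp
  obtain V where V: "mass v (triple p) = ennreal V" "0 < V"
    using Ainf_condD(2,3)[OF v, of p] by (cases "mass v (triple p)") auto
  obtain U where U: "mass u (triple p) = ennreal U" "0 < U"
    using A1_condD(2,3)[OF u, of 1 p] by (cases "mass u (triple p)") auto
  obtain i where i: "a powi i < V / ?t" "V / ?t \<le> a powi (i + 1)"
    using powi_bracket[OF a_gt_1, of "V / ?t"] V t by auto
  obtain j where j: "2 powi j < U / ?t" "U / ?t \<le> 2 powi (j + 1)"
    using powi_bracket[of 2 "U / ?t"] U t by auto
  have *: "ennreal x * ennreal ?t < ennreal y \<and> ennreal y \<le> ennreal z * ennreal ?t"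
    if "0 < x" "x < y / ?t" "y / ?t \<le> z" "0 < y" for x y z
  proof -
    have "x * ?t < y" "y \<le> z * ?t" using that t by (simp_all only: pos_less_divide_eq pos_divide_le_eq)
    moreover have "0 < z" using that t by (meson less_le_trans less_trans)
    ultimately show ?thesis using that t
      by (simp only: ennreal_mult[symmetric] less_imp_le ennreal_less_iff ennreal_leI mult_nonneg_nonneg simp_thms)
  qed
  have "kp \<in> stopping_class (i - k) j"
    unfolding kp(1) using kp(2) *[OF _ i V(2)] *[OF _ j U(2)] V(1) U(1)
    by (simp only: stopping_class_def v_level_def emeasure_triple) simp
  then show thesis by (rule that)
qed

lemma mixed_weak_type_unit:
  assumes c: "(K + 1) * a ^ r * (3 ^ CARD('n)) ^ r < a ^ c"
  shows "mass (\<lambda>x. u x * v x) {x. v x < dmax f x}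
    \<le> (ennreal a * ennreal (2 * (K * (2 * 3 ^ CARD('n)) ^ r) * 3 ^ CARD('n) * a) * ennreal (2 * A)
        * (\<integral>\<^sup>+l. ennreal (decay (1 - 1 / (2 * A)) c r (nat \<bar>l\<bar>)) \<partial>count_space (UNIV :: int set)))
      * mass (\<lambda>x. f x * u x) UNIV"
proof -
  let ?\<phi> = "\<lambda>l. ennreal (decay (1 - 1 / (2 * A)) c r (nat \<bar>l\<bar>))"
  let ?g = "\<lambda>kp. ennreal (a powi (fst kp)) * mass u (triple (snd kp))"
  let ?h = "\<lambda>kp. ennreal (a powi (fst kp + 1)) * mass u (stratum (fst kp) (snd kp))"
  let ?C = "ennreal (2 * (K * (2 * 3 ^ CARD('n)) ^ r) * 3 ^ CARD('n) * a)"
  let ?N = "mass (\<lambda>x. f x * u x) UNIV"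
  have in_class: "?h kp \<le> ennreal a * ?\<phi> l * ?g kp" if "kp \<in> stopping_class l j" for kp l j
  proof -
    obtain k p where kp: "kp = (k, p)" by (rule prod.exhaust)
    have "mass u (stratum k p) \<le> ?\<phi> l * mass u (triple p)"
      using that by (intro mass_stratum_le c) (auto simp: kp stopping_class_def)
    then have "?h kp \<le> ennreal (a powi (k + 1)) * (?\<phi> l * mass u (triple p))"
      unfolding kp by (simp add: mult_left_mono)
    also have "ennreal (a powi (k + 1)) = ennreal a * ennreal (a powi k)"
      unfolding a_powi_Suc using a_gt_1 by (intro ennreal_mult) (auto intro: less_imp_le)
    finally show ?thesis by (simp add: kp mult_ac)
  qed
  have "mass (\<lambda>x. u x * v x) {x. v x < dmax f x} \<le> (\<integral>\<^sup>+kp. ?h kp \<partial>count_space stopping)"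
    by (rule superlevel_mass_le_stopping_sum)
  also have "\<dots> \<le> (\<integral>\<^sup>+kp. \<integral>\<^sup>+l. \<integral>\<^sup>+j. ennreal a * ?\<phi> l * ?g kp * indicator (stopping_class l j) kp
      \<partial>count_space UNIV \<partial>count_space UNIV \<partial>count_space stopping)"
  proof (intro nn_integral_mono)
    fix kp assume "kp \<in> space (count_space stopping)"
    then have "kp \<in> stopping" by simp
    then obtain l j where lj: "kp \<in> stopping_class l j" by (rule stopping_in_class)
    have "?h kp \<le> ennreal a * ?\<phi> l * ?g kp * indicator (stopping_class l j) kp"
      using in_class[OF lj] lj by simp
    also have "\<dots> \<le> (\<integral>\<^sup>+j. ennreal a * ?\<phi> l * ?g kp * indicator (stopping_class l j) kp \<partial>count_space UNIV)"
      by (rule nn_integral_ge_point) simp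
    also have "\<dots> \<le> (\<integral>\<^sup>+l. \<integral>\<^sup>+j. ennreal a * ?\<phi> l * ?g kp * indicator (stopping_class l j) kp \<partial>count_space UNIV \<partial>count_space UNIV)"
      by (rule nn_integral_ge_point) simp
    finally show "?h kp \<le> \<dots>" .
  qed
  also have "\<dots> = (\<integral>\<^sup>+l. \<integral>\<^sup>+j. \<integral>\<^sup>+kp. ennreal a * ?\<phi> l * ?g kp * indicator (stopping_class l j) kp
      \<partial>count_space stopping \<partial>count_space UNIV \<partial>count_space UNIV)"
    by (subst nn_integral_count_space_nn_integral, simp_all)
       (subst nn_integral_count_space_nn_integral, simp_all)
  also have "\<dots> \<le> (\<integral>\<^sup>+l. \<integral>\<^sup>+j. ennreal a * ?\<phi> l * (?C * (ennreal (2 powi j) * mass f (class_union l j))) \<partial>count_space UNIV \<partial>count_space UNIV)"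
  proof (intro nn_integral_mono)
    fix l j :: int
    have sub: "stopping_class l j \<subseteq> stopping" by (auto simp: stopping_class_def stopping_def)
    have "(\<integral>\<^sup>+kp. ennreal a * ?\<phi> l * ?g kp * indicator (stopping_class l j) kp \<partial>count_space stopping)
       = ennreal a * ?\<phi> l * (\<integral>\<^sup>+kp. ?g kp * indicator (stopping_class l j) kp \<partial>count_space stopping)"
      by (subst nn_integral_cmult[symmetric]) (auto simp: mult_ac)
    also have "(\<integral>\<^sup>+kp. ?g kp * indicator (stopping_class l j) kp \<partial>count_space stopping) = (\<integral>\<^sup>+kp. ?g kp \<partial>count_space (stopping_class l j))"
    proof -
      have "(\<integral>\<^sup>+kp. ?g kp * indicator (stopping_class l j) kp \<partial>count_space stopping)
        = (\<integral>\<^sup>+kp. ?g kp * indicator (stopping_class l j) kp \<partial>count_space (stopping_class l j))"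
        using sub by (intro nn_integral_count_space_eq) (simp, use sub in blast)
      also have "\<dots> = (\<integral>\<^sup>+kp. ?g kp \<partial>count_space (stopping_class l j))"
        by (intro nn_integral_cong) simp
      finally show ?thesis .
    qed
    also have "ennreal a * ?\<phi> l * \<dots> \<le> ennreal a * ?\<phi> l * (?C * (ennreal (2 powi j) * mass f (class_union l j)))"
      by (intro mult_left_mono stopping_class_sum) simp
    finally show "(\<integral>\<^sup>+kp. ennreal a * ?\<phi> l * ?g kp * indicator (stopping_class l j) kp \<partial>count_space stopping) \<le> \<dots>" .
  qed
  also have "\<dots> = (\<integral>\<^sup>+l. ennreal a * ?\<phi> l * (?C * (\<integral>\<^sup>+j. ennreal (2 powi j) * mass f (class_union l j) \<partial>count_space UNIV)) \<partial>count_space UNIV)"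
    by (simp add: nn_integral_cmult)
  also have "\<dots> \<le> (\<integral>\<^sup>+l. ennreal a * ?\<phi> l * (?C * (ennreal (2 * A) * ?N)) \<partial>count_space UNIV)"
    by (intro nn_integral_mono mult_left_mono class_level_sum) simp_all
  also have "\<dots> = (\<integral>\<^sup>+l. (ennreal a * ?C * ennreal (2 * A) * ?N) * ?\<phi> l \<partial>count_space UNIV)"
    by (simp only: mult_ac)
  also have "\<dots> = (ennreal a * ?C * ennreal (2 * A) * ?N) * (\<integral>\<^sup>+l. ?\<phi> l \<partial>count_space UNIV)"
    by (rule nn_integral_cmult) simp
  finally show ?thesis by (simp only: mult_ac)
qed

end

text \<open>The mixed weak type inequality for one function. That the constant depends on \<open>A\<close>, \<open>K\<close>, \<open>r\<close> and the
dimension only is what makes the multilinear case accessible.\<close>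

theorem mixed_weak_type_dmax:
  fixes A K :: real and r :: nat
  assumes "1 \<le> A" "0 < K" "0 < r"
  obtains C where "C < \<infinity>"
    "\<And>u v f :: real ^ 'n::finite \<Rightarrow> ennreal. \<lbrakk>A1_cond A u; Ainf_cond K r v; f \<in> borel_measurable lebesgue; mass f UNIV < \<infinity>\<rbrakk>
      \<Longrightarrow> mass (\<lambda>x. u x * v x) {x. v x < dmax f x} \<le> C * mass (\<lambda>x. f x * u x) UNIV"
proof -
  define a :: real where "a = 2 * 2 ^ CARD('n)"
  have "(1::real) \<le> 2 ^ CARD('n)" by (rule one_le_power) simp
  then have "1 < a" unfolding a_def by linarith
  then obtain c where c: "(K + 1) * a ^ r * (3 ^ CARD('n)) ^ r < a ^ c"
    using real_arch_pow by blast
  have "1 - 1 / (2 * A) < 1" "0 < 1 - 1 / (2 * A)" using assms by (auto simp: field_simps)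
  then have "(\<integral>\<^sup>+l. ennreal (decay (1 - 1 / (2 * A)) c r (nat \<bar>l\<bar>)) \<partial>count_space (UNIV :: int set)) < \<infinity>"
    using assms by (intro decay_summable)
  then show thesis
    using assms by (intro that[OF _ weighted_stopping.mixed_weak_type_unit[OF weighted_stopping.intro[OF _ _ _ _ _ _ _ a_def] c]]) (auto simp: ennreal_mult_less_top)
qed

section \<open>Products of maximal functions\<close>

lemma Ainf_cond_scale:
  assumes v: "Ainf_cond K r v" and t: "0 < t"
  shows "Ainf_cond K r (\<lambda>x. ennreal t * v x)"
proof -
  note [measurable] = Ainf_condD(1)[OF v]
  have m: "mass (\<lambda>x. ennreal t * v x) F = ennreal t * mass v F" if [measurable]: "F \<in> sets lebesgue" for F
    by (simp add: emeasure_density nn_integral_cmult mult.assoc)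
  show ?thesis
    unfolding Ainf_cond_def
  proof (intro conjI allI ballI impI)
    fix p
    show "0 < mass (\<lambda>x. ennreal t * v x) (triple p)" "mass (\<lambda>x. ennreal t * v x) (triple p) < \<infinity>"
      using Ainf_condD(2,3)[OF v, of p] t by (simp_all add: m ennreal_zero_less_mult_iff ennreal_mult_less_top)
    fix F assume F: "F \<in> sets lebesgue" "F \<subseteq> triple p"
    have "ennreal t * (emeasure lebesgue F ^ r * mass v (triple p)) \<le> ennreal t * (ennreal K * emeasure lebesgue (triple p) ^ r * mass v F)"
      by (intro mult_left_mono Ainf_condD(4)[OF v] F) simp
    then show "emeasure lebesgue F ^ r * mass (\<lambda>x. ennreal t * v x) (triple p)
          \<le> ennreal K * emeasure lebesgue (triple p) ^ r * mass (\<lambda>x. ennreal t * v x) F"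
      using F(1) by (simp only: m sets_block mult_ac)
  qed measurable
qed

text \<open>For these functions \<open>dmax f\<close> is positive and finite everywhere, so that weights can be divided by it.\<close>

definition admissible :: "(real ^ 'n::finite \<Rightarrow> ennreal) \<Rightarrow> bool" where
  "admissible f \<longleftrightarrow> f \<in> borel_measurable lebesgue \<and> mass f UNIV < \<infinity> \<and> mass f UNIV \<noteq> 0 \<and> (\<forall>x. dmax f x < \<infinity>)"

lemma admissible_dmax_pos:
  assumes "admissible f"
  shows "0 < dmax f x"
proof -
  have "mass f UNIV \<noteq> 0" using assms by (simp add: admissible_def)
  moreover have "x \<in> triple (cell 0 x)" using mem_dyadic_cell[of x 0] block_mono[of 0 1 "cell 0 x"] by auto
  ultimately obtain c where "0 < c" "c \<le> dmax f x" using dmax_bounded_below by metis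
  then show ?thesis by (rule less_le_trans)
qed

lemma Ainf_cond_divide_dmax_prod:
  assumes "finite S" "0 < K" "0 < r"
  shows "\<exists>K' r'. 0 < K' \<and> 0 < r' \<and> (\<forall>v (f :: 'i \<Rightarrow> real ^ 'n::finite \<Rightarrow> ennreal).
      Ainf_cond K r v \<longrightarrow> (\<forall>j\<in>S. admissible (f j)) \<longrightarrow>
      Ainf_cond K' r' (\<lambda>x. v x / (\<Prod>j\<in>S. dmax (f j) x)))"
  using assms(1)
proof (induction S)
  case empty
  have "v x / 1 = v x" for v :: "real ^ 'n::finite \<Rightarrow> ennreal" and x
    by (simp add: divide_ennreal_def)
  then show ?case using assms by (intro exI[of _ K] exI[of _ r]) simp
next
  case (insert i S)
  then obtain K' r' where IH: "0 < K'" "0 < r'"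
    "\<And>v (f :: 'i \<Rightarrow> real ^ 'n::finite \<Rightarrow> ennreal). Ainf_cond K r v \<Longrightarrow> (\<forall>j\<in>S. admissible (f j)) \<Longrightarrow>
      Ainf_cond K' r' (\<lambda>x. v x / (\<Prod>j\<in>S. dmax (f j) x))"
    by blast
  have "Ainf_cond (K' * 2 ^ Suc r' * 60 ^ CARD('n)) (Suc r') (\<lambda>x. v x / (\<Prod>j\<in>insert i S. dmax (f j) x))"
    if v: "Ainf_cond K r v" and f: "\<forall>j\<in>insert i S. admissible (f j)"
    for v and f :: "'i \<Rightarrow> real ^ 'n::finite \<Rightarrow> ennreal"
  proof -
    have "v x / (\<Prod>j\<in>insert i S. dmax (f j) x) = v x / (\<Prod>j\<in>S. dmax (f j) x) / dmax (f i) x" for x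
    proof -
      have "dmax (f i) x < top" using f by (auto simp: admissible_def)
      moreover have "(\<Prod>j\<in>S. dmax (f j) x) < top"
        using f by (auto simp: admissible_def less_top[symmetric] ennreal_prod_eq_top)
      ultimately show ?thesis
        using insert.hyps by (simp add: divide_ennreal_def ennreal_inverse_mult mult_ac)
    qed
    moreover have "Ainf_cond (K' * 2 ^ Suc r' * 60 ^ CARD('n)) (Suc r') (\<lambda>x. v x / (\<Prod>j\<in>S. dmax (f j) x) / dmax (f i) x)"
      using f by (intro Ainf_cond_divide_dmax IH v) (auto simp: admissible_def)
    ultimately show ?thesis by simp
  qed
  then show ?case using IH(1) by (intro exI[of _ "K' * 2 ^ Suc r' * 60 ^ CARD('n)"] exI[of _ "Suc r'"]) auto
qed

text \<open>In the application \<open>d i\<close> is the value of \<open>dmax (f i)\<close> and \<open>V\<close> that of \<open>v\<close>. The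
divided weights \<open>\<tau> * V / (\<Prod>j\<in>I - {i}. d j)\<close> multiply up to \<open>(\<tau> * V) ^ m / (\<Prod>i\<in>I. d i) ^ (m - 1)\<close>, which on
the layer is at least a multiple of \<open>\<tau> * V\<close>. The rest is the inequality of arithmetic and geometric
means for the terms normalised by \<open>B i\<close>.\<close>

lemma layer_pointwise:
  fixes w d B :: "'i \<Rightarrow> real"
  assumes I: "finite I" "I \<noteq> {}" and d: "\<And>i. i \<in> I \<Longrightarrow> 0 < d i" and B: "\<And>i. i \<in> I \<Longrightarrow> 0 < B i"
    and w: "\<And>i. i \<in> I \<Longrightarrow> 0 \<le> w i" and V: "0 < V" and \<tau>: "0 < \<tau>" and le: "(\<Prod>i\<in>I. d i) \<le> 2 * \<tau> * V"
  defines "m \<equiv> card I"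
  shows "(\<Prod>i\<in>I. w i powr (1 / m)) * V powr (1 / m)
     \<le> 2 * \<tau> powr (- 1 / m) * (\<Prod>i\<in>I. B i) powr (1 / m) * (\<Sum>i\<in>I. w i * (\<tau> * (V / (\<Prod>j\<in>I - {i}. d j))) / B i)"
proof -
  have m: "0 < m" using I by (simp add: m_def card_gt_0_iff)
  let ?y = "\<lambda>i. w i * (\<tau> * (V / (\<Prod>j\<in>I - {i}. d j)))"
  define P where "P = (\<Prod>i\<in>I. d i)"
  have P: "0 < P" unfolding P_def by (intro prod_pos d)
  have y: "?y i = w i * (\<tau> * V * d i / P)" if "i \<in> I" for i
    using that d[OF that] I by (simp add: P_def prod.remove[of I i])
  have y0: "0 \<le> ?y i" if "i \<in> I" for i
    using y[OF that] w[OF that] d[OF that] V \<tau> P by simp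
  have "(\<Prod>i\<in>I. ?y i) = (\<Prod>i\<in>I. w i * (\<tau> * V / P * d i))"
  proof (intro prod.cong refl)
    fix i assume "i \<in> I"
    show "?y i = w i * (\<tau> * V / P * d i)" unfolding y[OF \<open>i \<in> I\<close>] by simp
  qed
  also have "\<dots> = (\<Prod>i\<in>I. w i) * ((\<tau> * V / P) ^ m * P)"
    by (simp only: prod.distrib prod_constant m_def P_def[symmetric])
  finally have prod_y: "(\<Prod>i\<in>I. ?y i) = (\<Prod>i\<in>I. w i) * ((\<tau> * V / P) ^ m * P)" .
  have "V \<le> 2 ^ m / \<tau> * ((\<tau> * V / P) ^ m * P)"
  proof -
    have "1 \<le> 2 * (\<tau> * V / P)" using le P by (simp add: P_def field_simps)
    then have "1 \<le> (2 * (\<tau> * V / P)) ^ (m - 1)" by (rule one_le_power)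
    then have "1 * (2 * V) \<le> (2 * (\<tau> * V / P)) ^ (m - 1) * (2 * V)" using V by (intro mult_right_mono) auto
    also have "\<dots> = (2 * (\<tau> * V / P)) ^ (m - 1) * (2 * (\<tau> * V / P)) * P / \<tau>"
      using P \<tau> by simp
    also have "\<dots> = (2 * (\<tau> * V / P)) ^ m * P / \<tau>"
      using m by (metis One_nat_def Suc_pred power_Suc2)
    also have "\<dots> = 2 ^ m / \<tau> * ((\<tau> * V / P) ^ m * P)"
      by (simp only: power_mult_distrib) simp
    finally show ?thesis using V by linarith
  qed
  then have "(\<Prod>i\<in>I. w i) * V \<le> (\<Prod>i\<in>I. w i) * (2 ^ m / \<tau> * ((\<tau> * V / P) ^ m * P))"
    using w by (intro mult_left_mono prod_nonneg) auto
  also have "\<dots> = 2 ^ m / \<tau> * (\<Prod>i\<in>I. ?y i)" unfolding prod_y by (simp only: mult_ac)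
  finally have 1: "(\<Prod>i\<in>I. w i) * V \<le> 2 ^ m / \<tau> * (\<Prod>i\<in>I. ?y i)" .
  have "(\<Prod>i\<in>I. w i powr (1 / m)) * V powr (1 / m) = ((\<Prod>i\<in>I. w i) * V) powr (1 / m)"
    by (simp add: powr_mult prod_powr_distrib)
  also have "\<dots> \<le> (2 ^ m / \<tau> * (\<Prod>i\<in>I. ?y i)) powr (1 / m)"
    using 1 w V by (intro powr_mono2) (auto intro!: mult_nonneg_nonneg prod_nonneg)
  also have "\<dots> = (2 ^ m) powr (1 / m) * \<tau> powr (- 1 / m) * (\<Prod>i\<in>I. ?y i) powr (1 / m)"
  proof -
    have "0 \<le> (\<Prod>i\<in>I. ?y i)" by (intro prod_nonneg ballI y0)
    then show ?thesis using \<tau> by (simp only: powr_mult powr_divide zero_le_power zero_le_numeral less_imp_le divide_nonneg_nonneg)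
       (simp add: powr_minus_divide)
  qed
  also have "(2 ^ m :: real) powr (1 / m) = 2"
    using m by (simp add: powr_realpow[symmetric] powr_powr)
  also have "(\<Prod>i\<in>I. ?y i) powr (1 / m) = (\<Prod>i\<in>I. B i) powr (1 / m) * (\<Prod>i\<in>I. ?y i / B i) powr (1 / m)"
  proof -
    have "(\<Prod>i\<in>I. ?y i) = (\<Prod>i\<in>I. B i) * (\<Prod>i\<in>I. ?y i / B i)"
      unfolding prod.distrib[symmetric] by (intro prod.cong) (auto dest: B)
    then show ?thesis
      using B y0 by (simp add: powr_mult prod_nonneg less_imp_le)
  qed
  also have "(\<Prod>i\<in>I. ?y i / B i) powr (1 / m) \<le> (\<Sum>i\<in>I. ?y i / B i)"
  proof -
    have "(\<Prod>i\<in>I. ?y i / B i) powr (1 / m) \<le> (\<Sum>i\<in>I. ?y i / B i / m)"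
      unfolding m_def using I by (intro arith_geom_mean divide_nonneg_pos y0 B)
    also have "\<dots> \<le> (\<Sum>i\<in>I. ?y i / B i)"
    proof (intro sum_mono)
      fix i assume "i \<in> I"
      then have "0 \<le> ?y i / B i" using B y0 by (intro divide_nonneg_pos)
      then show "?y i / B i / m \<le> ?y i / B i"
        using divide_left_mono[of 1 "real m" "?y i / B i"] m by simp
    qed
    finally show ?thesis .
  qed
  finally show ?thesis using \<tau> by (simp add: mult_left_mono mult.assoc)
qed

section \<open>Truncation and monotone limits\<close>

definition truncate_fun :: "nat \<Rightarrow> (real ^ 'n \<Rightarrow> ennreal) \<Rightarrow> real ^ 'n \<Rightarrow> ennreal" where
  "truncate_fun N g x = min (g x) (of_nat N) * indicator (cball 0 (real N)) x"

lemma truncate_fun_measurable [measurable]: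
  assumes [measurable]: "g \<in> borel_measurable lebesgue"
  shows "truncate_fun N g \<in> borel_measurable lebesgue"
proof -
  have [measurable]: "cball 0 (real N) \<in> sets lebesgue" by auto
  show ?thesis unfolding truncate_fun_def[abs_def] by measurable
qed

lemma truncate_fun_le: "truncate_fun N g x \<le> g x"
  by (auto simp: truncate_fun_def split: split_indicator)

lemma truncate_fun_le_const: "truncate_fun N g x \<le> of_nat N"
  by (auto simp: truncate_fun_def split: split_indicator)

lemma incseq_truncate_fun: "incseq (\<lambda>N. truncate_fun N g)"
proof (intro incseq_SucI le_funI)
  fix N x
  have "min (g x) (of_nat N) \<le> min (g x) (of_nat (Suc N))"
    by (intro min.mono order_refl of_nat_mono) simp
  then show "truncate_fun N g x \<le> truncate_fun (Suc N) g x"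
    by (auto simp: truncate_fun_def split: split_indicator)
qed

lemma SUP_truncate_fun:
  assumes "g x < \<infinity>"
  shows "(SUP N. truncate_fun N g x) = g x"
proof (rule antisym)
  show "(SUP N. truncate_fun N g x) \<le> g x" by (intro SUP_least truncate_fun_le)
  obtain z where z: "g x = ennreal z" "0 \<le> z" using assms by (cases "g x") auto
  obtain N where N: "max z (norm x) \<le> real N" using real_arch_simple by blast
  have "g x \<le> of_nat N" using N z by (simp add: ennreal_of_nat_eq_real_of_nat ennreal_leI)
  then have "g x \<le> truncate_fun N g x" using N by (simp add: truncate_fun_def min_absorb1)
  also have "\<dots> \<le> (SUP N. truncate_fun N g x)" by (rule SUP_upper) simp
  finally show "g x \<le> (SUP N. truncate_fun N g x)" .
qed

lemma mass_truncate_fun_finite: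
  fixes g :: "real ^ 'n \<Rightarrow> ennreal"
  assumes [measurable]: "g \<in> borel_measurable lebesgue"
  shows "mass (truncate_fun N g) UNIV < \<infinity>"
proof -
  have "mass (truncate_fun N g) UNIV = (\<integral>\<^sup>+x. truncate_fun N g x \<partial>lebesgue)"
    by (simp add: emeasure_density)
  also have "\<dots> \<le> (\<integral>\<^sup>+x. of_nat N * indicator (cball (0 :: real ^ 'n) (real N)) x \<partial>lebesgue)"
    by (intro nn_integral_mono) (auto simp: truncate_fun_def split: split_indicator)
  also have "\<dots> = of_nat N * emeasure lebesgue (cball 0 (real N) :: (real ^ 'n) set)"
    by (intro nn_integral_cmult_indicator) auto
  also have "\<dots> < \<infinity>"
    using emeasure_bounded_finite[of "cball 0 (real N) :: (real ^ 'n) set"]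
    by (simp add: ennreal_mult_less_top of_nat_less_top)
  finally show ?thesis .
qed

lemma dmax_truncate_fun_finite:
  assumes [measurable]: "g \<in> borel_measurable lebesgue"
  shows "dmax (truncate_fun N g) x < \<infinity>"
proof -
  have "dmax (truncate_fun N g) x \<le> of_nat N"
  proof (rule ccontr)
    assume "\<not> dmax (truncate_fun N g) x \<le> of_nat N"
    then obtain p where p: "of_nat N * ennreal (vol p) < mass (truncate_fun N g) (dyadic p)"
      by (auto simp: not_le less_dmax_iff)
    have "mass (truncate_fun N g) (dyadic p) \<le> of_nat N * mass (\<lambda>_. 1) (dyadic p)"
      by (intro mass_le_mult) (auto simp: truncate_fun_le_const)
    with p show False by (simp add: density_1)
  qed
  also have "of_nat N < (\<infinity> :: ennreal)" by (simp add: of_nat_less_top)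
  finally show ?thesis .
qed

lemma dmax_mono: 
  assumes [measurable]: "f \<in> borel_measurable lebesgue" "g \<in> borel_measurable lebesgue" and "\<And>x. f x \<le> g x"
  shows "dmax f x \<le> dmax g x"
proof -
  have "mass f (dyadic p) \<le> 1 * mass g (dyadic p)" for p
    using assms(3) by (intro mass_le_mult) auto
  then show ?thesis unfolding dmax_def by (intro SUP_mono) (auto intro!: divide_right_mono_ennreal)
qed

lemma dmax_SUP_truncate_fun:
  assumes [measurable]: "g \<in> borel_measurable lebesgue" and fin: "\<And>x. g x < \<infinity>"
  shows "dmax g x = (SUP N. dmax (truncate_fun N g) x)"
proof -
  have "mass g (dyadic p) = (SUP N. mass (truncate_fun N g) (dyadic p))" for p
  proof -
    have "mass g (dyadic p) = (\<integral>\<^sup>+x. (SUP N. truncate_fun N g x * indicator (dyadic p) x) \<partial>lebesgue)"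
      by (simp add: emeasure_density SUP_mult_right_ennreal[symmetric] SUP_truncate_fun[OF fin])
    also have "\<dots> = (SUP N. \<integral>\<^sup>+x. truncate_fun N g x * indicator (dyadic p) x \<partial>lebesgue)"
      using incseq_truncate_fun[of g]
      by (intro nn_integral_monotone_convergence_SUP) (auto simp: incseq_def le_fun_def intro!: mult_right_mono)
    also have "\<dots> = (SUP N. mass (truncate_fun N g) (dyadic p))"
      by (simp add: emeasure_density)
    finally show ?thesis .
  qed
  then show ?thesis unfolding dmax_def
    by (subst SUP_commute) (simp add: SUP_divide_ennreal)
qed

text \<open>Multiplication is not continuous at \<open>(0, \<infinity>)\<close>, but suprema of increasing sequences do commute with it.\<close>

lemma prod_SUP_incseq_ennreal:
  fixes F :: "'i \<Rightarrow> nat \<Rightarrow> ennreal"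
  assumes "finite I" "\<And>i. i \<in> I \<Longrightarrow> incseq (F i)"
  shows "(\<Prod>i\<in>I. SUP N. F i N) = (SUP N. \<Prod>i\<in>I. F i N)"
  using assms
proof (induction I)
  case (insert i I)
  have inc: "incseq (\<lambda>N. \<Prod>i\<in>I. F i N)"
    using insert.prems by (intro incseq_SucI prod_mono_ennreal) (simp add: incseq_SucD)
  have "(SUP N. F i N) * (SUP N. \<Prod>i\<in>I. F i N) = (SUP N. F i N * (\<Prod>i\<in>I. F i N))"
  proof (rule antisym)
    show "(SUP N. F i N) * (SUP N. \<Prod>i\<in>I. F i N) \<le> (SUP N. F i N * (\<Prod>i\<in>I. F i N))"
      unfolding SUP_mult_left_ennreal SUP_mult_right_ennreal
    proof (intro SUP_least)
      fix M N
      have "F i M * (\<Prod>i\<in>I. F i N) \<le> F i (max M N) * (\<Prod>i\<in>I. F i (max M N))"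
        using insert.prems[of i] inc by (intro mult_mono) (auto simp: incseq_def)
      also have "\<dots> \<le> (SUP N. F i N * (\<Prod>i\<in>I. F i N))" by (rule SUP_upper) simp
      finally show "F i M * (\<Prod>i\<in>I. F i N) \<le> (SUP N. F i N * (\<Prod>i\<in>I. F i N))" .
    qed
    show "(SUP N. F i N * (\<Prod>i\<in>I. F i N)) \<le> (SUP N. F i N) * (SUP N. \<Prod>i\<in>I. F i N)"
      by (intro SUP_least mult_mono SUP_upper) auto
  qed
  then show ?case using insert by simp
qed simp

section \<open>The multilinear mixed inequality\<close>

text \<open>The superlevel set \<open>{x. v x < (\<Prod>j\<in>I. dmax (f j) x)}\<close> of the product is, for each \<open>i\<close>, the superlevel
set of \<open>dmax (f i)\<close> over this weight.\<close>

definition divided_weight :: "nat set \<Rightarrow> (nat \<Rightarrow> real ^ 'n::finite \<Rightarrow> ennreal) \<Rightarrow> (real ^ 'n \<Rightarrow> real) \<Rightarrow> nat \<Rightarrow> real ^ 'n \<Rightarrow> ennreal" where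
  "divided_weight I f v i x = ennreal (v x) / (\<Prod>j\<in>I - {i}. dmax (f j) x)"

lemma borel_measurable_divided_weight [measurable]:
  assumes [measurable]: "v \<in> borel_measurable lebesgue"
  shows "divided_weight I f v i \<in> borel_measurable lebesgue"
  unfolding divided_weight_def by measurable

text \<open>The hypothesis on \<open>C\<close> is the inequality for one function, applied to each \<open>f i\<close> with \<open>w i\<close> and the
divided weight. Confining the product of maximal functions to one dyadic layer makes the pointwise
comparison of \<open>layer_pointwise\<close> possible.\<close>

lemma mixed_layer_bound:
  fixes w :: "nat \<Rightarrow> real ^ 'n::finite \<Rightarrow> real" and v :: "real ^ 'n \<Rightarrow> real"
    and f :: "nat \<Rightarrow> real ^ 'n \<Rightarrow> ennreal" and B :: "nat \<Rightarrow> real" and m :: nat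
  assumes m: "1 \<le> m"
    and w: "\<And>i x. i \<in> {1..m} \<Longrightarrow> 0 \<le> w i x" "\<And>i. i \<in> {1..m} \<Longrightarrow> w i \<in> borel_measurable lebesgue"
    and v [measurable]: "v \<in> borel_measurable lebesgue"
    and f: "\<And>i. i \<in> {1..m} \<Longrightarrow> admissible (f i)"
    and B: "\<And>i. i \<in> {1..m} \<Longrightarrow> mass (\<lambda>x. f i x * ennreal (w i x)) UNIV = ennreal (B i)" "\<And>i. i \<in> {1..m} \<Longrightarrow> 0 < B i"
    and \<tau>: "0 < \<tau>"
    and C: "0 \<le> C" "\<And>i. i \<in> {1..m} \<Longrightarrow>
      mass (\<lambda>x. ennreal (w i x) * (ennreal \<tau> * divided_weight {1..m} f v i x)) {x. ennreal \<tau> * divided_weight {1..m} f v i x < dmax (f i) x} \<le> ennreal (C * B i)"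
  shows "(\<integral>\<^sup>+x\<in>{x. 0 < v x \<and> ennreal (\<tau> * v x) < (\<Prod>i=1..m. dmax (f i) x) \<and> (\<Prod>i=1..m. dmax (f i) x) \<le> ennreal (2 * \<tau> * v x)}.
      ennreal ((\<Prod>i=1..m. w i x powr (1 / real m)) * v x powr (1 / real m)) \<partial>lebesgue)
    \<le> ennreal (2 * \<tau> powr (- 1 / real m) * (\<Prod>i=1..m. B i) powr (1 / real m) * (real m * C))"
    (is "(\<integral>\<^sup>+x\<in>?S. ?\<nu> x \<partial>lebesgue) \<le> _")
proof -
  let ?I = "{1..m}"
  let ?A = "\<lambda>i. {x. ennreal \<tau> * divided_weight ?I f v i x < dmax (f i) x}"
  let ?k = "2 * \<tau> powr (- 1 / real m) * (\<Prod>i=1..m. B i) powr (1 / real m)"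
  have k: "0 \<le> ?k" by simp
  note [measurable] = w(2)
  define h where "h i x = ennreal (1 / B i) * (ennreal (w i x) * (ennreal \<tau> * divided_weight ?I f v i x))" for i x
  have vm [measurable]: "(\<lambda>x. ennreal (v x)) \<in> borel_measurable lebesgue" by measurable
  have hm [measurable]: "h i \<in> borel_measurable lebesgue" if "i \<in> ?I" for i
    using that unfolding h_def by measurable
  have Sm: "?A i \<in> sets lebesgue" for i
  proof -
    have "{x \<in> space lebesgue. ennreal \<tau> * divided_weight ?I f v i x < dmax (f i) x} \<in> sets lebesgue" by measurable
    then show ?thesis by simp
  qed
  have pt: "?\<nu> x \<le> ennreal ?k * (\<Sum>i\<in>?I. h i x) \<and> (\<forall>i\<in>?I. ennreal \<tau> * divided_weight ?I f v i x < dmax (f i) x)" if x: "x \<in> ?S" for x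
  proof -
    have V: "0 < v x" using x by simp
    define d where "d i = enn2real (dmax (f i) x)" for i
    have d: "dmax (f i) x = ennreal (d i)" "0 < d i" if "i \<in> ?I" for i
    proof -
      have "dmax (f i) x < top" "0 < dmax (f i) x"
        using f[OF that] admissible_dmax_pos[OF f[OF that]] by (auto simp: admissible_def)
      then show "dmax (f i) x = ennreal (d i)" "0 < d i"
        by (simp_all add: d_def enn2real_positive_iff)
    qed
    have pd: "(\<Prod>i\<in>J. dmax (f i) x) = ennreal (\<Prod>i\<in>J. d i)" if "J \<subseteq> ?I" for J
    proof -
      have "(\<Prod>i\<in>J. dmax (f i) x) = (\<Prod>i\<in>J. ennreal (d i))" using that d(1) by (intro prod.cong) auto
      also have "\<dots> = ennreal (\<Prod>i\<in>J. d i)" by (intro prod_ennreal less_imp_le d(2) subsetD[OF that])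
      finally show ?thesis .
    qed
    have Pp: "0 < (\<Prod>i\<in>J. d i)" if "J \<subseteq> ?I" for J using that d(2) by (intro prod_pos) auto
    have vv: "ennreal \<tau> * divided_weight ?I f v i x = ennreal (\<tau> * (v x / (\<Prod>j\<in>?I - {i}. d j)))" if "i \<in> ?I" for i
    proof -
      have "divided_weight ?I f v i x = ennreal (v x / (\<Prod>j\<in>?I - {i}. d j))"
        unfolding divided_weight_def pd[OF Diff_subset] using V Pp[OF Diff_subset] by (intro divide_ennreal) auto
      then show ?thesis
        using \<tau> V Pp[OF Diff_subset, of "{i}"] by (simp only: ennreal_mult less_imp_le divide_pos_pos)
    qed
    have lt: "\<tau> * v x < (\<Prod>i\<in>?I. d i)" and le: "(\<Prod>i\<in>?I. d i) \<le> 2 * \<tau> * v x"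
      using x V \<tau> Pp[of ?I] by (auto simp: pd ennreal_less_iff ennreal_le_iff)
    have "?\<nu> x \<le> ennreal (?k * (\<Sum>i\<in>?I. w i x * (\<tau> * (v x / (\<Prod>j\<in>?I - {i}. d j))) / B i))"
      using layer_pointwise[of ?I d B "\<lambda>i. w i x" "v x" \<tau>] m d(2) B(2) w(1) V \<tau> le by (intro ennreal_leI) simp
    also have "\<dots> = ennreal ?k * (\<Sum>i\<in>?I. h i x)"
    proof -
      have nn: "0 \<le> w i x * (\<tau> * (v x / (\<Prod>j\<in>?I - {i}. d j)))" if "i \<in> ?I" for i
        using w(1)[OF that] \<tau> V Pp[OF Diff_subset, of "{i}"] by simp
      have "h i x = ennreal (w i x * (\<tau> * (v x / (\<Prod>j\<in>?I - {i}. d j))) / B i)" if "i \<in> ?I" for i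
      proof -
        have "h i x = ennreal (1 / B i) * ennreal (w i x * (\<tau> * (v x / (\<Prod>j\<in>?I - {i}. d j))))"
          unfolding h_def vv[OF that] using w(1)[OF that] \<tau> V Pp[OF Diff_subset, of "{i}"]
          by (subst ennreal_mult[of "w i x"]) auto
        also have "\<dots> = ennreal (1 / B i * (w i x * (\<tau> * (v x / (\<Prod>j\<in>?I - {i}. d j)))))"
          using nn[OF that] B(2)[OF that] by (intro ennreal_mult[symmetric]) auto
        also have "1 / B i * z = z / B i" for z by simp
        finally show ?thesis .
      qed
      then have "(\<Sum>i\<in>?I. h i x) = (\<Sum>i\<in>?I. ennreal (w i x * (\<tau> * (v x / (\<Prod>j\<in>?I - {i}. d j))) / B i))"
        by (intro sum.cong) auto
      also have "\<dots> = ennreal (\<Sum>i\<in>?I. w i x * (\<tau> * (v x / (\<Prod>j\<in>?I - {i}. d j))) / B i)"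
        using nn B(2) by (intro sum_ennreal divide_nonneg_pos) auto
      finally show ?thesis
        using nn B(2) k by (simp only:) (intro ennreal_mult sum_nonneg divide_nonneg_pos; simp)
    qed
    finally have 1: "?\<nu> x \<le> ennreal ?k * (\<Sum>i\<in>?I. h i x)" .
    have 2: "ennreal \<tau> * divided_weight ?I f v i x < dmax (f i) x" if "i \<in> ?I" for i
    proof -
      have "(\<Prod>i\<in>?I. d i) = d i * (\<Prod>j\<in>?I - {i}. d j)" using that by (simp add: prod.remove)
      then have "\<tau> * (v x / (\<Prod>j\<in>?I - {i}. d j)) < d i"
        using lt Pp[OF Diff_subset, of "{i}"] by (simp add: field_simps)
      then show ?thesis unfolding vv[OF that] d(1)[OF that] using d(2)[OF that] by (intro ennreal_lessI)
    qed
    show ?thesis using 1 2 by blast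
  qed
  have "(\<integral>\<^sup>+x\<in>?S. ?\<nu> x \<partial>lebesgue)
     \<le> (\<integral>\<^sup>+x. ennreal ?k * (\<Sum>i\<in>?I. h i x * indicator (?A i) x) \<partial>lebesgue)"
  proof (rule nn_integral_mono)
    fix x
    show "?\<nu> x * indicator ?S x \<le> ennreal ?k * (\<Sum>i\<in>?I. h i x * indicator (?A i) x)"
    proof (cases "x \<in> ?S")
      case True
      have "(\<Sum>i\<in>?I. h i x * indicator (?A i) x) = (\<Sum>i\<in>?I. h i x)"
        using pt[OF True] by (intro sum.cong) auto
      then show ?thesis using pt[OF True] True by simp
    qed simp
  qed
  also have "\<dots> = ennreal ?k * (\<Sum>i\<in>?I. \<integral>\<^sup>+x. h i x * indicator (?A i) x \<partial>lebesgue)"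
  proof -
    have *: "(\<lambda>x. h i x * indicator (?A i) x) \<in> borel_measurable lebesgue" if "i \<in> ?I" for i
      by (intro borel_measurable_times_ennreal borel_measurable_indicator hm that Sm)
    show ?thesis
      by (subst nn_integral_cmult) (intro borel_measurable_sum *, simp, subst nn_integral_sum, rule *, simp_all)
  qed
  also have "\<dots> \<le> ennreal ?k * (\<Sum>i\<in>?I. ennreal C)"
  proof (intro mult_left_mono sum_mono)
    fix i assume i: "i \<in> ?I"
    note [measurable] = Sm[of i] w(2)[OF i]
    have "(\<integral>\<^sup>+x. h i x * indicator (?A i) x \<partial>lebesgue)
      = ennreal (1 / B i) * (\<integral>\<^sup>+x. ennreal (w i x) * (ennreal \<tau> * divided_weight ?I f v i x) * indicator (?A i) x \<partial>lebesgue)"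
      unfolding h_def by (subst nn_integral_cmult[symmetric]) (auto simp: mult.assoc)
    also have "(\<integral>\<^sup>+x. ennreal (w i x) * (ennreal \<tau> * divided_weight ?I f v i x) * indicator (?A i) x \<partial>lebesgue)
      = mass (\<lambda>x. ennreal (w i x) * (ennreal \<tau> * divided_weight ?I f v i x)) (?A i)"
      by (intro emeasure_density[symmetric] Sm) measurable
    also have "ennreal (1 / B i) * \<dots> \<le> ennreal (1 / B i) * ennreal (C * B i)"
      by (intro mult_left_mono C i) simp
    also have "\<dots> = ennreal C"
      using B(2)[OF i] C(1) by (subst ennreal_mult[symmetric]) auto
    finally show "(\<integral>\<^sup>+x. h i x * indicator (?A i) x \<partial>lebesgue) \<le> ennreal C" .
  qed simp
  also have "(\<Sum>i\<in>?I. ennreal C) = ennreal (real m * C)"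
    using C(1) by (subst sum_ennreal) auto
  also have "ennreal ?k * \<dots> = ennreal (?k * (real m * C))"
    using k C(1) by (intro ennreal_mult[symmetric]) auto
  finally show ?thesis .
qed

text \<open>The constants for the divided weights do not depend on the functions, so one \<open>C\<close> serves all
\<open>f\<close> and all heights.\<close>

lemma mixed_component_bound:
  fixes w :: "nat \<Rightarrow> real ^ 'n::finite \<Rightarrow> real" and v :: "real ^ 'n \<Rightarrow> real"
  assumes w: "\<And>i. i \<in> I \<Longrightarrow> A1_weight (w i)" and v: "Ainfty_weight v" and I: "finite I"
  obtains C where "0 \<le> C" "\<And>f \<tau> i. \<lbrakk>\<forall>j\<in>I. admissible (f j); 0 < \<tau>; i \<in> I\<rbrakk> \<Longrightarrow>
     mass (\<lambda>x. ennreal (w i x) * (ennreal \<tau> * divided_weight I f v i x))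
       {x. ennreal \<tau> * divided_weight I f v i x < dmax (f i) x}
     \<le> ennreal C * mass (\<lambda>x. f i x * ennreal (w i x)) UNIV"
proof -
  obtain K r where Kr: "0 < K" "0 < r" "Ainf_cond K r (\<lambda>x. ennreal (v x))"
    using v Ap_weight_imp_Ainf_cond unfolding Ainfty_weight_def by blast
  let ?P = "\<lambda>i C. \<forall>f \<tau>. (\<forall>j\<in>I. admissible (f j)) \<longrightarrow> 0 < \<tau> \<longrightarrow>
     mass (\<lambda>x. ennreal (w i x) * (ennreal \<tau> * divided_weight I f v i x))
       {x. ennreal \<tau> * divided_weight I f v i x < dmax (f i) x}
     \<le> ennreal C * mass (\<lambda>x. f i x * ennreal (w i x)) UNIV"
  have "\<exists>C\<ge>0. ?P i C" if i: "i \<in> I" for i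
  proof -
    obtain A0 where A0: "\<And>A. A0 \<le> A \<Longrightarrow> A1_cond A (\<lambda>x. ennreal (w i x))"
      using A1_weight_imp_A1_cond[OF w[OF i]] by blast
    define A where "A = max A0 1"
    have A: "1 \<le> A" "A1_cond A (\<lambda>x. ennreal (w i x))" using A0 by (auto simp: A_def)
    obtain K' r' where K': "0 < K'" "0 < r'"
      "\<And>v (f :: nat \<Rightarrow> real ^ 'n \<Rightarrow> ennreal). Ainf_cond K r v \<Longrightarrow> (\<forall>j\<in>I - {i}. admissible (f j)) \<Longrightarrow>
        Ainf_cond K' r' (\<lambda>x. v x / (\<Prod>j\<in>I - {i}. dmax (f j) x))"
      using Ainf_cond_divide_dmax_prod[of "I - {i}" K r] I Kr by blast
    obtain C where C: "C < \<infinity>" "\<And>u v f :: real ^ 'n \<Rightarrow> ennreal. \<lbrakk>A1_cond A u; Ainf_cond K' r' v; f \<in> borel_measurable lebesgue; mass f UNIV < \<infinity>\<rbrakk>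
      \<Longrightarrow> mass (\<lambda>x. u x * v x) {x. v x < dmax f x} \<le> C * mass (\<lambda>x. f x * u x) UNIV"
      using mixed_weak_type_dmax[OF A(1) K'(1,2)] by blast
    obtain c where c: "C = ennreal c" "0 \<le> c" using C(1) by (cases C) auto
    have "?P i c"
    proof (intro allI impI)
      fix f :: "nat \<Rightarrow> real ^ 'n \<Rightarrow> ennreal" and \<tau> :: real
      assume f: "\<forall>j\<in>I. admissible (f j)" and \<tau>: "0 < \<tau>"
      have "Ainf_cond K' r' (\<lambda>x. ennreal \<tau> * divided_weight I f v i x)"
        unfolding divided_weight_def using f by (intro Ainf_cond_scale K' Kr \<tau>) auto
      then show "mass (\<lambda>x. ennreal (w i x) * (ennreal \<tau> * divided_weight I f v i x))
           {x. ennreal \<tau> * divided_weight I f v i x < dmax (f i) x}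
         \<le> ennreal c * mass (\<lambda>x. f i x * ennreal (w i x)) UNIV"
        unfolding c(1)[symmetric] using f i by (intro C(2) A) (auto simp: admissible_def)
    qed
    with c show ?thesis by blast
  qed
  then have "\<forall>i\<in>I. \<exists>C. 0 \<le> C \<and> ?P i C" by (rule ballI)
  then have "\<exists>c. \<forall>i\<in>I. 0 \<le> c i \<and> ?P i (c i)" by (rule bchoice)
  then obtain c where cP: "\<forall>i\<in>I. 0 \<le> c i \<and> ?P i (c i)" by (rule exE)
  have c: "0 \<le> c i" "?P i (c i)" if "i \<in> I" for i
    using bspec[OF cP that] by (rule conjunct1) (use bspec[OF cP that] in \<open>rule conjunct2\<close>)
  show thesis
  proof (rule that[of "\<Sum>i\<in>I. c i"])
    show "0 \<le> (\<Sum>i\<in>I. c i)" using c(1) by (rule sum_nonneg)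
    fix f :: "nat \<Rightarrow> real ^ 'n \<Rightarrow> ennreal" and \<tau> :: real and i assume *: "\<forall>j\<in>I. admissible (f j)" "0 < \<tau>" "i \<in> I"
    have "c i \<le> (\<Sum>i\<in>I. c i)" using c(1) I *(3) by (intro member_le_sum) auto
    then have "ennreal (c i) * mass (\<lambda>x. f i x * ennreal (w i x)) UNIV \<le> ennreal (\<Sum>i\<in>I. c i) * mass (\<lambda>x. f i x * ennreal (w i x)) UNIV"
      by (intro mult_right_mono ennreal_leI) auto
    then show "mass (\<lambda>x. ennreal (w i x) * (ennreal \<tau> * divided_weight I f v i x))
           {x. ennreal \<tau> * divided_weight I f v i x < dmax (f i) x}
         \<le> ennreal (\<Sum>i\<in>I. c i) * mass (\<lambda>x. f i x * ennreal (w i x)) UNIV"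
      using c(2)[OF *(3)] *(1,2) by (blast intro: order_trans)
  qed
qed

lemma mass_mult_weight_pos:
  assumes "weight w" and [measurable]: "f \<in> borel_measurable lebesgue" and "mass f UNIV \<noteq> 0"
  shows "mass (\<lambda>x. f x * ennreal (w x)) UNIV \<noteq> 0"
proof
  note [measurable] = weight_borel_measurable[OF assms(1)]
  assume "mass (\<lambda>x. f x * ennreal (w x)) UNIV = 0"
  then have "(\<integral>\<^sup>+x. f x * ennreal (w x) \<partial>lebesgue) = 0" by (simp add: emeasure_density)
  then have "AE x in lebesgue. f x * ennreal (w x) = 0"
    by (subst (asm) nn_integral_0_iff_AE) auto
  with weight_AE_pos[OF assms(1)] have "AE x in lebesgue. f x = 0"
    by eventually_elim auto
  then have "(\<integral>\<^sup>+x. f x \<partial>lebesgue) = 0" by (subst nn_integral_0_iff_AE) auto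
  with assms(3) show False by (simp add: emeasure_density)
qed

text \<open>The superlevel set at height \<open>t\<close> is the union of the layers at \<open>\<tau> = 2 ^ k * t\<close>. Their bounds decay like
\<open>2 powr (- k / m)\<close> and sum up to a geometric series.\<close>

lemma mixed_bound_finite:
  fixes w :: "nat \<Rightarrow> real ^ 'n::finite \<Rightarrow> real" and v :: "real ^ 'n \<Rightarrow> real" and m :: nat
  assumes m: "1 \<le> m" and w: "\<And>i. i \<in> {1..m} \<Longrightarrow> A1_weight (w i)" and v: "Ainfty_weight v"
  obtains C where "0 \<le> C" "\<And>f t B. \<lbrakk>\<And>i. i \<in> {1..m} \<Longrightarrow> f i \<in> borel_measurable lebesgue \<and> mass (f i) UNIV < \<infinity> \<and> (\<forall>x. dmax (f i) x < \<infinity>);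
      \<And>i. i \<in> {1..m} \<Longrightarrow> mass (\<lambda>x. f i x * ennreal (w i x)) UNIV \<le> ennreal (B i); \<And>i. i \<in> {1..m} \<Longrightarrow> 0 \<le> B i; 0 < t\<rbrakk>
    \<Longrightarrow> (\<integral>\<^sup>+x\<in>{x. 0 < v x \<and> ennreal (t * v x) < (\<Prod>i=1..m. dmax (f i) x)}.
      ennreal ((\<Prod>i=1..m. w i x powr (1 / real m)) * v x powr (1 / real m)) \<partial>lebesgue)
    \<le> ennreal (C * ((\<Prod>i=1..m. B i) / t) powr (1 / real m))"
proof -
  let ?I = "{1..m}"
  have ww: "weight (w i)" if "i \<in> ?I" for i using w[OF that] by (simp add: A1_weight_def)
  have wv: "weight v" using v by (auto simp: Ainfty_weight_def Ap_weight_def)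
  note [measurable] = weight_borel_measurable[OF ww] weight_borel_measurable[OF wv]
  have w0: "0 \<le> w i x" if "i \<in> ?I" for i x using ww[OF that] by (simp add: weight_def)
  obtain C where C: "0 \<le> C" "\<And>f \<tau> i. \<lbrakk>\<forall>j\<in>?I. admissible (f j); 0 < \<tau>; i \<in> ?I\<rbrakk> \<Longrightarrow>
     mass (\<lambda>x. ennreal (w i x) * (ennreal \<tau> * divided_weight ?I f v i x))
       {x. ennreal \<tau> * divided_weight ?I f v i x < dmax (f i) x}
     \<le> ennreal C * mass (\<lambda>x. f i x * ennreal (w i x)) UNIV"
    using mixed_component_bound[of ?I w v] w v by blast
  define q where "q = (2::real) powr (- 1 / real m)"
  have q: "0 < q" "q < 1"
    using m powr_less_mono[of "- 1 / real m" 0 "2::real"] by (auto simp: q_def)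
  define C' where "C' = 2 * (real m * C) / (1 - q)"
  have C': "0 \<le> C'" using C q by (simp add: C'_def)
  let ?\<nu> = "\<lambda>x. ennreal ((\<Prod>i=1..m. w i x powr (1 / real m)) * v x powr (1 / real m))"
  have \<nu>m [measurable]: "?\<nu> \<in> borel_measurable lebesgue" by measurable
  show thesis
  proof (rule that[OF C'])
    fix f :: "nat \<Rightarrow> real ^ 'n \<Rightarrow> ennreal" and t :: real and B :: "nat \<Rightarrow> real"
    assume f: "\<And>i. i \<in> ?I \<Longrightarrow> f i \<in> borel_measurable lebesgue \<and> mass (f i) UNIV < \<infinity> \<and> (\<forall>x. dmax (f i) x < \<infinity>)"
      and B: "\<And>i. i \<in> ?I \<Longrightarrow> mass (\<lambda>x. f i x * ennreal (w i x)) UNIV \<le> ennreal (B i)" "\<And>i. i \<in> ?I \<Longrightarrow> 0 \<le> B i"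
      and t: "0 < t"
    let ?D = "\<lambda>x. \<Prod>i=1..m. dmax (f i) x"
    let ?S = "{x. 0 < v x \<and> ennreal (t * v x) < ?D x}"
    show "(\<integral>\<^sup>+x\<in>?S. ?\<nu> x \<partial>lebesgue) \<le> ennreal (C' * ((\<Prod>i=1..m. B i) / t) powr (1 / real m))"
    \<comment> \<open>If one function vanishes almost everywhere, the product of maximal functions is zero and the superlevel set is empty.\<close>
    proof (cases "\<exists>i\<in>?I. mass (f i) UNIV = 0")
      case True
      then obtain i where i: "i \<in> ?I" "mass (f i) UNIV = 0" by blast
      then have D0: "?D x = 0" for x by (intro prod_zero bexI[of _ i] dmax_eq_0) auto
      have "?S = {}" by (simp only: D0 not_less_zero simp_thms Collect_empty_eq)
      then show ?thesis by (simp only:) simp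
    next
      case False
      then have adm: "\<forall>i\<in>?I. admissible (f i)" using f by (auto simp: admissible_def)
      define b where "b i = enn2real (mass (\<lambda>x. f i x * ennreal (w i x)) UNIV)" for i
      have b: "mass (\<lambda>x. f i x * ennreal (w i x)) UNIV = ennreal (b i)" "0 < b i" "b i \<le> B i" if i: "i \<in> ?I" for i
      proof -
        have "mass (\<lambda>x. f i x * ennreal (w i x)) UNIV \<noteq> 0"
          using f[OF i] False i by (intro mass_mult_weight_pos ww) auto
        moreover have "mass (\<lambda>x. f i x * ennreal (w i x)) UNIV \<noteq> top"
          using B(1)[OF i] by (rule neq_top_trans[rotated]) simp
        ultimately show 1: "mass (\<lambda>x. f i x * ennreal (w i x)) UNIV = ennreal (b i)" "0 < b i"
          by (simp_all add: b_def enn2real_positive_iff less_top zero_less_iff_neq_zero)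
        show "b i \<le> B i" using B(1)[OF i] B(2)[OF i] 1 by (simp add: ennreal_le_iff)
      qed
      let ?R = "2 * t powr (- 1 / real m) * (\<Prod>i=1..m. b i) powr (1 / real m) * (real m * C)"
      define \<tau> where "\<tau> k = 2 ^ k * t" for k :: nat
      have \<tau>: "0 < \<tau> k" for k using t by (simp add: \<tau>_def)
      let ?L = "\<lambda>k. {x. 0 < v x \<and> ennreal (\<tau> k * v x) < ?D x \<and> ?D x \<le> ennreal (2 * \<tau> k * v x)}"
      have Lm: "?L k \<in> sets lebesgue" for k
      proof -
        have "{x \<in> space lebesgue. 0 < v x \<and> ennreal (\<tau> k * v x) < ?D x \<and> ?D x \<le> ennreal (2 * \<tau> k * v x)} \<in> sets lebesgue"
          by measurable
        then show ?thesis by simp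
      qed
      have "?S \<subseteq> (\<Union>k. ?L k)"
      proof
        fix x assume x: "x \<in> ?S"
        have "?D x < top" using adm by (auto simp: admissible_def less_top[symmetric] ennreal_prod_eq_top)
        then obtain P where P: "?D x = ennreal P" "0 \<le> P" by (cases "?D x") auto
        have tv: "0 < t * v x" "t * v x < P" using x t P by (auto simp: ennreal_less_iff)
        obtain l where l: "2 powi l < P / (t * v x)" "P / (t * v x) \<le> 2 powi (l + 1)"
          using powi_bracket[of 2 "P / (t * v x)"] tv by auto
        have "0 \<le> l"
        proof (rule ccontr)
          assume "\<not> 0 \<le> l"
          then have "(2::real) powi (l + 1) \<le> 2 powi 0" by (intro power_int_increasing) auto
          with l(2) have "P / (t * v x) \<le> 1" by simp
          then have "P \<le> t * v x" using tv by (simp only: pos_divide_le_eq mult_1)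
          with tv show False by simp
        qed
        then obtain k where k: "l = int k" using nonneg_int_cases by blast
        have "2 ^ k * (t * v x) < P" "P \<le> 2 * 2 ^ k * (t * v x)"
          using l tv unfolding k by (simp_all add: power_int_add field_simps)
        then have "x \<in> ?L k" using x P t tv by (simp add: \<tau>_def ennreal_less_iff ennreal_leI mult_ac)
        then show "x \<in> (\<Union>k. ?L k)" by blast
      qed
      then have "(\<integral>\<^sup>+x\<in>?S. ?\<nu> x \<partial>lebesgue) \<le> (\<integral>\<^sup>+x\<in>(\<Union>k. ?L k). ?\<nu> x \<partial>lebesgue)"
        by (intro nn_integral_mono) (auto split: split_indicator)
      also have "\<dots> = mass ?\<nu> (\<Union>k. ?L k)"
        using Lm by (intro emeasure_density[symmetric] \<nu>m sets.countable_UN) auto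
      also have "\<dots> \<le> (\<Sum>k. mass ?\<nu> (?L k))"
        using Lm by (intro emeasure_subadditive_countably) auto
      also have "\<dots> \<le> (\<Sum>k. ennreal (?R * q ^ k))"
      proof (rule suminf_le)
        fix k
        have "mass ?\<nu> (?L k) = (\<integral>\<^sup>+x\<in>?L k. ?\<nu> x \<partial>lebesgue)"
          using Lm by (intro emeasure_density \<nu>m)
        also have "\<dots> \<le> ennreal (2 * \<tau> k powr (- 1 / real m) * (\<Prod>i=1..m. b i) powr (1 / real m) * (real m * C))"
        proof (rule mixed_layer_bound[OF m _ _ _ _ b(1,2) \<tau> C(1)])
          fix i assume i: "i \<in> ?I"
          show "mass (\<lambda>x. ennreal (w i x) * (ennreal (\<tau> k) * divided_weight ?I f v i x))
             {x. ennreal (\<tau> k) * divided_weight ?I f v i x < dmax (f i) x} \<le> ennreal (C * b i)"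
            using C(2)[OF adm \<tau> i, of k] b(2)[OF i] C(1) unfolding b(1)[OF i] by (simp add: ennreal_mult less_imp_le)
        qed (use adm w0 weight_borel_measurable ww wv in auto)
        also have "\<tau> k powr (- 1 / real m) = t powr (- 1 / real m) * q ^ k"
        proof -
          have "((2::real) ^ k) powr (- 1 / real m) = q ^ k"
            unfolding q_def by (simp add: powr_realpow[symmetric] powr_powr mult.commute)
          then show ?thesis by (simp add: \<tau>_def powr_mult)
        qed
        finally show "mass ?\<nu> (?L k) \<le> ennreal (?R * q ^ k)"
          by (simp add: mult_ac)
      qed auto
      also have "\<dots> = ennreal (\<Sum>k. ?R * q ^ k)"
        using q C(1) by (intro suminf_ennreal2 summable_mult summable_geometric) auto
      also have "(\<Sum>k. ?R * q ^ k)
        = C' * ((\<Prod>i=1..m. b i) / t) powr (1 / real m)"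
      proof -
        have "(\<Sum>k. q ^ k) = 1 / (1 - q)" using q by (intro suminf_geometric) auto
        moreover have "t powr (- 1 / real m) = 1 / t powr (1 / real m)"
          by (simp add: powr_minus_divide)
        ultimately show ?thesis
          using q by (subst suminf_mult) (auto simp: C'_def powr_divide mult_ac intro!: summable_geometric)
      qed
      also have "ennreal (C' * ((\<Prod>i=1..m. b i) / t) powr (1 / real m)) \<le> ennreal (C' * ((\<Prod>i=1..m. B i) / t) powr (1 / real m))"
      proof (intro ennreal_leI mult_left_mono C' powr_mono2 divide_right_mono prod_mono)
        show "0 \<le> (\<Prod>i=1..m. b i) / t" using t b(2) by (intro divide_nonneg_pos prod_nonneg) (auto intro: less_imp_le)
        fix i assume "i \<in> ?I"
        then show "0 \<le> b i \<and> b i \<le> B i" using b(2,3)[of i] by auto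
      qed (use t in auto)
      finally show ?thesis .
    qed
  qed
qed

lemma powr_root_power: "0 \<le> (x::real) \<Longrightarrow> 1 \<le> m \<Longrightarrow> (x powr (1 / real m)) powr real m = x"
  by (simp add: powr_powr)

theorem theorem1p4:
  fixes m :: nat
    and w :: "nat \<Rightarrow> real ^ 'n \<Rightarrow> real"
    and v :: "real ^ 'n \<Rightarrow> real"
  defines "\<nu> \<equiv> (\<lambda>x. \<Prod>i=1..m. w i x powr (1 / real m))"
  assumes "1 \<le> m"
    and "\<And>i. i \<in> {1..m} \<Longrightarrow> A1_weight (w i)"
    and "Ainfty_weight v"
  shows "\<exists>C<\<infinity>. \<forall>f :: nat \<Rightarrow> real ^ 'n \<Rightarrow> complex.
    (\<forall>i\<in>{1..m}. f i \<in> L1_space (w i)) \<longrightarrow>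
    weak_Lp_norm (1 / real m) (\<lambda>x. \<nu> x * v x powr (1 / real m))
      (\<lambda>x. (\<Prod>i=1..m. HL_maximal (f i) x) / ennreal (v x))
    \<le> C * (\<Prod>i=1..m. L1_norm (w i) (f i))"
proof (rule mixed_bound_finite[OF assms(2-4)])
  let ?I = "{1..m}"
  fix C :: real
  assume C: "0 \<le> C" "\<And>f t B. \<lbrakk>\<And>i. i \<in> ?I \<Longrightarrow> f i \<in> borel_measurable lebesgue \<and> mass (f i) UNIV < \<infinity> \<and> (\<forall>x. dmax (f i) x < \<infinity>);
      \<And>i. i \<in> ?I \<Longrightarrow> mass (\<lambda>x. f i x * ennreal (w i x)) UNIV \<le> ennreal (B i); \<And>i. i \<in> ?I \<Longrightarrow> 0 \<le> B i; 0 < t\<rbrakk>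
    \<Longrightarrow> (\<integral>\<^sup>+x\<in>{x. 0 < v x \<and> ennreal (t * v x) < (\<Prod>i=1..m. dmax (f i) x)}.
      ennreal ((\<Prod>i=1..m. w i x powr (1 / real m)) * v x powr (1 / real m)) \<partial>lebesgue)
    \<le> ennreal (C * ((\<Prod>i=1..m. B i) / t) powr (1 / real m))"
  have ww: "weight (w i)" if "i \<in> ?I" for i using assms(3)[OF that] by (simp add: A1_weight_def)
  have wv: "weight v" using assms(4) by (auto simp: Ainfty_weight_def Ap_weight_def)
  note [measurable] = weight_borel_measurable[OF ww] weight_borel_measurable[OF wv]
  let ?\<nu> = "\<lambda>x. ennreal (\<nu> x * v x powr (1 / real m))"
  have \<nu>m [measurable]: "?\<nu> \<in> borel_measurable lebesgue" unfolding \<nu>_def by measurable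
  define a :: real where "a = 6 ^ (CARD('n) * m)"
  have a: "0 < a" by (simp add: a_def)
  show ?thesis
  proof (intro exI[of _ "ennreal (C ^ m * a)"] conjI allI impI)
    show "ennreal (C ^ m * a) < \<infinity>" by simp
    fix f :: "nat \<Rightarrow> real ^ 'n \<Rightarrow> complex"
    assume f: "\<forall>i\<in>?I. f i \<in> L1_space (w i)"
    have fm: "f i \<in> borel_measurable lebesgue" if "i \<in> ?I" for i
      using f that by (simp add: L1_space_def)
    define g where "g i y = ennreal (norm (f i y))" for i y
    have gm [measurable]: "g i \<in> borel_measurable lebesgue" if "i \<in> ?I" for i
      using fm[OF that] unfolding g_def[abs_def] by measurable
    define B where "B i = enn2real (L1_norm (w i) (f i))" for i
    have B: "L1_norm (w i) (f i) = ennreal (B i)" "0 \<le> B i" if "i \<in> ?I" for i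
      using f that by (simp_all add: L1_space_def B_def)
    have gB: "mass (\<lambda>x. g i x * ennreal (w i x)) UNIV = ennreal (B i)" if i: "i \<in> ?I" for i
    proof -
      note [measurable] = gm[OF i] weight_borel_measurable[OF ww[OF i]]
      have "mass (\<lambda>x. g i x * ennreal (w i x)) UNIV = (\<integral>\<^sup>+x. g i x * ennreal (w i x) \<partial>lebesgue)"
        by (simp add: emeasure_density)
      also have "\<dots> = L1_norm (w i) (f i)"
        unfolding L1_norm_def g_def using ww[OF i] by (intro nn_integral_cong) (simp add: ennreal_mult weight_def)
      finally show ?thesis using B(1)[OF i] by simp
    qed
    have prodB: "(\<Prod>i=1..m. L1_norm (w i) (f i)) = ennreal (\<Prod>i=1..m. B i)"
    proof -
      have "(\<Prod>i=1..m. L1_norm (w i) (f i)) = (\<Prod>i=1..m. ennreal (B i))"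
        by (intro prod.cong refl B(1))
      also have "\<dots> = ennreal (\<Prod>i=1..m. B i)" by (intro prod_ennreal B(2))
      finally show ?thesis .
    qed
    let ?D = "\<lambda>x. \<Prod>i=1..m. dmax (g i) x"
    let ?D' = "\<lambda>N x. \<Prod>i=1..m. dmax (truncate_fun N (g i)) x"
    let ?R = "\<lambda>t. ennreal (C * ((\<Prod>i=1..m. B i) / t) powr (1 / real m))"
    \<comment> \<open>Truncation makes the functions integrable with bounded maximal functions; the superlevel sets of the truncations increase to the full one.\<close>
    have bound: "(\<integral>\<^sup>+x\<in>{x. 0 < v x \<and> ennreal (t * v x) < ?D x}. ?\<nu> x \<partial>lebesgue) \<le> ?R t"
      if t: "0 < t" for t
    proof -
      let ?S = "\<lambda>N. {x. 0 < v x \<and> ennreal (t * v x) < ?D' N x}"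
      have Dm: "?D' N \<in> borel_measurable lebesgue" for N by measurable
      have Sm: "?S N \<in> sets lebesgue" for N
      proof -
        note [measurable] = Dm[of N]
        have "{x \<in> space lebesgue. 0 < v x \<and> ennreal (t * v x) < ?D' N x} \<in> sets lebesgue" by measurable
        then show ?thesis by simp
      qed
      have inc: "incseq (\<lambda>N. dmax (truncate_fun N (g i)) x)" if "i \<in> ?I" for i x
        using incseq_truncate_fun[of "g i"] gm[OF that]
        by (intro incseq_SucI dmax_mono truncate_fun_measurable) (auto simp: incseq_def le_fun_def)
      have D: "?D x = (SUP N. ?D' N x)" for x
      proof -
        have "?D x = (\<Prod>i=1..m. SUP N. dmax (truncate_fun N (g i)) x)"
          using gm by (intro prod.cong dmax_SUP_truncate_fun) (auto simp: g_def)
        also have "\<dots> = (SUP N. ?D' N x)" using inc by (intro prod_SUP_incseq_ennreal) auto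
        finally show ?thesis .
      qed
      have incS: "incseq ?S"
      proof (intro incseq_SucI subsetI)
        fix N x assume "x \<in> ?S N"
        moreover have "?D' N x \<le> ?D' (Suc N) x"
          using inc by (intro prod_mono_ennreal) (auto dest: incseq_SucD)
        ultimately show "x \<in> ?S (Suc N)" by (auto intro: less_le_trans)
      qed
      have "{x. 0 < v x \<and> ennreal (t * v x) < ?D x} = (\<Union>N. ?S N)"
        unfolding D less_SUP_iff by auto
      then have "(\<integral>\<^sup>+x\<in>{x. 0 < v x \<and> ennreal (t * v x) < ?D x}. ?\<nu> x \<partial>lebesgue) = mass ?\<nu> (\<Union>N. ?S N)"
        using Sm by (simp only:) (intro emeasure_density[symmetric] \<nu>m sets.countable_UN; auto)
      also have "\<dots> = (SUP N. mass ?\<nu> (?S N))"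
        using Sm incS by (intro SUP_emeasure_incseq[symmetric]) auto
      also have "\<dots> \<le> ?R t"
      proof (rule SUP_least)
        fix N
        have "mass ?\<nu> (?S N) = (\<integral>\<^sup>+x\<in>?S N. ?\<nu> x \<partial>lebesgue)"
          using Sm by (intro emeasure_density \<nu>m)
        also have "\<dots> \<le> ?R t"
        proof (unfold \<nu>_def, rule C(2)[OF _ _ _ t])
          fix i assume i: "i \<in> ?I"
          note [measurable] = gm[OF i] weight_borel_measurable[OF ww[OF i]]
          show "truncate_fun N (g i) \<in> borel_measurable lebesgue \<and> mass (truncate_fun N (g i)) UNIV < \<infinity> \<and> (\<forall>x. dmax (truncate_fun N (g i)) x < \<infinity>)"
            by (intro conjI allI mass_truncate_fun_finite dmax_truncate_fun_finite truncate_fun_measurable) measurable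
          have "mass (\<lambda>x. truncate_fun N (g i) x * ennreal (w i x)) UNIV \<le> 1 * mass (\<lambda>x. g i x * ennreal (w i x)) UNIV"
            by (intro mass_le_mult) (auto intro!: mult_right_mono truncate_fun_le)
          then show "mass (\<lambda>x. truncate_fun N (g i) x * ennreal (w i x)) UNIV \<le> ennreal (B i)"
            using gB[OF i] by simp
          show "0 \<le> B i" by (rule B(2)[OF i])
        qed
        finally show "mass ?\<nu> (?S N) \<le> ?R t" .
      qed
      finally show ?thesis .
    qed
    show "weak_Lp_norm (1 / real m) (\<lambda>x. \<nu> x * v x powr (1 / real m))
      (\<lambda>x. (\<Prod>i=1..m. HL_maximal (f i) x) / ennreal (v x))
      \<le> ennreal (C ^ m * a) * (\<Prod>i=1..m. L1_norm (w i) (f i))"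
      unfolding weak_Lp_norm_def
    proof (rule SUP_least)
      fix t :: real assume "t \<in> {0<..}"
      then have t: "0 < t" by simp
      let ?E = "{x. ennreal t < (\<Prod>i=1..m. HL_maximal (f i) x) / ennreal (v x)}"
      \<comment> \<open>The factor \<open>a\<close> is the price for replacing \<open>m\<close> maximal functions by \<open>dmax\<close>.\<close>
      have sub: "0 < v x \<and> ennreal (t / a * v x) < ?D x" if x: "x \<in> ?E" "?\<nu> x \<noteq> 0" for x
      proof -
        have "0 \<le> v x" using wv by (simp add: weight_def)
        moreover have "v x \<noteq> 0" using x(2) by auto
        ultimately have vx: "0 < v x" by simp
        have "(\<Prod>i=1..m. HL_maximal (f i) x) \<le> (\<Prod>i=1..m. 6 ^ CARD('n) * dmax (g i) x)"
          using HL_maximal_le_dmax fm unfolding g_def[abs_def] by (intro prod_mono_ennreal) auto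
        also have "\<dots> = ennreal a * ?D x"
          by (simp add: prod.distrib a_def power_mult ennreal_power[symmetric])
        finally have "ennreal t * ennreal (v x) < ennreal a * ?D x"
          using x(1) less_divide_ennreal_real_iff[OF vx] by (auto intro: less_le_trans)
        moreover have "ennreal t * ennreal (v x) = ennreal a * ennreal (t / a * v x)"
          using t vx a by (simp add: ennreal_mult[symmetric])
        ultimately have "ennreal a * ennreal (t / a * v x) < ennreal a * ?D x" by simp
        then have "ennreal (t / a * v x) < ?D x"
          by (meson mult_left_mono not_le zero_le)
        with vx show ?thesis by blast
      qed
      have "(\<integral>\<^sup>+x\<in>?E. ?\<nu> x \<partial>lebesgue) \<le> (\<integral>\<^sup>+x\<in>{x. 0 < v x \<and> ennreal (t / a * v x) < ?D x}. ?\<nu> x \<partial>lebesgue)"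
      proof (rule nn_integral_mono)
        fix x
        show "?\<nu> x * indicator ?E x \<le> ?\<nu> x * indicator {x. 0 < v x \<and> ennreal (t / a * v x) < ?D x} x"
          using sub[of x] by (cases "?\<nu> x = 0") (auto split: split_indicator)
      qed
      also have "\<dots> \<le> ennreal (C * ((\<Prod>i=1..m. B i) / (t / a)) powr (1 / real m))"
        using t a by (intro bound) simp
      finally have le: "(\<integral>\<^sup>+x\<in>?E. ?\<nu> x \<partial>lebesgue) \<le> ennreal (C * ((\<Prod>i=1..m. B i) / (t / a)) powr (1 / real m))" .
      then obtain y where y: "(\<integral>\<^sup>+x\<in>?E. ?\<nu> x \<partial>lebesgue) = ennreal y" "0 \<le> y"
        by (cases "\<integral>\<^sup>+x\<in>?E. ?\<nu> x \<partial>lebesgue") (auto simp: top_unique)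
      have P: "0 \<le> (\<Prod>i=1..m. B i)" using B(2) by (intro prod_nonneg) auto
      have Q: "0 \<le> (\<Prod>i=1..m. B i) / (t / a)" using P t a by simp
      have yle: "y \<le> C * ((\<Prod>i=1..m. B i) / (t / a)) powr (1 / real m)"
        using le y C(1) by (simp add: ennreal_le_iff)
      have "y powr real m \<le> (C * ((\<Prod>i=1..m. B i) / (t / a)) powr (1 / real m)) powr real m"
        using yle y by (intro powr_mono2) auto
      also have "\<dots> = C powr real m * ((\<Prod>i=1..m. B i) / (t / a))"
        using assms(2) Q by (simp only: powr_mult powr_root_power)
      also have "C powr real m = C ^ m" using C(1) assms(2) by (simp add: powr_realpow')
      finally have "t * y powr real m \<le> t * (C ^ m * ((\<Prod>i=1..m. B i) / (t / a)))"
        using t by (intro mult_left_mono) auto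
      also have "\<dots> = C ^ m * a * (\<Prod>i=1..m. B i)" using t by simp
      finally have "ennreal (t * y powr real m) \<le> ennreal (C ^ m * a * (\<Prod>i=1..m. B i))" by (rule ennreal_leI)
      also have "\<dots> = ennreal (C ^ m * a) * ennreal (\<Prod>i=1..m. B i)"
        using C(1) a P by (intro ennreal_mult) auto
      finally show "ennreal t * ennpowr (\<integral>\<^sup>+x\<in>?E. ?\<nu> x \<partial>lebesgue) (1 / (1 / real m))
        \<le> ennreal (C ^ m * a) * (\<Prod>i=1..m. L1_norm (w i) (f i))"
        unfolding prodB y(1) using y(2) t by (simp add: ennpowr_def ennreal_mult)
    qed
  qed
qed

end
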